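(* Let $\Lambda_c$ be the conifold algebra, let $\mathbb{A}^4\subset\mathrm{trep}_2\Lambda_c$ be the affine space of representations in canonical form and $T\subset\mathrm{GL}_2$ the diagonal torus. Under the action map $$\mathrm{GL}_2\times\mathbb{A}^4\longrightarrow\mathrm{trep}_2\Lambda_c,\qquad (g,P)\mapsto g.P,$$ two points $(g,P)$ and $(g',P')$ are mapped to the same point if and only if they belong to the same $T$-orbit in $\mathrm{GL}_2\times\mathbb{A}^4$. That is, one can identify $\mathrm{trep}_2\Lambda_c$ with the principal fiber bundle $$\mathrm{trep}_2\Lambda_c\simeq\mathrm{GL}_2\times^T\mathbb{A}^4=(\mathrm{GL}_2\times\mathbb{A}^4)/T .$$ In particular, there is a natural one-to-one correspondence between $\mathrm{GL}_2$-orbits in $\mathrm{trep}_2\Lambda_c$ and $T$-orbits in $\mathbb{A}^4$. The $T$-action on $\mathbb{A}^4$ can be identified with the $\mathrm{GL}(\alpha)$-action on the representation space $\mathrm{rep}_\alpha Q$, where $Q$ is the quiver with two vertices, two arrows from the first vertex to the second and two arrows from the second vertex to the first, and $\alpha=(1,1)$. In particular, the conifold algebra $\Lambda_c$ is isomorphic to the quiver-order $\int_\alpha\mathbb{C}Q$.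
   Context: The conifold algebra is $$\Lambda_c=\frac{\mathbb{C}\langle X,Y,Z\rangle}{(Z^2-1,\ XZ+ZX,\ YZ+ZY,\ [X^2,Y],\ [Y^2,X])},\qquad [A,B]=AB-BA.$$ $\mathrm{trep}_2\Lambda_c$ is the variety of algebra maps $\phi:\Lambda_c\to M_2(\mathbb{C})$ with $\mathrm{Tr}\,\phi(X)=\mathrm{Tr}\,\phi(Y)=\mathrm{Tr}\,\phi(Z)=0$ (the trace preserving $2$-dimensional representations), on which $\mathrm{GL}_2$ acts by simultaneous conjugation. $\mathbb{A}^4\subset\mathrm{trep}_2\Lambda_c$ is the closed subvariety of representations of the form $$X\mapsto\begin{bmatrix} 0 & x_2 \\ x_3 & 0 \end{bmatrix},\quad Y\mapsto\begin{bmatrix} 0 & y_2 \\ y_3 & 0 \end{bmatrix},\quad Z\mapsto\begin{bmatrix} 1 & 0 \\ 0 & -1 \end{bmatrix},$$ with coordinates $(x_2,x_3,y_2,y_3)$. $T=\{\mathrm{diag}(\lambda,\mu):\lambda,\mu\in\mathbb{C}^*\}\subset\mathrm{GL}_2$ is the stabilizer of $\mathrm{diag}(1,-1)$; it acts on $\mathbb{A}^4$ by simultaneous conjugation and on $\mathrm{GL}_2\times\mathbb{A}^4$ by $t.(g,P)=(gt^{-1},t.P)$. For a quiver $Q$ on $k$ vertices and a dimension vector $\alpha=(a_1,\dots,a_k)$ with $n=\sum a_i$, $\mathrm{rep}_\alpha Q$ is the affine space of $\alpha$-dimensional representations, $\mathrm{GL}(\alpha)=\prod\mathrm{GL}_{a_i}$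 acts on it by base change, and $\int_\alpha\mathbb{C}Q$ denotes the algebra of $\mathrm{GL}_n$-equivariant polynomial maps $\mathrm{GL}_n\times^{\mathrm{GL}(\alpha)}\mathrm{rep}_\alpha Q\to M_n(\mathbb{C})$, with $\mathrm{GL}_n$ acting on $M_n(\mathbb{C})$ by conjugation. *)

theory Defs
  imports
    "HOL-Algebra.QuotRing"
    "HOL-Algebra.Group_Action"
    "HOL-Algebra.Product_Groups"
    "HOL-Library.Poly_Mapping"
    "Jordan_Normal_Form.Determinant"
begin

section \<open>Complex algebras\<close>

text \<open>
  A possibly noncommutative unital complex algebra is carried by a
  \<^typ>\<open>(complex, 'a) module\<close> record: a ring together with a scalar multiplication.
\<close>

definition alg_hom :: "(complex, 'a) module \<Rightarrow> (complex, 'b) module \<Rightarrow> ('a \<Rightarrow> 'b) set" where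
  "alg_hom A B = {h \<in> Ring.ring_hom A B.
     \<forall>c. \<forall>x\<in>carrier A. h (c \<odot>\<^bsub>A\<^esub> x) = c \<odot>\<^bsub>B\<^esub> h x}"

definition alg_iso :: "(complex, 'a) module \<Rightarrow> (complex, 'b) module \<Rightarrow> ('a \<Rightarrow> 'b) set" where
  "alg_iso A B = {h \<in> alg_hom A B. bij_betw h (carrier A) (carrier B)}"

definition quot_alg :: "(complex, 'a) module \<Rightarrow> 'a set \<Rightarrow> (complex, 'a set) module" where
  "quot_alg A I =
     \<lparr>carrier = carrier (A Quot I), monoid.mult = monoid.mult (A Quot I), one = monoid.one (A Quot I),
      zero = ring.zero (A Quot I), add = ring.add (A Quot I),
      module.smult = (\<lambda>c S. \<Union>a\<in>S. I +>\<^bsub>A\<^esub> (c \<odot>\<^bsub>A\<^esub> a))\<rparr>"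


section \<open>The conifold algebra\<close>

datatype gen = GX | GY | GZ

datatype word = Word (letters: "gen list")

instantiation word :: monoid_add
begin

definition zero_word :: word where "zero_word = Word []"

definition plus_word :: "word \<Rightarrow> word \<Rightarrow> word" where
  "plus_word u v = Word (letters u @ letters v)"

instance
  by standard (simp_all add: zero_word_def plus_word_def)

end

text \<open>
  Words form a (noncommutative) monoid, written additively, under concatenation. Hence
  \<^typ>\<open>word \<Rightarrow>\<^sub>0 complex\<close> with its convolution product is the free algebra on three letters.
\<close>

definition free_alg :: "(complex, word \<Rightarrow>\<^sub>0 complex) module" where
  "free_alg = \<lparr>carrier = UNIV, monoid.mult = (*), one = 1, zero = 0, add = (+),
     module.smult = (\<lambda>c p. Poly_Mapping.single 0 c * p)\<rparr>"

definition letter :: "gen \<Rightarrow> (word \<Rightarrow>\<^sub>0 complex)" where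
  "letter w = Poly_Mapping.single (Word [w]) 1"

definition commutator :: "'a::ring \<Rightarrow> 'a \<Rightarrow> 'a" where
  "commutator a b = a * b - b * a"

definition conifold_rels :: "(word \<Rightarrow>\<^sub>0 complex) set" where
  "conifold_rels = (let X = letter GX; Y = letter GY; Z = letter GZ in
     {Z ^ 2 - 1, X * Z + Z * X, Y * Z + Z * Y, commutator (X ^ 2) Y, commutator (Y ^ 2) X})"

definition conifold_ideal :: "(word \<Rightarrow>\<^sub>0 complex) set" where
  "conifold_ideal = Idl\<^bsub>free_alg\<^esub> conifold_rels"

definition conifold_alg :: "(complex, (word \<Rightarrow>\<^sub>0 complex) set) module" where
  "conifold_alg = quot_alg free_alg conifold_ideal"

definition cgen :: "gen \<Rightarrow> (word \<Rightarrow>\<^sub>0 complex) set" where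
  "cgen w = conifold_ideal +>\<^bsub>free_alg\<^esub> letter w"


section \<open>Affine varieties\<close>

text \<open>
  An affine variety is represented by its set of points together with its algebra of regular
  functions. Regular functions are total functions on the ambient type; their values off
  the set of points are irrelevant.
\<close>

record 'a variety =
  points :: "'a set"
  regular :: "('a \<Rightarrow> complex) set"

inductive_set poly_fun :: "('a \<Rightarrow> complex) set \<Rightarrow> ('a \<Rightarrow> complex) set"
  for C :: "('a \<Rightarrow> complex) set" where
  coord: "f \<in> C \<Longrightarrow> f \<in> poly_fun C"
| const: "(\<lambda>_. c) \<in> poly_fun C"
| add: "f \<in> poly_fun C \<Longrightarrow> g \<in> poly_fun C \<Longrightarrow> (\<lambda>x. f x + g x) \<in> poly_fun C"
| mult: "f \<in> poly_fun C \<Longrightarrow> g \<in> poly_fun C \<Longrightarrow> (\<lambda>x. f x * g x) \<in> poly_fun C"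

text \<open>The variety with set of points \<open>S\<close> and coordinate functions \<open>C\<close>.\<close>

definition affine_var :: "'a set \<Rightarrow> ('a \<Rightarrow> complex) set \<Rightarrow> 'a variety" where
  "affine_var S C = \<lparr>points = S, regular = {f. \<exists>p\<in>poly_fun C. \<forall>x\<in>S. f x = p x}\<rparr>"

definition prod_var :: "'a variety \<Rightarrow> 'b variety \<Rightarrow> ('a \<times> 'b) variety" where
  "prod_var V W = affine_var (points V \<times> points W)
     ((\<lambda>f. f \<circ> fst) ` regular V \<union> (\<lambda>f. f \<circ> snd) ` regular W)"

definition principal_open :: "'a variety \<Rightarrow> ('a \<Rightarrow> complex) \<Rightarrow> 'a variety" where
  "principal_open V f = affine_var {x \<in> points V. f x \<noteq> 0}
     (insert (\<lambda>x. inverse (f x)) (regular V))"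

definition var_morphism :: "'a variety \<Rightarrow> 'b variety \<Rightarrow> ('a \<Rightarrow> 'b) \<Rightarrow> bool" where
  "var_morphism V W \<phi> \<longleftrightarrow> \<phi> \<in> points V \<rightarrow> points W \<and> (\<forall>f\<in>regular W. f \<circ> \<phi> \<in> regular V)"

definition var_iso :: "'a variety \<Rightarrow> 'b variety \<Rightarrow> ('a \<Rightarrow> 'b) \<Rightarrow> bool" where
  "var_iso V W \<phi> \<longleftrightarrow> bij_betw \<phi> (points V) (points W) \<and>
     var_morphism V W \<phi> \<and> var_morphism W V (inv_into (points V) \<phi>)"

text \<open>
  The quotient of \<open>V\<close> by \<open>G\<close>: the points are the orbits and the regular functions are the
  \<open>G\<close>-invariant regular functions on \<open>V\<close>. It is used only for free actions of reductive groups
  on affine varieties, where this is the geometric quotient.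
\<close>

definition quot_var ::
  "'a variety \<Rightarrow> ('g, 'b) monoid_scheme \<Rightarrow> ('g \<Rightarrow> 'a \<Rightarrow> 'a) \<Rightarrow> 'a set variety" where
  "quot_var V G act = \<lparr>points = orbits G (points V) act,
     regular = {f. (\<lambda>x. f (orbit G act x)) \<in> regular V}\<rparr>"

text \<open>
  Zariski locally trivial principal bundles \<open>\<pi> : E \<rightarrow> B\<close> for the group \<open>G\<close> (with underlying
  variety \<open>GV\<close>) acting on \<open>E\<close> from the left: locally on \<open>B\<close>, the total space is
  \<open>G\<close>-equivariantly isomorphic over \<open>B\<close> to the product of the base with \<open>G\<close>.
\<close>

definition principal_bundle ::
  "('g, 'c) monoid_scheme \<Rightarrow> 'g variety \<Rightarrow> ('g \<Rightarrow> 'a \<Rightarrow> 'a) \<Rightarrow>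
     'a variety \<Rightarrow> 'b variety \<Rightarrow> ('a \<Rightarrow> 'b) \<Rightarrow> bool" where
  "principal_bundle G GV act E B \<pi> \<longleftrightarrow>
     var_morphism E B \<pi> \<and>
     (\<forall>b\<in>points B. \<exists>f\<in>regular B. f b \<noteq> 0 \<and>
        (\<exists>\<tau>. var_iso (prod_var (principal_open B f) GV) (principal_open E (f \<circ> \<pi>)) \<tau> \<and>
             (\<forall>u\<in>points (principal_open B f). \<forall>h\<in>carrier G.
                \<pi> (\<tau> (u, h)) = u \<and>
                (\<forall>k\<in>carrier G. \<tau> (u, k \<otimes>\<^bsub>G\<^esub> h) = act k (\<tau> (u, h))))))"


section \<open>Matrices and general linear groups\<close>

abbreviation mat_alg :: "nat \<Rightarrow> (complex, complex mat) module" where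
  "mat_alg n \<equiv> module_mat TYPE(complex) n n"

definition GL :: "nat \<Rightarrow> complex mat monoid" where
  "GL n = units_of (ring_mat TYPE(complex) n ())"

definition conj_mat :: "nat \<Rightarrow> complex mat \<Rightarrow> complex mat \<Rightarrow> complex mat" where
  "conj_mat n g A = g * A * inv\<^bsub>GL n\<^esub> g"

definition mat_trace :: "complex mat \<Rightarrow> complex" where
  "mat_trace A = (\<Sum>i<dim_row A. A $$ (i, i))"

definition mat_coords :: "nat \<Rightarrow> (complex mat \<Rightarrow> complex) set" where
  "mat_coords n = {\<lambda>A. A $$ (i, j) | i j. i < n \<and> j < n}"

definition GL_coords :: "nat \<Rightarrow> (complex mat \<Rightarrow> complex) set" where
  "GL_coords n = insert (\<lambda>A. inverse (det A)) (mat_coords n)"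

definition mat_var :: "nat \<Rightarrow> complex mat variety" where
  "mat_var n = affine_var (carrier_mat n n) (mat_coords n)"

definition GL_var :: "nat \<Rightarrow> complex mat variety" where
  "GL_var n = affine_var (carrier (GL n)) (GL_coords n)"


section \<open>Trace preserving representations of the conifold algebra\<close>

text \<open>Algebra maps are taken extensional, so that equality means equality on the algebra.\<close>

definition trep2 :: "((word \<Rightarrow>\<^sub>0 complex) set \<Rightarrow> complex mat) set" where
  "trep2 = {\<phi> \<in> alg_hom conifold_alg (mat_alg 2) \<inter> extensional (carrier conifold_alg).
     \<forall>w. mat_trace (\<phi> (cgen w)) = 0}"

definition trep2_coords :: "(((word \<Rightarrow>\<^sub>0 complex) set \<Rightarrow> complex mat) \<Rightarrow> complex) set" where
  "trep2_coords = {\<lambda>\<phi>. \<phi> (cgen w) $$ (i, j) | w i j. i < 2 \<and> j < 2}"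

definition trep2_var :: "((word \<Rightarrow>\<^sub>0 complex) set \<Rightarrow> complex mat) variety" where
  "trep2_var = affine_var trep2 trep2_coords"

definition rep_act :: "complex mat \<Rightarrow> ((word \<Rightarrow>\<^sub>0 complex) set \<Rightarrow> complex mat) \<Rightarrow>
    ((word \<Rightarrow>\<^sub>0 complex) set \<Rightarrow> complex mat)" where
  "rep_act g \<phi> = (\<lambda>a\<in>carrier conifold_alg. conj_mat 2 g (\<phi> a))"

definition A4 :: "((word \<Rightarrow>\<^sub>0 complex) set \<Rightarrow> complex mat) set" where
  "A4 = {\<phi> \<in> trep2. \<exists>x2 x3 y2 y3.
     \<phi> (cgen GX) = mat_of_rows_list 2 [[0, x2], [x3, 0]] \<and>
     \<phi> (cgen GY) = mat_of_rows_list 2 [[0, y2], [y3, 0]] \<and>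
     \<phi> (cgen GZ) = mat_of_rows_list 2 [[1, 0], [0, -1]]}"

definition A4_var :: "((word \<Rightarrow>\<^sub>0 complex) set \<Rightarrow> complex mat) variety" where
  "A4_var = affine_var A4 trep2_coords"

definition torus :: "complex mat monoid" where
  "torus = (GL 2)\<lparr>carrier :=
     {mat_of_rows_list 2 [[l, 0], [0, m]] | l m. l \<noteq> 0 \<and> m \<noteq> 0}\<rparr>"

definition torus_var :: "complex mat variety" where
  "torus_var = affine_var (carrier torus) (GL_coords 2)"


section \<open>Associated bundles\<close>

text \<open>
  \<open>H\<close> acts on \<open>GL\<^sub>n \<times> F\<close> through a homomorphism \<open>\<iota>\<close> to \<open>GL\<^sub>n\<close> and an action \<open>act\<close> on \<open>F\<close>;
  the associated bundle is the quotient.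
\<close>

definition twist_act :: "nat \<Rightarrow> ('h \<Rightarrow> complex mat) \<Rightarrow> ('h \<Rightarrow> 'f \<Rightarrow> 'f) \<Rightarrow>
    'h \<Rightarrow> complex mat \<times> 'f \<Rightarrow> complex mat \<times> 'f" where
  "twist_act n \<iota> act h = (\<lambda>(g, x). (g * inv\<^bsub>GL n\<^esub> (\<iota> h), act h x))"

definition assoc_bundle :: "nat \<Rightarrow> ('h, 'c) monoid_scheme \<Rightarrow> ('h \<Rightarrow> complex mat) \<Rightarrow>
    'f variety \<Rightarrow> ('h \<Rightarrow> 'f \<Rightarrow> 'f) \<Rightarrow> (complex mat \<times> 'f) set variety" where
  "assoc_bundle n H \<iota> F act = quot_var (prod_var (GL_var n) F) H (twist_act n \<iota> act)"

text \<open>The action \<open>h.[g, x] = [h g, x]\<close> of \<open>GL\<^sub>n\<close> on (classes in) an associated bundle.\<close>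

definition bundle_act ::
  "complex mat \<Rightarrow> (complex mat \<times> 'f) set \<Rightarrow> (complex mat \<times> 'f) set" where
  "bundle_act h c = (\<lambda>(g, x). (h * g, x)) ` c"

abbreviation torus_act :: "complex mat \<Rightarrow>
    complex mat \<times> ((word \<Rightarrow>\<^sub>0 complex) set \<Rightarrow> complex mat) \<Rightarrow>
    complex mat \<times> ((word \<Rightarrow>\<^sub>0 complex) set \<Rightarrow> complex mat)" where
  "torus_act \<equiv> twist_act 2 (\<lambda>t. t) rep_act"

abbreviation torus_bundle ::
  "(complex mat \<times> ((word \<Rightarrow>\<^sub>0 complex) set \<Rightarrow> complex mat)) set variety" where
  "torus_bundle \<equiv> assoc_bundle 2 torus (\<lambda>t. t) A4_var rep_act"


section \<open>Quiver representations and quiver orders\<close>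

text \<open>The vertices of a quiver are \<open>0, \<dots>, nverts - 1\<close>.\<close>

record 'a quiver =
  nverts :: nat
  arrows :: "'a set"
  tl_vert :: "'a \<Rightarrow> nat"
  hd_vert :: "'a \<Rightarrow> nat"

definition total_dim :: "'a quiver \<Rightarrow> (nat \<Rightarrow> nat) \<Rightarrow> nat" where
  "total_dim Q \<alpha> = (\<Sum>v<nverts Q. \<alpha> v)"

definition qrep_var :: "'a quiver \<Rightarrow> (nat \<Rightarrow> nat) \<Rightarrow> ('a \<Rightarrow> complex mat) variety" where
  "qrep_var Q \<alpha> = affine_var
     (\<Pi>\<^sub>E a\<in>arrows Q. carrier_mat (\<alpha> (hd_vert Q a)) (\<alpha> (tl_vert Q a)))
     {\<lambda>V. V a $$ (i, j) | a i j. a \<in> arrows Q \<and> i < \<alpha> (hd_vert Q a) \<and> j < \<alpha> (tl_vert Q a)}"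

definition GL_dim :: "'a quiver \<Rightarrow> (nat \<Rightarrow> nat) \<Rightarrow> (nat \<Rightarrow> complex mat) monoid" where
  "GL_dim Q \<alpha> = product_group {..<nverts Q} (\<lambda>v. GL (\<alpha> v))"

definition GL_dim_var :: "'a quiver \<Rightarrow> (nat \<Rightarrow> nat) \<Rightarrow> (nat \<Rightarrow> complex mat) variety" where
  "GL_dim_var Q \<alpha> = affine_var (carrier (GL_dim Q \<alpha>))
     {\<lambda>\<gamma>. f (\<gamma> v) | f v. v < nverts Q \<and> f \<in> GL_coords (\<alpha> v)}"

definition qrep_act :: "'a quiver \<Rightarrow> (nat \<Rightarrow> nat) \<Rightarrow>
    (nat \<Rightarrow> complex mat) \<Rightarrow> ('a \<Rightarrow> complex mat) \<Rightarrow> ('a \<Rightarrow> complex mat)" where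
  "qrep_act Q \<alpha> \<gamma> V =
     (\<lambda>a\<in>arrows Q. \<gamma> (hd_vert Q a) * V a * inv\<^bsub>GL (\<alpha> (tl_vert Q a))\<^esub> (\<gamma> (tl_vert Q a)))"

definition block_embed :: "'a quiver \<Rightarrow> (nat \<Rightarrow> complex mat) \<Rightarrow> complex mat" where
  "block_embed Q \<gamma> = diag_block_mat (map \<gamma> [0..<nverts Q])"

definition quiver_bundle ::
  "'a quiver \<Rightarrow> (nat \<Rightarrow> nat) \<Rightarrow> (complex mat \<times> ('a \<Rightarrow> complex mat)) set variety" where
  "quiver_bundle Q \<alpha> =
     assoc_bundle (total_dim Q \<alpha>) (GL_dim Q \<alpha>) (block_embed Q) (qrep_var Q \<alpha>) (qrep_act Q \<alpha>)"

definition quiver_order :: "'a quiver \<Rightarrow> (nat \<Rightarrow> nat) \<Rightarrow>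
    (complex, (complex mat \<times> ('a \<Rightarrow> complex mat)) set \<Rightarrow> complex mat) module" where
  "quiver_order Q \<alpha> = (let n = total_dim Q \<alpha>; B = quiver_bundle Q \<alpha> in
     \<lparr>carrier = {F \<in> extensional (points B). var_morphism B (mat_var n) F \<and>
        (\<forall>h\<in>carrier (GL n). \<forall>c\<in>points B. F (bundle_act h c) = conj_mat n h (F c))},
      monoid.mult = (\<lambda>F G. \<lambda>c\<in>points B. F c * G c),
      one = (\<lambda>c\<in>points B. 1\<^sub>m n),
      zero = (\<lambda>c\<in>points B. 0\<^sub>m n n),
      add = (\<lambda>F G. \<lambda>c\<in>points B. F c + G c),
      module.smult = (\<lambda>z F. \<lambda>c\<in>points B. z \<cdot>\<^sub>m F c)\<rparr>)"

text \<open>Arrows \<open>0, 1\<close> go from the first vertex to the second, arrows \<open>2, 3\<close> go back.\<close>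

definition conifold_quiver :: "nat quiver" where
  "conifold_quiver = \<lparr>nverts = 2, arrows = {0, 1, 2, 3},
     tl_vert = (\<lambda>a. if a < 2 then 0 else 1), hd_vert = (\<lambda>a. if a < 2 then 1 else 0)\<rparr>"

definition conifold_dim :: "nat \<Rightarrow> nat" where
  "conifold_dim = (\<lambda>_. 1)"

text \<open>The linear identification sending the coordinates \<open>x3, y3, x2, y2\<close> to the four arrows.\<close>

definition A4_to_qrep ::
  "((word \<Rightarrow>\<^sub>0 complex) set \<Rightarrow> complex mat) \<Rightarrow> (nat \<Rightarrow> complex mat)" where
  "A4_to_qrep \<phi> = (\<lambda>a\<in>{0, 1, 2, 3}. mat_of_rows_list 1
     [[[\<phi> (cgen GX) $$ (1, 0), \<phi> (cgen GY) $$ (1, 0),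
        \<phi> (cgen GX) $$ (0, 1), \<phi> (cgen GY) $$ (0, 1)] ! a]])"

end

theory Submission
  imports Defs "HOL-Library.Product_Plus"
begin

text \<open>
  A trace preserving representation is determined by traceless matrices \<open>X\<close>, \<open>Y\<close>, \<open>Z\<close> with
  \<open>Z\<^sup>2 = 1\<close> such that \<open>X\<close> and \<open>Y\<close> anticommute with \<open>Z\<close>, and it lies in \<open>A\<^sup>4\<close> if and only if
  \<open>Z = diag(1, -1)\<close>. Hence two points of \<open>GL\<^sub>2 \<times> A\<^sup>4\<close> with the same image differ by a stabilizer of
  \<open>diag(1, -1)\<close>. Let \<open>p\<close> be the upper left entry of the projector \<open>(1 + Z) / 2\<close>. Bases of its image
  and its kernel can be written down explicitly where \<open>p \<noteq> 0\<close> and where \<open>1 - p \<noteq> 0\<close>. These local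
  sections trivialize the bundle, and since \<open>p + (1 - p) = 1\<close>, regularity of the inverse of
  \<open>GL\<^sub>2 \<times>\<^sup>T A\<^sup>4 \<rightarrow> trep\<^sub>2 \<Lambda>\<^sub>c\<close> can be checked on the two open sets.

  For the quiver order, the relations say that \<open>a b c = c b a\<close> for letters \<open>a, b, c\<close> among \<open>X, Y\<close>.
  So, up to powers of \<open>Z\<close>, a word depends only on the number of occurrences of each letter at even and
  at odd positions, that is, on the monomial which appears in a given row of the generic matrix of the
  word. As monomials are linearly independent functions, \<open>\<Lambda>\<^sub>c\<close> embeds into the algebra of polynomial
  matrices on \<open>A\<^sup>4\<close>. A monomial of the right torus weight comes from an alternating path, so the image
  consists of all equivariant polynomial matrices.
\<close>

section \<open>Varieties\<close>

text \<open>The bundle is nontrivial: the image of the projector \<open>(1 + Z) / 2\<close> is a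
  nontrivial line bundle over the quadric of all \<open>Z\<close>, so no single formula inverts the
  action map. A regular function on a quotient is by definition an invariant function upstairs, so a
  map into the quotient is tested by composing with sections, and the results on the open sets are
  combined by an explicit partition of unity. For the order, faithfulness is proved one row at a
  time. Multiplying from the left by the idempotent \<open>(1 + Z) / 2\<close> or
  \<open>(1 - Z) / 2\<close> turns every later \<open>Z\<close> into a sign and leaves words in
  \<open>X\<close> and \<open>Y\<close>, for which equal exponents in that row mean equality modulo
  the relations. Equivariant maps on the quiver bundle are determined by their values at the classes
  of \<open>(1, V)\<close>, where only equivariance under the torus remains; this makes surjectivity
  a question about polynomial matrices in four variables.\<close>

definition is_variety :: "'a variety \<Rightarrow> bool" where
  "is_variety V \<longleftrightarrow> (\<forall>c. (\<lambda>_. c) \<in> regular V) \<and>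
     (\<forall>f\<in>regular V. \<forall>g\<in>regular V. (\<lambda>x. f x + g x) \<in> regular V \<and> (\<lambda>x. f x * g x) \<in> regular V) \<and>
     (\<forall>f g. f \<in> regular V \<longrightarrow> (\<forall>x\<in>points V. g x = f x) \<longrightarrow> g \<in> regular V)"

text \<open>Regular functions are total on the ambient type and constrained only on the points,
  where alone explicit formulas hold; \<open>regular_cong\<close> carries regularity across such
  equations.\<close>

lemma regular_const: "is_variety V \<Longrightarrow> (\<lambda>_. c) \<in> regular V"
  and regular_add: "is_variety V \<Longrightarrow> f \<in> regular V \<Longrightarrow> g \<in> regular V \<Longrightarrow> (\<lambda>x. f x + g x) \<in> regular V"
  and regular_mult: "is_variety V \<Longrightarrow> f \<in> regular V \<Longrightarrow> g \<in> regular V \<Longrightarrow> (\<lambda>x. f x * g x) \<in> regular V"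
  and regular_cong: "is_variety V \<Longrightarrow> f \<in> regular V \<Longrightarrow> (\<And>x. x \<in> points V \<Longrightarrow> g x = f x) \<Longrightarrow> g \<in> regular V"
  unfolding is_variety_def by blast+

lemma regular_uminus: "is_variety V \<Longrightarrow> f \<in> regular V \<Longrightarrow> (\<lambda>x. - f x) \<in> regular V"
  using regular_mult[OF _ regular_const[of V "-1"], of f] by simp

lemma regular_diff:
  "is_variety V \<Longrightarrow> f \<in> regular V \<Longrightarrow> g \<in> regular V \<Longrightarrow> (\<lambda>x. f x - g x) \<in> regular V"
  using regular_add[OF _ _ regular_uminus[of V g], of f] by simp

lemma regular_divide_const: "is_variety V \<Longrightarrow> f \<in> regular V \<Longrightarrow> (\<lambda>x. f x / c) \<in> regular V"
  using regular_mult[OF _ _ regular_const[of V "inverse c"], of f] by (simp add: divide_inverse)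

lemma regular_power: "is_variety V \<Longrightarrow> f \<in> regular V \<Longrightarrow> (\<lambda>x. f x ^ n) \<in> regular V"
  by (induction n) (auto intro: regular_const regular_mult)

lemma regular_sum:
  "is_variety V \<Longrightarrow> (\<And>i. i \<in> I \<Longrightarrow> f i \<in> regular V) \<Longrightarrow> (\<lambda>x. \<Sum>i\<in>I. f i x) \<in> regular V"
  by (induction I rule: infinite_finite_induct) (auto intro: regular_const regular_add)

lemmas regular_intros =
  regular_const regular_add regular_mult regular_uminus regular_diff regular_divide_const
  regular_power regular_sum

lemma is_variety_affine_var [simp]: "is_variety (affine_var S C)"
  unfolding is_variety_def
proof (intro conjI ballI allI impI)
  fix c show "(\<lambda>_. c) \<in> regular (affine_var S C)"
    by (auto simp: affine_var_def intro: poly_fun.const)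
next
  fix f g assume fg: "f \<in> regular (affine_var S C)" "g \<in> regular (affine_var S C)"
  then obtain p q where pq: "p \<in> poly_fun C" "\<forall>x\<in>S. f x = p x" "q \<in> poly_fun C" "\<forall>x\<in>S. g x = q x"
    by (auto simp: affine_var_def)
  from pq show "(\<lambda>x. f x + g x) \<in> regular (affine_var S C)"
    by (auto simp: affine_var_def intro!: bexI[OF _ poly_fun.add[of p _ q]])
  from pq show "(\<lambda>x. f x * g x) \<in> regular (affine_var S C)"
    by (auto simp: affine_var_def intro!: bexI[OF _ poly_fun.mult[of p _ q]])
next
  fix f g assume "f \<in> regular (affine_var S C)" "\<forall>x\<in>points (affine_var S C). g x = f x"
  then show "g \<in> regular (affine_var S C)"
    by (auto simp: affine_var_def)
qed

lemma points_affine_var [simp]: "points (affine_var S C) = S"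
  by (simp add: affine_var_def)

lemma affine_var_coord: "f \<in> C \<Longrightarrow> f \<in> regular (affine_var S C)"
  by (auto simp: affine_var_def intro: poly_fun.coord)

lemma regular_poly_fun:
  assumes "is_variety V" "p \<in> poly_fun C" "\<And>f. f \<in> C \<Longrightarrow> (\<lambda>x. f (\<phi> x)) \<in> regular V"
  shows "(\<lambda>x. p (\<phi> x)) \<in> regular V"
  using assms(2) by induction (auto intro: assms regular_intros)

lemma is_variety_prod_var [simp]: "is_variety (prod_var V W)"
  and is_variety_principal_open [simp]: "is_variety (principal_open V f)"
  by (simp_all add: prod_var_def principal_open_def)

lemma points_prod_var [simp]: "points (prod_var V W) = points V \<times> points W"
  and points_principal_open [simp]: "points (principal_open V f) = {x \<in> points V. f x \<noteq> 0}"
  by (simp_all add: prod_var_def principal_open_def)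

lemma points_quot_var [simp]: "points (quot_var V G act) = orbits G (points V) act"
  and regular_quot_var: "f \<in> regular (quot_var V G act) \<longleftrightarrow> (\<lambda>x. f (orbit G act x)) \<in> regular V"
  by (simp_all add: quot_var_def)

lemma is_variety_quot_var [simp]:
  assumes "is_variety V"
  shows "is_variety (quot_var V G act)"
  unfolding is_variety_def regular_quot_var
proof (intro conjI allI ballI impI)
  fix f g assume fg: "(\<lambda>x. f (orbit G act x)) \<in> regular V" "\<forall>x\<in>points (quot_var V G act). g x = f x"
  show "(\<lambda>x. g (orbit G act x)) \<in> regular V"
    by (rule regular_cong[OF assms fg(1)]) (use fg(2) in \<open>auto simp: orbits_def\<close>)
qed (auto intro!: regular_intros assms simp: regular_quot_var)

lemma regular_fst: "f \<in> regular V \<Longrightarrow> (\<lambda>x. f (fst x)) \<in> regular (prod_var V W)"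
  and regular_snd: "g \<in> regular W \<Longrightarrow> (\<lambda>x. g (snd x)) \<in> regular (prod_var V W)"
  unfolding prod_var_def by (rule affine_var_coord; auto simp: comp_def)+

lemma regular_principal_open: "f \<in> regular V \<Longrightarrow> f \<in> regular (principal_open V d)"
  and regular_inverse_principal_open: "(\<lambda>x. inverse (d x)) \<in> regular (principal_open V d)"
  unfolding principal_open_def by (rule affine_var_coord; simp)+

lemma var_morphismD:
  assumes "var_morphism V W \<phi>"
  shows "x \<in> points V \<Longrightarrow> \<phi> x \<in> points W"
    and "f \<in> regular W \<Longrightarrow> (\<lambda>x. f (\<phi> x)) \<in> regular V"
  using assms by (auto simp: var_morphism_def comp_def)

text \<open>Pulling back is compatible with sums and products, so testing the coordinate functions
  is enough. The source is any \<open>is_variety\<close>, because quotients come without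
  coordinates.\<close>

lemma var_morphism_affine_varI:
  assumes "is_variety V" "\<And>x. x \<in> points V \<Longrightarrow> \<phi> x \<in> S"
    "\<And>f. f \<in> C \<Longrightarrow> (\<lambda>x. f (\<phi> x)) \<in> regular V"
  shows "var_morphism V (affine_var S C) \<phi>"
  unfolding var_morphism_def
proof (intro conjI ballI funcsetI)
  fix f assume "f \<in> regular (affine_var S C)"
  then obtain p where p: "p \<in> poly_fun C" "\<forall>x\<in>S. f x = p x" by (auto simp: affine_var_def)
  have "(\<lambda>x. p (\<phi> x)) \<in> regular V" by (rule regular_poly_fun[OF assms(1) p(1) assms(3)])
  then show "f \<circ> \<phi> \<in> regular V"
    by (rule regular_cong[OF assms(1)]) (use p assms(2) in auto)
qed (use assms in auto)

lemma var_morphism_prod_varI: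
  assumes "is_variety U" "var_morphism U V (\<lambda>x. fst (\<phi> x))" "var_morphism U W (\<lambda>x. snd (\<phi> x))"
  shows "var_morphism U (prod_var V W) \<phi>"
  unfolding prod_var_def
  by (rule var_morphism_affine_varI) (auto simp: assms(1) comp_def mem_Times_iff
      intro: var_morphismD[OF assms(2)] var_morphismD[OF assms(3)])

lemma var_morphism_principal_openI:
  assumes "is_variety U" "var_morphism U V \<phi>" "\<And>x. x \<in> points U \<Longrightarrow> d (\<phi> x) \<noteq> 0"
    "(\<lambda>x. inverse (d (\<phi> x))) \<in> regular U"
  shows "var_morphism U (principal_open V d) \<phi>"
  unfolding principal_open_def
  by (rule var_morphism_affine_varI) (auto simp: assms intro: var_morphismD[OF assms(2)])

lemma var_morphism_orbit: "var_morphism V (quot_var V G act) (orbit G act)"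
  by (auto simp: var_morphism_def regular_quot_var orbits_def comp_def)

text \<open>The composite with \<open>orbit\<close> is invariant by construction, so regularity
  upstairs is the whole condition.\<close>

lemma var_morphism_quot_varI:
  assumes "var_morphism V W (\<lambda>x. \<phi> (orbit G act x))"
  shows "var_morphism (quot_var V G act) W \<phi>"
  using assms by (auto simp: var_morphism_def regular_quot_var orbits_def comp_def)

lemma var_morphism_comp:
  "var_morphism U V \<phi> \<Longrightarrow> var_morphism V W \<psi> \<Longrightarrow> var_morphism U W (\<lambda>x. \<psi> (\<phi> x))"
  by (auto simp: var_morphism_def comp_def Pi_iff)

lemma var_morphism_cong:
  assumes "is_variety V" "var_morphism V W \<phi>" "\<And>x. x \<in> points V \<Longrightarrow> \<psi> x = \<phi> x"
  shows "var_morphism V W \<psi>"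
  unfolding var_morphism_def comp_def
proof (intro conjI funcsetI ballI)
  fix f assume "f \<in> regular W"
  from var_morphismD(2)[OF assms(2) this] show "(\<lambda>x. f (\<psi> x)) \<in> regular V"
    by (rule regular_cong[OF assms(1)]) (simp add: assms(3))
qed (use assms(3) var_morphismD(1)[OF assms(2)] in auto)

lemma var_morphism_principal_open_inclusion: "var_morphism (principal_open V d) V (\<lambda>x. x)"
  by (auto simp: var_morphism_def comp_def intro: regular_principal_open)

lemma var_morphism_fst: "var_morphism (prod_var V W) V fst"
  and var_morphism_snd: "var_morphism (prod_var V W) W snd"
  by (auto simp: var_morphism_def comp_def intro: regular_fst regular_snd)

text \<open>\<open>var_iso\<close> refers to \<open>inv_into\<close>, which agrees with the explicit
  inverse \<open>\<psi>\<close> only on the points of \<open>W\<close>; regularity is transferred by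
  \<open>var_morphism_cong\<close>.\<close>

lemma var_isoI:
  assumes "is_variety W" "var_morphism V W \<phi>" "var_morphism W V \<psi>"
    "\<And>x. x \<in> points V \<Longrightarrow> \<psi> (\<phi> x) = x" "\<And>y. y \<in> points W \<Longrightarrow> \<phi> (\<psi> y) = y"
  shows "var_iso V W \<phi>"
proof -
  have bij: "bij_betw \<phi> (points V) (points W)"
    by (rule bij_betwI[where g = \<psi>]) (use assms var_morphismD in auto)
  have "inv_into (points V) \<phi> y = \<psi> y" if "y \<in> points W" for y
    using that assms(5) var_morphismD(1)[OF assms(3)] bij
    by (metis bij_betw_inv_into_left)
  with var_morphism_cong[OF assms(1,3)] bij assms(2) show ?thesis
    by (simp add: var_iso_def)
qed

text \<open>Clearing denominators; the extra factor \<open>d x\<close> makes the identity hold also where \<open>d\<close> vanishes.\<close>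

lemma regular_principal_open_denominator:
  assumes V: "is_variety V" and d: "d \<in> regular V" and F: "F \<in> regular (principal_open V d)"
  obtains n a where "a \<in> regular V" "\<And>x. x \<in> points V \<Longrightarrow> d x ^ n * F x = a x"
proof -
  obtain p where p: "p \<in> poly_fun (insert (\<lambda>x. inverse (d x)) (regular V))"
      "\<forall>x\<in>{x\<in>points V. d x \<noteq> 0}. F x = p x"
    using F by (auto simp: principal_open_def affine_var_def)
  from p(1) have "\<exists>n. \<exists>a\<in>regular V. \<forall>x\<in>points V. d x \<noteq> 0 \<longrightarrow> d x ^ n * p x = a x"
  proof induction
    case (coord f)
    then consider "f = (\<lambda>x. inverse (d x))" | "f \<in> regular V" by blast
    then show ?case
    proof cases
      case 1
      then show ?thesis by (intro exI[of _ 1] bexI[OF _ regular_const[OF V, of 1]]) auto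
    next
      case 2
      then show ?thesis by (intro exI[of _ 0] bexI[of _ f]) auto
    qed
  next
    case (const c)
    show ?case by (intro exI[of _ 0] bexI[OF _ regular_const[OF V, of c]]) auto
  next
    case (add f g)
    then obtain n a m b where *: "a \<in> regular V" "\<forall>x\<in>points V. d x \<noteq> 0 \<longrightarrow> d x ^ n * f x = a x"
      "b \<in> regular V" "\<forall>x\<in>points V. d x \<noteq> 0 \<longrightarrow> d x ^ m * g x = b x" by blast
    have "(\<lambda>x. d x ^ m * a x + d x ^ n * b x) \<in> regular V"
      by (intro regular_intros V d *)
    moreover have "d x ^ (n + m) * (f x + g x) = d x ^ m * (d x ^ n * f x) + d x ^ n * (d x ^ m * g x)" for x
      by (simp add: algebra_simps power_add)
    ultimately show ?case using *
      by (intro exI[of _ "n + m"] bexI[of _ "\<lambda>x. d x ^ m * a x + d x ^ n * b x"]) auto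
  next
    case (mult f g)
    then obtain n a m b where *: "a \<in> regular V" "\<forall>x\<in>points V. d x \<noteq> 0 \<longrightarrow> d x ^ n * f x = a x"
      "b \<in> regular V" "\<forall>x\<in>points V. d x \<noteq> 0 \<longrightarrow> d x ^ m * g x = b x" by blast
    have "(\<lambda>x. a x * b x) \<in> regular V"
      by (intro regular_intros V d *)
    moreover have "d x ^ (n + m) * (f x * g x) = a x * b x" if "x \<in> points V" "d x \<noteq> 0" for x
    proof -
      have "d x ^ (n + m) * (f x * g x) = (d x ^ n * f x) * (d x ^ m * g x)"
        by (simp add: power_add)
      with * that show ?thesis by simp
    qed
    ultimately show ?case
      by (intro exI[of _ "n + m"] bexI[of _ "\<lambda>x. a x * b x"]) auto
  qed
  then obtain n a where na: "a \<in> regular V" "\<forall>x\<in>points V. d x \<noteq> 0 \<longrightarrow> d x ^ n * p x = a x" by blast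
  show thesis
  proof (rule that[of "\<lambda>x. d x * a x" "Suc n"])
    show "(\<lambda>x. d x * a x) \<in> regular V" by (intro regular_intros V d na)
    show "d x ^ Suc n * F x = d x * a x" if "x \<in> points V" for x
      using na(2) p(2) that by (cases "d x = 0") (auto simp: mult.assoc)
  qed
qed

text \<open>As \<open>d + e = 1\<close>, the powers of \<open>d\<close> and \<open>e\<close> that
  clear the denominators still generate the unit ideal; combining the two numerators with the
  corresponding coefficients returns \<open>F\<close>.\<close>

lemma regular_glue:
  assumes V: "is_variety V" and d: "d \<in> regular V" "e \<in> regular V"
    and de: "\<And>x. x \<in> points V \<Longrightarrow> d x + e x = 1"
    and F: "F \<in> regular (principal_open V d)" "F \<in> regular (principal_open V e)"
  shows "F \<in> regular V"
proof -
  obtain n a where a: "a \<in> regular V" "\<And>x. x \<in> points V \<Longrightarrow> d x ^ n * F x = a x"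
    using regular_principal_open_denominator[OF V d(1) F(1)] by blast
  obtain m b where b: "b \<in> regular V" "\<And>x. x \<in> points V \<Longrightarrow> e x ^ m * F x = b x"
    using regular_principal_open_denominator[OF V d(2) F(2)] by blast
  \<comment> \<open>Geometric sums give the partition of unity: \<open>1 - d^n = e * s\<close>,
    hence \<open>1 - (s * e)^m = d^n * t\<close>, that is,
    \<open>t * d^n + s^m * e^m = 1\<close>.\<close>
  define s where "s = (\<lambda>x. \<Sum>i<n. d x ^ i)"
  define t where "t = (\<lambda>x. \<Sum>i<m. (s x * e x) ^ i)"
  have s: "s \<in> regular V" unfolding s_def by (intro regular_intros V d)
  have t: "t \<in> regular V" unfolding t_def by (intro regular_intros V d s)
  have "F x = t x * a x + s x ^ m * b x" if x: "x \<in> points V" for x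
  proof -
    have e: "e x = 1 - d x" using de[OF x] by (simp add: algebra_simps)
    have "1 - d x ^ n = e x * s x" unfolding s_def e by (rule one_diff_power_eq)
    then have dn: "d x ^ n = 1 - s x * e x" by (simp add: algebra_simps)
    have "1 - (s x * e x) ^ m = (1 - s x * e x) * t x" unfolding t_def by (rule one_diff_power_eq)
    then have "t x * d x ^ n + s x ^ m * e x ^ m = 1"
      by (simp add: dn algebra_simps power_mult_distrib)
    then have "F x = (t x * d x ^ n + s x ^ m * e x ^ m) * F x" by simp
    also have "\<dots> = t x * a x + s x ^ m * b x"
      by (simp add: a(2)[OF x, symmetric] b(2)[OF x, symmetric] algebra_simps)
    finally show ?thesis .
  qed
  moreover have "(\<lambda>x. t x * a x + s x ^ m * b x) \<in> regular V"
    by (intro regular_intros V s t a b)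
  ultimately show ?thesis by (rule regular_cong[OF V, rotated]) auto
qed

section \<open>Linear extension and independence\<close>

text \<open>The index type serves twice: as words, for the free algebra, and as exponents, for
  polynomial functions in four variables.\<close>

definition lin_ext :: "('m \<Rightarrow> complex) \<Rightarrow> ('m \<Rightarrow>\<^sub>0 complex) \<Rightarrow> complex" where
  "lin_ext F p = (\<Sum>w\<in>Poly_Mapping.keys p. poly_mapping.lookup p w * F w)"

lemma lin_ext_superset:
  "finite S \<Longrightarrow> Poly_Mapping.keys p \<subseteq> S \<Longrightarrow> lin_ext F p = (\<Sum>w\<in>S. poly_mapping.lookup p w * F w)"
  unfolding lin_ext_def by (rule sum.mono_neutral_left) (auto simp: in_keys_iff)

lemma lin_ext_zero [simp]: "lin_ext F 0 = 0"
  by (simp add: lin_ext_def)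

lemma lin_ext_add: "lin_ext F (p + q) = lin_ext F p + lin_ext F q"
  using keys_add[of p q]
  by (simp add: lin_ext_superset[of "Poly_Mapping.keys p \<union> Poly_Mapping.keys q"] lookup_add sum.distrib algebra_simps)

lemma lin_ext_uminus: "lin_ext F (- p) = - lin_ext F p"
  by (metis add_eq_0_iff lin_ext_add lin_ext_zero neg_eq_iff_add_eq_0)

lemma lin_ext_diff: "lin_ext F (p - q) = lin_ext F p - lin_ext F q"
  using lin_ext_add[of F p "- q"] by (simp add: lin_ext_uminus)

lemma lin_ext_sum: "lin_ext F (sum p I) = (\<Sum>i\<in>I. lin_ext F (p i))"
  by (induction I rule: infinite_finite_induct) (auto simp: lin_ext_add)

lemma lin_ext_single [simp]: "lin_ext F (Poly_Mapping.single w c) = c * F w"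
  by (simp add: lin_ext_def)

lemma sum_singles: "(\<Sum>w\<in>Poly_Mapping.keys p. Poly_Mapping.single w (poly_mapping.lookup p w)) = p"
  by (rule poly_mapping_eqI) (simp add: lookup_sum lookup_single when_def in_keys_iff)

lemma lin_ext_mult:
  "lin_ext F (p * q) = (\<Sum>w\<in>Poly_Mapping.keys p. \<Sum>v\<in>Poly_Mapping.keys q. poly_mapping.lookup p w * poly_mapping.lookup q v * F (w + v))"
proof -
  have "p * q = (\<Sum>w\<in>Poly_Mapping.keys p. Poly_Mapping.single w (poly_mapping.lookup p w)) * (\<Sum>v\<in>Poly_Mapping.keys q. Poly_Mapping.single v (poly_mapping.lookup q v))"
    by (simp add: sum_singles)
  also have "\<dots> = (\<Sum>w\<in>Poly_Mapping.keys p. \<Sum>v\<in>Poly_Mapping.keys q. Poly_Mapping.single (w + v) (poly_mapping.lookup p w * poly_mapping.lookup q v))"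
    by (simp add: sum_product mult_single)
  finally show ?thesis by (simp add: lin_ext_sum)
qed

text \<open>Independence of the family rather than of the set of its values, so that coefficients
  can be compared index by index.\<close>

definition lin_indep :: "('a \<Rightarrow> 'x \<Rightarrow> complex) \<Rightarrow> bool" where
  "lin_indep \<phi> \<longleftrightarrow> (\<forall>S c. finite S \<longrightarrow> (\<forall>x. (\<Sum>a\<in>S. c a * \<phi> a x) = 0) \<longrightarrow> (\<forall>a\<in>S. c a = 0))"

lemma lin_indepD:
  "lin_indep \<phi> \<Longrightarrow> finite S \<Longrightarrow> (\<And>x. (\<Sum>a\<in>S. c a * \<phi> a x) = 0) \<Longrightarrow> a \<in> S \<Longrightarrow> c a = 0"
  unfolding lin_indep_def by blast

lemma lin_indep_power: "lin_indep (\<lambda>(n::nat) x. x ^ n)"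
  unfolding lin_indep_def
proof (intro allI impI ballI)
  fix S :: "nat set" and c :: "nat \<Rightarrow> complex" and a
  assume S: "finite S" and 0: "\<forall>x. (\<Sum>a\<in>S. c a * x ^ a) = 0" and a: "a \<in> S"
  \<comment> \<open>Padding with zeros turns the sum over an arbitrary finite set of exponents into
    a polynomial of degree at most \<open>Max S\<close>.\<close>
  define c' where "c' = (\<lambda>n. if n \<in> S then c n else 0)"
  have "(\<Sum>i\<le>Max S. c' i * x ^ i) = 0" for x
  proof -
    have "(\<Sum>i\<le>Max S. c' i * x ^ i) = (\<Sum>i\<in>S. c' i * x ^ i)"
      by (rule sum.mono_neutral_right) (use S in \<open>auto simp: c'_def\<close>)
    also have "\<dots> = (\<Sum>i\<in>S. c i * x ^ i)" by (rule sum.cong) (auto simp: c'_def)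
    finally show ?thesis using 0 by simp
  qed
  then have "c' a = 0" using zero_polynom_imp_zero_coeffs[of c' "Max S" a] S a by simp
  then show "c a = 0" using a by (simp add: c'_def)
qed

text \<open>For fixed \<open>y\<close> the sum is a combination of the \<open>\<phi> a\<close>, so
  its coefficients vanish; these, as functions of \<open>y\<close>, are combinations of the
  \<open>\<psi> b\<close>.\<close>

lemma lin_indep_prod:
  assumes "lin_indep \<phi>" "lin_indep \<psi>"
  shows "lin_indep (\<lambda>(a, b) (x, y). \<phi> a x * \<psi> b y)"
  unfolding lin_indep_def
proof (intro allI impI ballI)
  fix S :: "('a \<times> 'c) set" and c :: "'a \<times> 'c \<Rightarrow> complex" and s
  assume S: "finite S" and 0: "\<forall>z. (\<Sum>s\<in>S. c s * (case s of (a, b) \<Rightarrow> \<lambda>(x, y). \<phi> a x * \<psi> b y) z) = 0"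
    and s: "s \<in> S"
  \<comment> \<open>Zero outside \<open>S\<close>, so that the sum may run over the whole rectangle
    spanned by the two projections of \<open>S\<close>.\<close>
  define c' where "c' = (\<lambda>s. if s \<in> S then c s else 0)"
  let ?A = "fst ` S" and ?B = "snd ` S"
  have fin: "finite ?A" "finite ?B" using S by auto
  have "(\<Sum>a\<in>?A. (\<Sum>b\<in>?B. c' (a, b) * \<psi> b y) * \<phi> a x) = 0" for x y
  proof -
    have "(\<Sum>a\<in>?A. (\<Sum>b\<in>?B. c' (a, b) * \<psi> b y) * \<phi> a x)
        = (\<Sum>s\<in>?A \<times> ?B. c' s * (case s of (a, b) \<Rightarrow> \<phi> a x * \<psi> b y))"
      unfolding sum_distrib_right sum.cartesian_product by (rule sum.cong) (auto simp: mult_ac)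
    also have "\<dots> = (\<Sum>s\<in>S. c' s * (case s of (a, b) \<Rightarrow> \<phi> a x * \<psi> b y))"
    proof (rule sum.mono_neutral_right)
      show "S \<subseteq> ?A \<times> ?B" by (rule subset_fst_snd)
    qed (use fin in \<open>auto simp: c'_def\<close>)
    also have "\<dots> = (\<Sum>s\<in>S. c s * (case s of (a, b) \<Rightarrow> \<lambda>(x, y). \<phi> a x * \<psi> b y) (x, y))"
      by (rule sum.cong) (auto simp: c'_def)
    also have "\<dots> = 0" using 0[rule_format, of "(x, y)"] .
    finally show ?thesis .
  qed
  note indep = this
  have "(\<Sum>b\<in>?B. c' (fst s, b) * \<psi> b y) = 0" for y
    using lin_indepD[OF assms(1) fin(1), where c = "\<lambda>a. \<Sum>b\<in>?B. c' (a, b) * \<psi> b y" and a = "fst s",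
        OF indep imageI[OF s]] .
  from lin_indepD[OF assms(2) fin(2), where c = "\<lambda>b. c' (fst s, b)" and a = "snd s", OF this imageI[OF s]]
  show "c s = 0" using s by (simp add: c'_def)
qed

section \<open>Two by two matrices\<close>

abbreviation m2 :: "complex \<Rightarrow> complex \<Rightarrow> complex \<Rightarrow> complex \<Rightarrow> complex mat" where
  "m2 a b c d \<equiv> mat_of_rows_list 2 [[a, b], [c, d]]"

lemma sum_less_2: "(\<Sum>i<2::nat. f i) = f 0 + f 1" "(\<Sum>i = 0..<2::nat. f i) = f 0 + f 1"
  by (simp_all add: numeral_2_eq_2)

lemma m2_carrier [simp]: "m2 a b c d \<in> carrier_mat 2 2"
  and dim_m2 [simp]: "dim_row (m2 a b c d) = 2" "dim_col (m2 a b c d) = 2"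
  and m2_index [simp]: "m2 a b c d $$ (0, 0) = a" "m2 a b c d $$ (0, 1) = b"
    "m2 a b c d $$ (1, 0) = c" "m2 a b c d $$ (1, 1) = d"
    "m2 a b c d $$ (0, Suc 0) = b" "m2 a b c d $$ (Suc 0, 0) = c" "m2 a b c d $$ (Suc 0, Suc 0) = d"
  by (auto simp: mat_of_rows_list_def)

lemma mat2_eqI:
  assumes "A \<in> carrier_mat 2 2" "B \<in> carrier_mat 2 2"
    "A $$ (0, 0) = B $$ (0, 0)" "A $$ (0, 1) = B $$ (0, 1)"
    "A $$ (1, 0) = B $$ (1, 0)" "A $$ (1, 1) = B $$ (1, 1)"
  shows "A = B"
  by (rule eq_matI) (use assms in \<open>auto simp: less_2_cases_iff\<close>)

lemma mat2_eta: "A \<in> carrier_mat 2 2 \<Longrightarrow> A = m2 (A $$ (0, 0)) (A $$ (0, 1)) (A $$ (1, 0)) (A $$ (1, 1))"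
  by (rule mat2_eqI) auto

lemma mat2_cases:
  assumes "A \<in> carrier_mat 2 2" obtains a b c d where "A = m2 a b c d"
  using mat2_eta[OF assms] by blast

lemma m2_eq_iff [simp]: "m2 a b c d = m2 a' b' c' d' \<longleftrightarrow> a = a' \<and> b = b' \<and> c = c' \<and> d = d'"
proof
  assume *: "m2 a b c d = m2 a' b' c' d'"
  show "a = a' \<and> b = b' \<and> c = c' \<and> d = d'"
    using arg_cong[OF *, of "\<lambda>A. A $$ (0, 0)"] arg_cong[OF *, of "\<lambda>A. A $$ (0, 1)"]
      arg_cong[OF *, of "\<lambda>A. A $$ (1, 0)"] arg_cong[OF *, of "\<lambda>A. A $$ (1, 1)"] by simp
qed simp

lemma m2_mult [simp]:
  "m2 a b c d * m2 a' b' c' d' = m2 (a * a' + b * c') (a * b' + b * d') (c * a' + d * c') (c * b' + d * d')"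
  by (rule mat2_eqI) (auto simp: scalar_prod_def sum_less_2)

lemma m2_add [simp]: "m2 a b c d + m2 a' b' c' d' = m2 (a + a') (b + b') (c + c') (d + d')"
  and m2_smult [simp]: "z \<cdot>\<^sub>m m2 a b c d = m2 (z * a) (z * b) (z * c) (z * d)"
  by (rule mat2_eqI; simp)+

lemma m2_diff [simp]: "m2 a b c d - m2 a' b' c' d' = m2 (a - a') (b - b') (c - c') (d - d')"
  by (rule mat2_eqI) auto

lemma one_mat_2: "1\<^sub>m 2 = m2 1 0 0 1"
  and zero_mat_2: "0\<^sub>m 2 2 = m2 0 0 0 0"
  by (rule mat2_eqI; simp)+

lemma mat2_diff_eq_0D:
  fixes A B :: "complex mat"
  assumes "A \<in> carrier_mat 2 2" "B \<in> carrier_mat 2 2" "A - B = 0\<^sub>m 2 2"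
  shows "A = B"
proof -
  obtain a b c d where A: "A = m2 a b c d" using mat2_cases[OF assms(1)] .
  obtain a' b' c' d' where B: "B = m2 a' b' c' d'" using mat2_cases[OF assms(2)] .
  show ?thesis using assms(3) by (simp add: A B zero_mat_2)
qed

lemma det_m2 [simp]: "det (m2 a b c d) = a * d - b * c"
proof -
  have "det (m2 a b c d) = (\<Sum>j<2. m2 a b c d $$ (0, j) * cofactor (m2 a b c d) 0 j)"
    by (rule laplace_expansion_row[of _ 2]) simp_all
  moreover have "det (mat_delete (m2 a b c d) 0 j) = (if j = 0 then d else c)" if "j < 2" for j
    using that by (subst det_single) (auto simp: mat_delete_def less_2_cases_iff)
  ultimately show ?thesis by (simp add: cofactor_def sum_less_2)
qed

lemma mat_trace_m2 [simp]: "mat_trace (m2 a b c d) = a + d"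
  by (simp add: mat_trace_def sum_less_2)

section \<open>General linear groups and conjugation of matrices\<close>

lemma GL_simps [simp]: "x \<otimes>\<^bsub>GL n\<^esub> y = x * y" "\<one>\<^bsub>GL n\<^esub> = 1\<^sub>m n"
  by (simp_all add: GL_def units_of_def ring_mat_simps)

lemma carrier_GL: "carrier (GL n) = {g \<in> carrier_mat n n. det g \<noteq> 0}"
proof -
  have "carrier (GL n) = Units (ring_mat TYPE(complex) n ())"
    by (simp add: GL_def units_of_def)
  moreover have "g \<in> Units (ring_mat TYPE(complex) n ()) \<longleftrightarrow> g \<in> carrier_mat n n \<and> det g \<noteq> 0" for g
    using unit_imp_det_non_zero[of g n "()"] det_non_zero_imp_unit[of g n "()"]
    by (auto simp: Units_def ring_mat_simps)
  ultimately show ?thesis by auto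
qed

lemma GL_carrier_mat: "g \<in> carrier (GL n) \<Longrightarrow> g \<in> carrier_mat n n"
  by (simp add: carrier_GL)

lemma group_GL: "group (GL n)"
proof -
  interpret ring "ring_mat TYPE(complex) n ()" by (rule ring_mat)
  show ?thesis unfolding GL_def by (rule units_group)
qed

lemma GL_mult_closed: "g \<in> carrier (GL n) \<Longrightarrow> h \<in> carrier (GL n) \<Longrightarrow> g * h \<in> carrier (GL n)"
  using monoid.m_closed[OF group.is_monoid[OF group_GL]] by fastforce

lemma GL_one_closed: "1\<^sub>m n \<in> carrier (GL n)"
  using monoid.one_closed[OF group.is_monoid[OF group_GL]] by fastforce

lemma GL_inv_closed: "g \<in> carrier (GL n) \<Longrightarrow> inv\<^bsub>GL n\<^esub> g \<in> carrier (GL n)"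
  by (rule group.inv_closed[OF group_GL])

lemma GL_inv_right: "g \<in> carrier (GL n) \<Longrightarrow> g * inv\<^bsub>GL n\<^esub> g = 1\<^sub>m n"
  and GL_inv_left: "g \<in> carrier (GL n) \<Longrightarrow> inv\<^bsub>GL n\<^esub> g * g = 1\<^sub>m n"
  and GL_inv_inv: "g \<in> carrier (GL n) \<Longrightarrow> inv\<^bsub>GL n\<^esub> (inv\<^bsub>GL n\<^esub> g) = g"
  using group.r_inv[OF group_GL, of g n] group.l_inv[OF group_GL, of g n] group.inv_inv[OF group_GL, of g n]
  by auto

lemma GL_inv_one: "inv\<^bsub>GL n\<^esub> (1\<^sub>m n) = 1\<^sub>m n"
  using monoid.inv_one[OF group.is_monoid[OF group_GL]] by fastforce

lemma GL_inv_mult: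
  "g \<in> carrier (GL n) \<Longrightarrow> h \<in> carrier (GL n) \<Longrightarrow>
    inv\<^bsub>GL n\<^esub> (g * h) = inv\<^bsub>GL n\<^esub> h * inv\<^bsub>GL n\<^esub> g"
  using group.inv_mult_group[OF group_GL] by fastforce

lemma GL_inv_cancel:
  assumes "g \<in> carrier (GL n)" "A \<in> carrier_mat n n"
  shows "g * (inv\<^bsub>GL n\<^esub> g * A) = A" "inv\<^bsub>GL n\<^esub> g * (g * A) = A"
    "A * inv\<^bsub>GL n\<^esub> g * g = A" "A * g * inv\<^bsub>GL n\<^esub> g = A"
proof -
  note c = GL_carrier_mat[OF assms(1)] GL_carrier_mat[OF GL_inv_closed[OF assms(1)]] assms(2)
  show "g * (inv\<^bsub>GL n\<^esub> g * A) = A"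
    by (simp only: assoc_mult_mat[OF c, symmetric] GL_inv_right[OF assms(1)] left_mult_one_mat[OF c(3)])
  show "inv\<^bsub>GL n\<^esub> g * (g * A) = A"
    by (simp only: assoc_mult_mat[OF c(2,1,3), symmetric] GL_inv_left[OF assms(1)] left_mult_one_mat[OF c(3)])
  show "A * inv\<^bsub>GL n\<^esub> g * g = A"
    by (simp only: assoc_mult_mat[OF c(3,2,1)] GL_inv_left[OF assms(1)] right_mult_one_mat[OF c(3)])
  show "A * g * inv\<^bsub>GL n\<^esub> g = A"
    by (simp only: assoc_mult_mat[OF c(3,1,2)] GL_inv_right[OF assms(1)] right_mult_one_mat[OF c(3)])
qed

lemma inv_GL_2:
  assumes "m2 a b c d \<in> carrier (GL 2)"
  shows "inv\<^bsub>GL 2\<^esub> (m2 a b c d) = (let D = a * d - b * c in m2 (d / D) (- b / D) (- c / D) (a / D))"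
proof -
  let ?D = "a * d - b * c"
  have D: "?D \<noteq> 0" using assms by (simp add: carrier_GL)
  let ?h = "m2 (d / ?D) (- b / ?D) (- c / ?D) (a / ?D)"
  \<comment> \<open>The denominator is a free variable here, and the determinant is substituted for
    it afterwards, so that it stays intact as one term.\<close>
  have "m2 a b c d * m2 (d / D) (- b / D) (- c / D) (a / D) = m2 (?D / D) 0 0 (?D / D)" for D
    by (simp add: diff_divide_distrib mult.commute)
  from this[of ?D] D have "m2 a b c d * ?h = 1\<^sub>m 2"
    by (simp only: one_mat_2 divide_self[OF D])
  moreover have "?h \<in> carrier (GL 2)"
  proof -
    have "det (m2 (d / D) (- b / D) (- c / D) (a / D)) = ?D / (D * D)" for D
      by (simp add: diff_divide_distrib mult.commute)
    then have "det ?h = ?D / (?D * ?D)" .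
    then have "det ?h \<noteq> 0" using D by (metis divide_eq_0_iff mult_eq_0_iff)
    then show ?thesis unfolding carrier_GL by (intro CollectI conjI m2_carrier)
  qed
  ultimately have "inv\<^bsub>GL 2\<^esub> (m2 a b c d) = ?h"
    using GL_inv_cancel(2)[OF assms, of ?h] GL_carrier_mat[OF GL_inv_closed[OF assms]] by simp
  then show ?thesis by (simp add: Let_def)
qed

lemma conj_mat_carrier [simp]:
  "g \<in> carrier (GL n) \<Longrightarrow> A \<in> carrier_mat n n \<Longrightarrow> conj_mat n g A \<in> carrier_mat n n"
  using GL_carrier_mat[of g n] GL_carrier_mat[OF GL_inv_closed, of g n]
  by (auto simp: conj_mat_def intro!: mult_carrier_mat)

lemma conj_mat_mult:
  assumes "g \<in> carrier (GL n)" "h \<in> carrier (GL n)" "A \<in> carrier_mat n n"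
  shows "conj_mat n (g * h) A = conj_mat n g (conj_mat n h A)"
proof -
  note c = GL_carrier_mat[OF assms(1)] GL_carrier_mat[OF GL_inv_closed[OF assms(1)]]
    GL_carrier_mat[OF assms(2)] GL_carrier_mat[OF GL_inv_closed[OF assms(2)]] assms(3)
  show ?thesis using c
    by (simp add: conj_mat_def GL_inv_mult assms assoc_mult_mat[of _ n n _ n _ n] mult_carrier_mat[of _ n n _ n])
qed

lemma conj_mat_one: "A \<in> carrier_mat n n \<Longrightarrow> conj_mat n (1\<^sub>m n) A = A"
  by (simp add: conj_mat_def GL_inv_one)

lemma conj_mat_1:
  "g \<in> carrier (GL n) \<Longrightarrow> conj_mat n g (1\<^sub>m n) = 1\<^sub>m n"
  using GL_carrier_mat[of g n] by (simp add: conj_mat_def GL_inv_right)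

lemma conj_mat_times:
  assumes "g \<in> carrier (GL n)" "A \<in> carrier_mat n n" "B \<in> carrier_mat n n"
  shows "conj_mat n g (A * B) = conj_mat n g A * conj_mat n g B"
proof -
  note c = GL_carrier_mat[OF assms(1)] GL_carrier_mat[OF GL_inv_closed[OF assms(1)]] assms(2,3)
  show ?thesis using c GL_inv_cancel(2)[OF assms(1)]
    by (simp add: conj_mat_def assoc_mult_mat[of _ n n _ n _ n] mult_carrier_mat[of _ n n _ n])
qed

lemma conj_mat_add:
  assumes "g \<in> carrier (GL n)" "A \<in> carrier_mat n n" "B \<in> carrier_mat n n"
  shows "conj_mat n g (A + B) = conj_mat n g A + conj_mat n g B"
proof -
  note c = GL_carrier_mat[OF assms(1)] GL_carrier_mat[OF GL_inv_closed[OF assms(1)]] assms(2,3)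
  show ?thesis using c
    by (simp add: conj_mat_def mult_add_distrib_mat[of _ n n] add_mult_distrib_mat[of _ n n] mult_carrier_mat[of _ n n _ n])
qed

lemma conj_mat_smult:
  assumes "g \<in> carrier (GL n)" "A \<in> carrier_mat n n"
  shows "conj_mat n g (z \<cdot>\<^sub>m A) = z \<cdot>\<^sub>m conj_mat n g A"
proof -
  note c = GL_carrier_mat[OF assms(1)] GL_carrier_mat[OF GL_inv_closed[OF assms(1)]] assms(2)
  show ?thesis using c
    by (simp add: conj_mat_def mult_smult_distrib[of _ n n] mult_smult_assoc_mat[of _ n n] mult_carrier_mat[of _ n n _ n])
qed

lemma conj_mat_inv_cancel:
  assumes "g \<in> carrier (GL n)" "A \<in> carrier_mat n n"
  shows "conj_mat n (inv\<^bsub>GL n\<^esub> g) (conj_mat n g A) = A"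
    "conj_mat n g (conj_mat n (inv\<^bsub>GL n\<^esub> g) A) = A"
  using assms by (simp_all add: conj_mat_mult[symmetric] GL_inv_closed GL_inv_left GL_inv_right conj_mat_one)

text \<open>The inverse is the adjugate over the determinant, and up to sign the
  \<open>(l, j)\<close> entry of the adjugate is \<open>g $$ (1 - j, 1 - l)\<close>. In this form
  conjugation is visibly polynomial in the entries of \<open>g\<close> and \<open>A\<close> and in
  \<open>inverse (det g)\<close>.\<close>

lemma conj_mat_2:
  assumes "g \<in> carrier (GL 2)" "A \<in> carrier_mat 2 2" "i < 2" "j < 2"
  shows "conj_mat 2 g A $$ (i, j) = inverse (det g) *
    (\<Sum>k<2. \<Sum>l<2. g $$ (i, k) * A $$ (k, l) * ((if l = j then 1 else -1) * g $$ (1 - j, 1 - l)))"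
proof -
  obtain a b c d where g: "g = m2 a b c d" using mat2_cases GL_carrier_mat[OF assms(1)] by blast
  obtain a' b' c' d' where A: "A = m2 a' b' c' d'" using mat2_cases assms(2) by blast
  show ?thesis
    using assms(1,3,4) unfolding g A
    by (auto simp: conj_mat_def inv_GL_2 Let_def less_2_cases_iff sum_less_2 divide_inverse algebra_simps)
qed

lemma mat_trace_conj_mat_2:
  assumes "g \<in> carrier (GL 2)" "A \<in> carrier_mat 2 2"
  shows "mat_trace (conj_mat 2 g A) = mat_trace A"
proof -
  obtain a b c d where g: "g = m2 a b c d" using mat2_cases GL_carrier_mat[OF assms(1)] by blast
  obtain a' b' c' d' where A: "A = m2 a' b' c' d'" using mat2_cases assms(2) by blast
  have "a * d - b * c \<noteq> 0" using assms(1) by (simp add: g carrier_GL)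
  then show ?thesis
    using assms(1) unfolding g A
    by (simp add: conj_mat_def inv_GL_2 Let_def divide_simps) (simp add: algebra_simps)
qed

section \<open>The conifold algebra and its representations\<close>

lemma free_alg_simps [simp]:
  "carrier free_alg = UNIV" "x \<otimes>\<^bsub>free_alg\<^esub> y = x * y" "\<one>\<^bsub>free_alg\<^esub> = 1" "\<zero>\<^bsub>free_alg\<^esub> = 0"
  "x \<oplus>\<^bsub>free_alg\<^esub> y = x + y" "c \<odot>\<^bsub>free_alg\<^esub> x = Poly_Mapping.single 0 c * x"
  by (simp_all add: free_alg_def)

lemma ring_free_alg: "ring free_alg"
proof (rule ringI)
  show "abelian_group free_alg"
    by (rule abelian_groupI) (auto simp: algebra_simps intro: exI[of _ "- x" for x])
  show "monoid free_alg"
    by (rule monoidI) (auto simp: algebra_simps)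
qed (auto simp: algebra_simps)

lemma ideal_conifold_ideal: "ideal conifold_ideal free_alg"
  unfolding conifold_ideal_def by (rule ring.genideal_ideal[OF ring_free_alg]) simp

lemma conifold_rels_subset: "conifold_rels \<subseteq> conifold_ideal"
  unfolding conifold_ideal_def by (rule ring.genideal_self[OF ring_free_alg]) simp

lemma conifold_ideal_minimal: "ideal J free_alg \<Longrightarrow> conifold_rels \<subseteq> J \<Longrightarrow> conifold_ideal \<subseteq> J"
  unfolding conifold_ideal_def by (rule ring.genideal_minimal[OF ring_free_alg])

lemma conifold_ideal_zero: "0 \<in> conifold_ideal"
  and conifold_ideal_add: "p \<in> conifold_ideal \<Longrightarrow> q \<in> conifold_ideal \<Longrightarrow> p + q \<in> conifold_ideal"
  and conifold_ideal_mult_left: "p \<in> conifold_ideal \<Longrightarrow> r * p \<in> conifold_ideal"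
proof -
  interpret ideal conifold_ideal free_alg by (rule ideal_conifold_ideal)
  show "0 \<in> conifold_ideal" using additive_subgroup.zero_closed[OF additive_subgroup_axioms] by simp
  show "p \<in> conifold_ideal \<Longrightarrow> q \<in> conifold_ideal \<Longrightarrow> p + q \<in> conifold_ideal"
    using additive_subgroup.a_closed[OF additive_subgroup_axioms, of p q] by simp
  show "p \<in> conifold_ideal \<Longrightarrow> r * p \<in> conifold_ideal"
    using I_l_closed[of p r] by simp
qed

lemma conifold_ideal_uminus: "p \<in> conifold_ideal \<Longrightarrow> - p \<in> conifold_ideal"
  using conifold_ideal_mult_left[of p "- 1"] by simp

lemma conifold_ideal_diff: "p \<in> conifold_ideal \<Longrightarrow> q \<in> conifold_ideal \<Longrightarrow> p - q \<in> conifold_ideal"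
  using conifold_ideal_add[OF _ conifold_ideal_uminus, of p q] by simp

definition cl :: "(word \<Rightarrow>\<^sub>0 complex) \<Rightarrow> (word \<Rightarrow>\<^sub>0 complex) set" where
  "cl p = conifold_ideal +>\<^bsub>free_alg\<^esub> p"

lemma cgen_eq_cl: "cgen a = cl (letter a)"
  by (simp add: cgen_def cl_def)

lemma mem_cl_iff: "q \<in> cl p \<longleftrightarrow> q - p \<in> conifold_ideal"
proof
  show "q \<in> cl p \<Longrightarrow> q - p \<in> conifold_ideal"
    by (auto simp: cl_def a_r_coset_def r_coset_def)
  show "q - p \<in> conifold_ideal \<Longrightarrow> q \<in> cl p"
    by (auto simp: cl_def a_r_coset_def r_coset_def intro!: bexI[of _ "q - p"])
qed

lemma cl_eq_iff: "cl p = cl q \<longleftrightarrow> p - q \<in> conifold_ideal"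
proof
  assume "cl p = cl q"
  then have "p \<in> cl q" using mem_cl_iff[of p p] conifold_ideal_zero by simp
  then show "p - q \<in> conifold_ideal" by (simp add: mem_cl_iff)
next
  assume *: "p - q \<in> conifold_ideal"
  have "r - p \<in> conifold_ideal \<longleftrightarrow> r - q \<in> conifold_ideal" for r
    using conifold_ideal_add[OF _ *, of "r - p"] conifold_ideal_diff[OF _ *, of "r - q"] by auto
  then show "cl p = cl q" by (auto simp: mem_cl_iff)
qed

lemma carrier_conifold_alg: "carrier conifold_alg = range cl"
  by (auto simp: conifold_alg_def quot_alg_def FactRing_def A_RCOSETS_def RCOSETS_def cl_def a_r_coset_def)

lemma cl_in_carrier [simp]: "cl p \<in> carrier conifold_alg"
  by (simp add: carrier_conifold_alg)

lemma cgen_in_carrier [simp]: "cgen a \<in> carrier conifold_alg"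
  by (simp add: cgen_eq_cl)

lemma conifold_alg_simps [simp]:
  "cl p \<otimes>\<^bsub>conifold_alg\<^esub> cl q = cl (p * q)" "cl p \<oplus>\<^bsub>conifold_alg\<^esub> cl q = cl (p + q)"
  "\<one>\<^bsub>conifold_alg\<^esub> = cl 1" "\<zero>\<^bsub>conifold_alg\<^esub> = cl 0"
  "c \<odot>\<^bsub>conifold_alg\<^esub> cl p = cl (Poly_Mapping.single 0 c * p)"
proof -
  interpret ideal conifold_ideal free_alg by (rule ideal_conifold_ideal)
  show "cl p \<otimes>\<^bsub>conifold_alg\<^esub> cl q = cl (p * q)"
    using rcoset_mult_add[of p q]
    by (simp add: conifold_alg_def quot_alg_def FactRing_def cl_def)
  show "cl p \<oplus>\<^bsub>conifold_alg\<^esub> cl q = cl (p + q)"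
    using a_rcos_sum[of p q]
    by (simp add: conifold_alg_def quot_alg_def FactRing_def cl_def)
  show "\<one>\<^bsub>conifold_alg\<^esub> = cl 1"
    by (simp add: conifold_alg_def quot_alg_def FactRing_def cl_def)
  show "\<zero>\<^bsub>conifold_alg\<^esub> = cl 0"
    by (auto simp: conifold_alg_def quot_alg_def FactRing_def mem_cl_iff)
  \<comment> \<open>Scalar multiplication in \<open>quot_alg\<close> is a union over all
    representatives; each of them contributes the same coset.\<close>
  have "cl (Poly_Mapping.single 0 c * a) = cl (Poly_Mapping.single 0 c * p)" if "a \<in> cl p" for a
    using conifold_ideal_mult_left[of "a - p" "Poly_Mapping.single 0 c"] that
    by (simp add: cl_eq_iff mem_cl_iff right_diff_distrib)
  moreover have "p \<in> cl p" by (simp add: mem_cl_iff conifold_ideal_zero)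
  ultimately have "(\<Union>a\<in>cl p. cl (Poly_Mapping.single 0 c * a)) = cl (Poly_Mapping.single 0 c * p)"
    by blast
  then show "c \<odot>\<^bsub>conifold_alg\<^esub> cl p = cl (Poly_Mapping.single 0 c * p)"
    by (simp add: conifold_alg_def quot_alg_def cl_def)
qed

section \<open>Evaluation of the free algebra at matrices\<close>

primrec mword :: "(gen \<Rightarrow> complex mat) \<Rightarrow> gen list \<Rightarrow> complex mat" where
  "mword M [] = 1\<^sub>m 2"
| "mword M (a # w) = M a * mword M w"

text \<open>For 2x2 matrices \<open>M a\<close> this is the algebra map from the free algebra with
  \<open>letter a\<close> going to \<open>M a\<close>. Working entrywise reduces it to scalar linear
  extension.\<close>

definition evmat :: "(gen \<Rightarrow> complex mat) \<Rightarrow> (word \<Rightarrow>\<^sub>0 complex) \<Rightarrow> complex mat" where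
  "evmat M p = mat 2 2 (\<lambda>(i, j). lin_ext (\<lambda>w. mword M (letters w) $$ (i, j)) p)"

lemma mword_carrier: "(\<And>a. M a \<in> carrier_mat 2 2) \<Longrightarrow> mword M w \<in> carrier_mat 2 2"
  by (induction w) (auto intro!: mult_carrier_mat)

lemma mword_append:
  assumes "\<And>a. M a \<in> carrier_mat 2 2"
  shows "mword M (u @ v) = mword M u * mword M v"
proof (induction u)
  case (Cons a u)
  show ?case
    by (simp add: Cons assoc_mult_mat[OF assms mword_carrier[OF assms] mword_carrier[OF assms]])
qed (simp add: left_mult_one_mat[OF mword_carrier[OF assms]])

lemma evmat_carrier [simp]: "evmat M p \<in> carrier_mat 2 2"
  by (simp add: evmat_def)

lemma dim_evmat [simp]: "dim_row (evmat M p) = 2" "dim_col (evmat M p) = 2"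
  by (simp_all add: evmat_def)

lemma evmat_index:
  "i < 2 \<Longrightarrow> j < 2 \<Longrightarrow> evmat M p $$ (i, j) = lin_ext (\<lambda>w. mword M (letters w) $$ (i, j)) p"
  by (simp add: evmat_def)

lemma evmat_single:
  assumes "\<And>a. M a \<in> carrier_mat 2 2"
  shows "evmat M (Poly_Mapping.single (Word w) c) = c \<cdot>\<^sub>m mword M w"
  by (rule mat2_eqI) (use mword_carrier[of M w] assms in \<open>auto simp: evmat_index\<close>)

lemma evmat_add: "evmat M (p + q) = evmat M p + evmat M q"
  by (rule mat2_eqI) (auto simp: evmat_index lin_ext_add)

lemma evmat_mult:
  assumes "\<And>a. M a \<in> carrier_mat 2 2"
  shows "evmat M (p * q) = evmat M p * evmat M q"
proof (rule eq_matI)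
  fix i j assume "i < dim_row (evmat M p * evmat M q)" "j < dim_col (evmat M p * evmat M q)"
  then have ij: "i < 2" "j < 2" by auto
  have *: "mword M (letters (w + v)) $$ (i, j)
      = mword M (letters w) $$ (i, 0) * mword M (letters v) $$ (0, j)
      + mword M (letters w) $$ (i, 1) * mword M (letters v) $$ (1, j)" for w v
    using mword_carrier[where M = M, OF assms, where w = "letters w"] mword_carrier[where M = M, OF assms, where w = "letters v"] ij
    by (simp add: plus_word_def mword_append[OF assms] scalar_prod_def sum_less_2)
  show "evmat M (p * q) $$ (i, j) = (evmat M p * evmat M q) $$ (i, j)"
    using ij
    by (simp add: evmat_index lin_ext_mult * scalar_prod_def sum_less_2)
      (simp add: lin_ext_def sum_product sum.distrib[symmetric] algebra_simps)
qed auto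

lemma lin_ext_one: "lin_ext F 1 = F 0"
  by (simp add: lin_ext_def)

lemma evmat_one [simp]: "evmat M 1 = 1\<^sub>m 2"
  by (rule mat2_eqI) (auto simp: evmat_index lin_ext_one zero_word_def)

lemma evmat_zero [simp]: "evmat M 0 = 0\<^sub>m 2 2"
  by (rule mat2_eqI) (auto simp: evmat_index)

lemma evmat_scalar:
  assumes "\<And>a. M a \<in> carrier_mat 2 2"
  shows "evmat M (Poly_Mapping.single 0 c * p) = c \<cdot>\<^sub>m evmat M p"
proof -
  have "evmat M (Poly_Mapping.single 0 c) = c \<cdot>\<^sub>m 1\<^sub>m 2"
    using evmat_single[where M = M, OF assms, where w = "[]"] by (simp add: zero_word_def)
  then show ?thesis
    by (simp add: evmat_mult[OF assms] mult_smult_assoc_mat[of _ 2 2 _ 2])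
qed

lemma evmat_letter:
  assumes "\<And>a. M a \<in> carrier_mat 2 2"
  shows "evmat M (letter a) = M a"
  using assms[of a] evmat_single[where M = M, OF assms, where w = "[a]" and c = 1]
  by (auto simp: letter_def)

lemma ideal_evmat_kernel:
  assumes "\<And>a. M a \<in> carrier_mat 2 2"
  shows "ideal {p. evmat M p = 0\<^sub>m 2 2} free_alg"
proof -
  have "ring_hom_ring free_alg (ring_mat TYPE(complex) 2 ()) (evmat M)"
    by (rule ring_hom_ringI[OF ring_free_alg ring_mat])
      (simp_all add: ring_mat_simps evmat_add evmat_mult[of M, OF assms])
  note ring_hom_ring.kernel_is_ideal[OF this]
  also have "a_kernel free_alg (ring_mat TYPE(complex) 2 ()) (evmat M) = {p. evmat M p = 0\<^sub>m 2 2}"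
    by (simp add: a_kernel_def' ring_mat_simps)
  finally show ?thesis .
qed

lemma evmat_diff:
  "evmat M (p - q) = evmat M p - evmat M q"
  by (rule mat2_eqI) (auto simp: evmat_index lin_ext_diff)

text \<open>The commutator relations follow from tracelessness: by Cayley-Hamilton a traceless 2x2
  matrix has a scalar square. So these conditions on the images of the generators describe
  \<open>trep2\<close>.\<close>

definition conifold_rep :: "(gen \<Rightarrow> complex mat) \<Rightarrow> bool" where
  "conifold_rep M \<longleftrightarrow> (\<forall>a. M a \<in> carrier_mat 2 2 \<and> mat_trace (M a) = 0) \<and> M GZ * M GZ = 1\<^sub>m 2 \<and>
     M GX * M GZ + M GZ * M GX = 0\<^sub>m 2 2 \<and> M GY * M GZ + M GZ * M GY = 0\<^sub>m 2 2"

lemma evmat_ideal: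
  assumes "conifold_rep M" "p \<in> conifold_ideal"
  shows "evmat M p = 0\<^sub>m 2 2"
proof -
  have c: "M a \<in> carrier_mat 2 2" and tr: "mat_trace (M a) = 0" for a
    using assms(1) by (auto simp: conifold_rep_def)
  note ev = evmat_diff evmat_add evmat_mult[OF c] evmat_letter[OF c]
  obtain x1 x2 x3 x4 where X: "M GX = m2 x1 x2 x3 x4" using mat2_cases[OF c] .
  obtain y1 y2 y3 y4 where Y: "M GY = m2 y1 y2 y3 y4" using mat2_cases[OF c] .
  have x4: "x4 = - x1" using tr[of GX] by (simp add: X eq_neg_iff_add_eq_0 add.commute)
  have y4: "y4 = - y1" using tr[of GY] by (simp add: Y eq_neg_iff_add_eq_0 add.commute)
  have "conifold_rels \<subseteq> {p. evmat M p = 0\<^sub>m 2 2}"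
    unfolding conifold_rels_def Let_def
  proof (intro subsetI, elim insertE)
    fix r assume "r = letter GZ ^ 2 - 1"
    with assms(1) show "r \<in> {p. evmat M p = 0\<^sub>m 2 2}"
      by (simp add: ev power2_eq_square conifold_rep_def minus_r_inv_mat[OF one_carrier_mat])
  next
    fix r assume "r = letter GX * letter GZ + letter GZ * letter GX"
    with assms(1) show "r \<in> {p. evmat M p = 0\<^sub>m 2 2}" by (simp add: ev conifold_rep_def)
  next
    fix r assume "r = letter GY * letter GZ + letter GZ * letter GY"
    with assms(1) show "r \<in> {p. evmat M p = 0\<^sub>m 2 2}" by (simp add: ev conifold_rep_def)
  next
    fix r assume r: "r = commutator (letter GX ^ 2) (letter GY)"
    show "r \<in> {p. evmat M p = 0\<^sub>m 2 2}" unfolding r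
      by (simp add: ev power2_eq_square commutator_def X Y x4 y4 zero_mat_2 algebra_simps)
  next
    fix r assume r: "r = commutator (letter GY ^ 2) (letter GX)"
    show "r \<in> {p. evmat M p = 0\<^sub>m 2 2}" unfolding r
      by (simp add: ev power2_eq_square commutator_def X Y x4 y4 zero_mat_2 algebra_simps)
  qed simp
  from conifold_ideal_minimal[OF ideal_evmat_kernel[OF c] this] assms(2) show ?thesis by blast
qed

definition rep :: "(gen \<Rightarrow> complex mat) \<Rightarrow> (word \<Rightarrow>\<^sub>0 complex) set \<Rightarrow> complex mat" where
  "rep M = (\<lambda>a\<in>carrier conifold_alg. evmat M (SOME p. a = cl p))"

text \<open>\<open>evmat M\<close> vanishes on the ideal, so every representative that
  \<open>SOME\<close> may pick gives the same matrix.\<close>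

lemma rep_cl:
  assumes "conifold_rep M"
  shows "rep M (cl p) = evmat M p"
proof -
  have "cl p = cl (SOME q. cl p = cl q)" by (rule someI[of _ p]) simp
  then have "p - (SOME q. cl p = cl q) \<in> conifold_ideal" by (simp add: cl_eq_iff)
  from evmat_ideal[OF assms this]
  have 0: "evmat M p - evmat M (SOME q. cl p = cl q) = 0\<^sub>m 2 2" by (simp add: evmat_diff)
  have "evmat M p = evmat M (SOME q. cl p = cl q)"
    by (rule mat2_diff_eq_0D[OF _ _ 0]) simp_all
  then show ?thesis by (simp add: rep_def)
qed

lemma conifold_repD: "conifold_rep M \<Longrightarrow> M a \<in> carrier_mat 2 2"
  by (simp add: conifold_rep_def)

lemma rep_cgen: "conifold_rep M \<Longrightarrow> rep M (cgen a) = M a"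
  by (simp add: cgen_eq_cl rep_cl evmat_letter conifold_repD)

lemma rep_in_trep2:
  assumes "conifold_rep M"
  shows "rep M \<in> trep2"
proof -
  note c = conifold_repD[OF assms]
  have "rep M \<in> alg_hom conifold_alg (mat_alg 2)"
    unfolding alg_hom_def
  proof (intro CollectI conjI allI ballI ring_hom_memI)
    show "rep M (\<one>\<^bsub>conifold_alg\<^esub>) = \<one>\<^bsub>mat_alg 2\<^esub>"
      by (simp add: rep_cl[OF assms] module_mat_simps)
    show "rep M (z \<odot>\<^bsub>conifold_alg\<^esub> x) = z \<odot>\<^bsub>mat_alg 2\<^esub> rep M x" if "x \<in> carrier conifold_alg" for z x
      using that by (auto simp: carrier_conifold_alg rep_cl[OF assms] module_mat_simps evmat_scalar[OF c])
  qed (auto simp: carrier_conifold_alg rep_cl[OF assms] module_mat_simps evmat_mult[OF c] evmat_add)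
  moreover have "rep M \<in> extensional (carrier conifold_alg)" by (simp add: rep_def)
  ultimately show ?thesis
    using assms by (simp add: trep2_def rep_cgen conifold_rep_def)
qed

lemma trep2_simps:
  assumes "\<phi> \<in> trep2"
  shows "\<phi> (cl p) \<in> carrier_mat 2 2" "\<phi> (cl (p * q)) = \<phi> (cl p) * \<phi> (cl q)"
    "\<phi> (cl (p + q)) = \<phi> (cl p) + \<phi> (cl q)" "\<phi> (cl 1) = 1\<^sub>m 2"
    "\<phi> (cl (Poly_Mapping.single 0 c * p)) = c \<cdot>\<^sub>m \<phi> (cl p)" "mat_trace (\<phi> (cgen a)) = 0"
    "\<phi> \<in> extensional (carrier conifold_alg)"
proof -
  have h: "\<phi> \<in> Ring.ring_hom conifold_alg (mat_alg 2)"
    and s: "\<And>c x. x \<in> carrier conifold_alg \<Longrightarrow> \<phi> (c \<odot>\<^bsub>conifold_alg\<^esub> x) = c \<odot>\<^bsub>mat_alg 2\<^esub> \<phi> x"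
    using assms by (auto simp: trep2_def alg_hom_def)
  show "\<phi> (cl p) \<in> carrier_mat 2 2"
    using ring_hom_closed[OF h cl_in_carrier] by (simp add: module_mat_simps)
  show "\<phi> (cl (p * q)) = \<phi> (cl p) * \<phi> (cl q)"
    using ring_hom_mult[OF h cl_in_carrier cl_in_carrier] by (simp add: module_mat_simps)
  show "\<phi> (cl (p + q)) = \<phi> (cl p) + \<phi> (cl q)"
    using ring_hom_add[OF h cl_in_carrier cl_in_carrier] by (simp add: module_mat_simps)
  show "\<phi> (cl 1) = 1\<^sub>m 2"
    using ring_hom_one[OF h] by (simp add: module_mat_simps)
  show "\<phi> (cl (Poly_Mapping.single 0 c * p)) = c \<cdot>\<^sub>m \<phi> (cl p)"
    using s[OF cl_in_carrier] by (simp add: module_mat_simps)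
qed (use assms in \<open>auto simp: trep2_def\<close>)

lemma lin_ext_unique:
  fixes L :: "('m \<Rightarrow>\<^sub>0 complex) \<Rightarrow> complex"
  assumes add: "\<And>p q. L (p + q) = L p + L q" and single: "\<And>w c. L (Poly_Mapping.single w c) = c * F w"
  shows "L p = lin_ext F p"
proof -
  have "L 0 = 0" using add[of 0 0] by simp
  then have "L (sum f S) = (\<Sum>w\<in>S. L (f w))" for f and S :: "'m set"
    by (induction S rule: infinite_finite_induct) (auto simp: add)
  from this[of "\<lambda>w. Poly_Mapping.single w (poly_mapping.lookup p w)" "Poly_Mapping.keys p"]
  show ?thesis by (simp add: sum_singles single lin_ext_def)
qed

text \<open>Both sides are linear in \<open>p\<close>, and on words they agree because
  \<open>\<phi>\<close> is multiplicative. Hence the images of the three generators determine a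
  representation.\<close>

lemma trep2_cl:
  assumes "\<phi> \<in> trep2"
  shows "\<phi> (cl p) = evmat (\<lambda>a. \<phi> (cgen a)) p"
proof -
  let ?M = "\<lambda>a. \<phi> (cgen a)"
  note s = trep2_simps[OF assms]
  have c: "?M a \<in> carrier_mat 2 2" for a by (simp add: cgen_eq_cl s)
  have word: "\<phi> (cl (Poly_Mapping.single (Word w) 1)) = mword ?M w" for w
  proof (induction w)
    case Nil
    show ?case using s(4) by (simp add: zero_word_def[symmetric])
  next
    case (Cons a w)
    have "Poly_Mapping.single (Word (a # w)) 1 = letter a * Poly_Mapping.single (Word w) (1::complex)"
      by (simp add: letter_def mult_single plus_word_def)
    then show ?case using Cons by (simp add: s cgen_eq_cl)
  qed
  have single: "\<phi> (cl (Poly_Mapping.single w z)) = z \<cdot>\<^sub>m mword ?M (letters w)" for w z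
  proof -
    have "Poly_Mapping.single w z = Poly_Mapping.single 0 z * Poly_Mapping.single w 1"
      by (simp add: mult_single)
    then show ?thesis using word[of "letters w"] by (simp only: s(5)) simp
  qed
  have "\<phi> (cl p) $$ (i, j) = evmat ?M p $$ (i, j)" if "i < 2" "j < 2" for i j
    unfolding evmat_index[OF that]
  proof (rule lin_ext_unique)
    show "\<phi> (cl (p + q)) $$ (i, j) = \<phi> (cl p) $$ (i, j) + \<phi> (cl q) $$ (i, j)" for p q
      using that s(1)[of q] s(1)[of p] by (simp add: s(3))
    show "\<phi> (cl (Poly_Mapping.single w z)) $$ (i, j) = z * mword ?M (letters w) $$ (i, j)" for w z
      using that mword_carrier[where M = ?M, OF c, where w = "letters w"] by (simp add: single)
  qed
  then show ?thesis by (intro mat2_eqI s) auto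
qed

lemma trep2_eqI:
  assumes "\<phi> \<in> trep2" "\<psi> \<in> trep2" "\<And>a. \<phi> (cgen a) = \<psi> (cgen a)"
  shows "\<phi> = \<psi>"
  by (rule extensionalityI[OF trep2_simps(7)[OF assms(1)] trep2_simps(7)[OF assms(2)]])
    (auto simp: carrier_conifold_alg trep2_cl[OF assms(1)] trep2_cl[OF assms(2)] assms(3))

lemma conifold_rep_of_trep2:
  assumes "\<phi> \<in> trep2"
  shows "conifold_rep (\<lambda>a. \<phi> (cgen a))"
proof -
  note s = trep2_simps[OF assms]
  let ?M = "\<lambda>a. \<phi> (cgen a)"
  have c: "?M a \<in> carrier_mat 2 2" for a by (simp add: cgen_eq_cl s)
  have rel: "evmat ?M r = 0\<^sub>m 2 2" if "r \<in> conifold_rels" for r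
  proof -
    have "cl r = cl 0" using that conifold_rels_subset by (auto simp: cl_eq_iff)
    then show ?thesis using trep2_cl[OF assms, of r] trep2_cl[OF assms, of 0] by simp
  qed
  note ev = evmat_diff evmat_add evmat_mult[of ?M, OF c] evmat_letter[of ?M, OF c]
  have "evmat ?M (letter GZ ^ 2 - 1) = 0\<^sub>m 2 2"
    "evmat ?M (letter GX * letter GZ + letter GZ * letter GX) = 0\<^sub>m 2 2"
    "evmat ?M (letter GY * letter GZ + letter GZ * letter GY) = 0\<^sub>m 2 2"
    by (rule rel; simp add: conifold_rels_def Let_def)+
  then have r: "?M GZ * ?M GZ - 1\<^sub>m 2 = 0\<^sub>m 2 2" "?M GX * ?M GZ + ?M GZ * ?M GX = 0\<^sub>m 2 2"
    "?M GY * ?M GZ + ?M GZ * ?M GY = 0\<^sub>m 2 2"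
    by (simp_all add: ev power2_eq_square)
  have "?M GZ * ?M GZ = 1\<^sub>m 2"
    using c[of GZ] by (intro mat2_diff_eq_0D[OF _ _ r(1)]) auto
  with r c s show ?thesis by (simp add: conifold_rep_def)
qed

section \<open>Generic representations and monomials\<close>

type_synonym quad = "complex \<times> complex \<times> complex \<times> complex"
type_synonym expo = "nat \<times> nat \<times> nat \<times> nat"

definition generic_mat :: "quad \<Rightarrow> gen \<Rightarrow> complex mat" where
  "generic_mat = (\<lambda>(x2, x3, y2, y3) a. case a of GX \<Rightarrow> m2 0 x2 x3 0 | GY \<Rightarrow> m2 0 y2 y3 0 | GZ \<Rightarrow> m2 1 0 0 (-1))"

lemma generic_mat_simps [simp]:
  "generic_mat (x2, x3, y2, y3) GX = m2 0 x2 x3 0"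
  "generic_mat (x2, x3, y2, y3) GY = m2 0 y2 y3 0"
  "generic_mat v GZ = m2 1 0 0 (-1)"
  by (auto simp: generic_mat_def split: prod.splits)

lemma generic_mat_carrier [simp]: "generic_mat v a \<in> carrier_mat 2 2"
  by (cases v; cases a) simp_all

lemma dim_generic_mat [simp]: "dim_row (generic_mat v a) = 2" "dim_col (generic_mat v a) = 2"
  using carrier_matD[OF generic_mat_carrier[of v a]] by auto

lemma conifold_rep_generic_mat: "conifold_rep (generic_mat v)"
proof (cases v)
  case (fields x2 x3 y2 y3)
  have "mat_trace (generic_mat v a) = 0" for a by (cases a) (simp_all add: fields)
  then show ?thesis by (simp add: conifold_rep_def fields one_mat_2 zero_mat_2)
qed

definition mono :: "expo \<Rightarrow> quad \<Rightarrow> complex" where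
  "mono = (\<lambda>(a, b, c, d) (x2, x3, y2, y3). x2 ^ a * (x3 ^ b * (y2 ^ c * y3 ^ d)))"

text \<open>Four copies of the powers of one variable, combined by three products; the right-nested
  product in \<open>mono\<close> mirrors the nesting of the tuples.\<close>

lemma lin_indep_mono: "lin_indep mono"
proof -
  note * = lin_indep_power
  have "mono = (\<lambda>(a, b) (x, y). x ^ a * (\<lambda>(a, b) (x, y). x ^ a * (\<lambda>(a, b) (x, y). x ^ a * y ^ b) b y) b y)"
    by (auto simp: mono_def fun_eq_iff)
  with lin_indep_prod[OF * lin_indep_prod[OF * lin_indep_prod[OF * *]]] show ?thesis by simp
qed

lemma mono_add: "mono (m + n) v = mono m v * mono n v"
  by (cases m; cases n; cases v) (simp add: mono_def power_add)

lemma mono_0: "mono 0 v = 1"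
  by (cases v) (simp add: mono_def zero_prod_def)

text \<open>
  The boolean \<open>r\<close> stands for a row of the matrices, \<open>True\<close> for the first one. In row \<open>r\<close>, the
  generic matrix of a word \<open>w\<close> has the single entry \<open>word_sign r w * mono (word_expo r w)\<close>, in column \<open>end_row r w\<close>.
\<close>

fun letter_expo :: "bool \<Rightarrow> gen \<Rightarrow> expo" where
  "letter_expo True GX = (1, 0, 0, 0)"
| "letter_expo False GX = (0, 1, 0, 0)"
| "letter_expo True GY = (0, 0, 1, 0)"
| "letter_expo False GY = (0, 0, 0, 1)"
| "letter_expo _ GZ = 0"

fun next_row :: "bool \<Rightarrow> gen \<Rightarrow> bool" where
  "next_row r GZ = r"
| "next_row r _ = (\<not> r)"

fun word_expo :: "bool \<Rightarrow> gen list \<Rightarrow> expo" where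
  "word_expo r [] = 0"
| "word_expo r (a # w) = letter_expo r a + word_expo (next_row r a) w"

fun end_row :: "bool \<Rightarrow> gen list \<Rightarrow> bool" where
  "end_row r [] = r"
| "end_row r (a # w) = end_row (next_row r a) w"

definition row_sign :: "bool \<Rightarrow> complex" where
  "row_sign r = (if r then 1 else - 1)"

fun word_sign :: "bool \<Rightarrow> gen list \<Rightarrow> complex" where
  "word_sign r [] = 1"
| "word_sign r (a # w) = (if a = GZ then row_sign r else 1) * word_sign (next_row r a) w"

definition row_index :: "bool \<Rightarrow> nat" where
  "row_index r = (if r then 0 else 1)"

lemma row_index_less [simp]: "row_index r < 2"
  and row_index_eq_iff [simp]: "row_index r = row_index s \<longleftrightarrow> r = s"
  by (auto simp: row_index_def)

lemma less_2_eq_row_index: "i < 2 \<Longrightarrow> \<exists>r. i = row_index r"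
  by (auto simp: row_index_def less_2_cases_iff)

text \<open>The generic matrix of a letter has one entry per row that can be nonzero, so a row of a
  product follows a single path through the rows and multiplies the entries it meets.\<close>

lemma mword_generic_mat:
  "j < 2 \<Longrightarrow> mword (generic_mat v) w $$ (row_index r, j) = (if j = row_index (end_row r w) then word_sign r w * mono (word_expo r w) v else 0)"
proof (induction w arbitrary: r)
  case Nil
  then show ?case by (auto simp: row_index_def mono_0 less_2_cases_iff)
next
  case (Cons a w)
  have c: "mword (generic_mat v) w \<in> carrier_mat 2 2" by (rule mword_carrier) simp
  have row: "generic_mat v a $$ (row_index r, k) = (if k = row_index (next_row r a) then (if a = GZ then row_sign r else 1) * mono (letter_expo r a) v else 0)"
    if "k < 2" for k
    using that by (cases v; cases a; cases r) (auto simp: row_index_def mono_def zero_prod_def less_2_cases_iff row_sign_def)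
  have "mword (generic_mat v) (a # w) $$ (row_index r, j)
      = generic_mat v a $$ (row_index r, 0) * mword (generic_mat v) w $$ (0, j) + generic_mat v a $$ (row_index r, 1) * mword (generic_mat v) w $$ (1, j)"
    using c Cons.prems by (auto simp: scalar_prod_def sum_less_2)
  also have "\<dots> = generic_mat v a $$ (row_index r, row_index (next_row r a)) * mword (generic_mat v) w $$ (row_index (next_row r a), j)"
    by (cases "next_row r a") (simp_all add: row, simp_all add: row_index_def)
  finally show ?case by (simp add: row Cons mono_add)
qed

section \<open>Words modulo the conifold relations\<close>

abbreviation word_elem :: "gen list \<Rightarrow> (word \<Rightarrow>\<^sub>0 complex)" where
  "word_elem w \<equiv> Poly_Mapping.single (Word w) 1"

lemma word_elem_append: "word_elem (u @ v) = word_elem u * word_elem v"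
  and word_elem_Cons: "word_elem (a # v) = letter a * word_elem v"
  by (simp_all add: mult_single plus_word_def letter_def)

text \<open>Scalars are multiples of the empty word and hence central; this lets them move past the
  factors of a noncommutative product.\<close>

lemma scalar_commute: "Poly_Mapping.single 0 c * p = p * Poly_Mapping.single (0::word) (c::complex)"
proof -
  have "Poly_Mapping.single 0 c * Poly_Mapping.single w d = Poly_Mapping.single w d * Poly_Mapping.single 0 c" for w :: word and d :: complex
    by (simp add: mult_single mult.commute)
  then have "Poly_Mapping.single 0 c * (\<Sum>w\<in>Poly_Mapping.keys p. Poly_Mapping.single w (poly_mapping.lookup p w))
    = (\<Sum>w\<in>Poly_Mapping.keys p. Poly_Mapping.single w (poly_mapping.lookup p w)) * Poly_Mapping.single 0 c"
    by (simp add: sum_distrib_left sum_distrib_right)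
  then show ?thesis by (simp add: sum_singles)
qed

lemma cl_mult_cong: "cl p = cl p' \<Longrightarrow> cl q = cl q' \<Longrightarrow> cl (p * q) = cl (p' * q')"
  by (metis conifold_alg_simps(1))

lemma cl_add_cong: "cl p = cl p' \<Longrightarrow> cl q = cl q' \<Longrightarrow> cl (p + q) = cl (p' + q')"
  by (metis conifold_alg_simps(2))

lemma cl_sum_cong: "(\<And>i. i \<in> S \<Longrightarrow> cl (f i) = cl (g i)) \<Longrightarrow> cl (sum f S) = cl (sum g S)"
proof (induction S rule: infinite_finite_induct)
  case (insert x S)
  from cl_add_cong[OF insert.prems[OF insertI1] insert.IH[OF insert.prems[OF insertI2]]]
  show ?case using insert.hyps by simp
qed simp_all

lemma cl_relI: "p - q \<in> conifold_rels \<Longrightarrow> cl p = cl q"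
  using conifold_rels_subset by (auto simp: cl_eq_iff)

lemma cl_letter_rels:
  "cl (letter GZ * letter GZ) = cl 1"
  "a \<noteq> GZ \<Longrightarrow> cl (letter a * letter GZ) = cl (- (letter GZ * letter a))"
  "cl (letter GX * letter GX * letter GY) = cl (letter GY * letter GX * letter GX)"
  "cl (letter GY * letter GY * letter GX) = cl (letter GX * letter GY * letter GY)"
  by (cases a; auto intro!: cl_relI simp: conifold_rels_def Let_def power2_eq_square commutator_def mult.assoc)+

text \<open>If the outer letters differ, the middle one equals one of them, and the claim is a
  commutator relation such as \<open>X X Y = Y X X\<close>, multiplied by the rest of the
  word.\<close>

lemma cl_swap:
  assumes "a \<noteq> GZ" "b \<noteq> GZ" "c \<noteq> GZ"
  shows "cl (word_elem (a # b # c # w)) = cl (word_elem (c # b # a # w))"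
proof -
  have "cl (letter a * letter b * letter c) = cl (letter c * letter b * letter a)"
    using assms cl_letter_rels(3,4) by (cases a; cases b; cases c) simp_all
  from cl_mult_cong[OF this refl, of "word_elem w"] show ?thesis by (simp add: word_elem_Cons mult.assoc)
qed

section \<open>Words in X and Y up to swaps of letters two places apart\<close>

fun comp_at :: "bool \<Rightarrow> gen \<Rightarrow> expo \<Rightarrow> nat" where
  "comp_at True GX (a, b, c, d) = a"
| "comp_at False GX (a, b, c, d) = b"
| "comp_at True GY (a, b, c, d) = c"
| "comp_at False GY (a, b, c, d) = d"
| "comp_at _ GZ _ = 0"

lemma comp_at_add: "comp_at r a (m + n) = comp_at r a m + comp_at r a n"
  by (cases m; cases n; cases r; cases a) auto

lemma comp_at_0 [simp]: "comp_at r a 0 = 0"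
  by (cases r; cases a) (auto simp: zero_prod_def)

lemma comp_at_letter_expo: "a \<noteq> GZ \<Longrightarrow> b \<noteq> GZ \<Longrightarrow> comp_at r a (letter_expo s b) = (if r = s \<and> a = b then 1 else 0)"
  by (cases r; cases a; cases s; cases b) auto

lemma next_row_neq_GZ: "a \<noteq> GZ \<Longrightarrow> next_row r a = (\<not> r)"
  by (cases a) auto

text \<open>A swap exchanges letters two places apart and so preserves the parity of positions. In a
  word without \<open>GZ\<close> the rows alternate, so an \<open>a\<close> counted in row
  \<open>r\<close> stands at an even distance from the front and gets there in steps of two.\<close>

lemma bring_to_front:
  assumes "GZ \<notin> set w" "a \<noteq> GZ" "comp_at r a (word_expo r w) > 0"
  shows "\<exists>w'. GZ \<notin> set w' \<and> cl (word_elem w) = cl (word_elem (a # w')) \<and> word_expo r w = word_expo r (a # w')"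
  using assms
proof (induction "length w" arbitrary: w rule: less_induct)
  case less
  show ?case
  proof (cases w)
    case Nil
    then show ?thesis using less.prems by simp
  next
    case w: (Cons b w1)
    show ?thesis
    proof (cases "b = a")
      case True
      then show ?thesis using less.prems w by auto
    next
      case False
      show ?thesis
      proof (cases w1)
        case Nil
        then show ?thesis using less.prems w False by (simp add: comp_at_letter_expo)
      next
        case w1: (Cons c w2)
        have bc: "b \<noteq> GZ" "c \<noteq> GZ" using less.prems(1) by (auto simp: w w1)
        \<comment> \<open>After two letters the row is \<open>r\<close> again. Since
          \<open>b\<close> differs from \<open>a\<close> and \<open>c\<close> is read in the other
          row, the counted occurrence lies in \<open>w2\<close>.\<close>
        have "comp_at r a (word_expo r w2) > 0"
          using less.prems False bc by (auto simp: w w1 comp_at_add comp_at_letter_expo next_row_neq_GZ)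
        then obtain w' where w': "GZ \<notin> set w'" "cl (word_elem w2) = cl (word_elem (a # w'))" "word_expo r w2 = word_expo r (a # w')"
          using less.hyps[of w2] less.prems by (auto simp: w w1)
        have "cl (word_elem w) = cl (word_elem ([b, c] @ a # w'))"
          unfolding w w1 using cl_mult_cong[OF refl w'(2), of "word_elem [b, c]"] by (simp add: word_elem_append[symmetric])
        also have "\<dots> = cl (word_elem (a # c # b # w'))"
          using cl_swap[OF bc less.prems(2)] by simp
        finally show ?thesis
          using w' less.prems bc by (intro exI[of _ "c # b # w'"]) (simp add: w w1 next_row_neq_GZ add_ac)
      qed
    qed
  qed
qed

lemma letter_expo_add_neq_0: "a \<noteq> GZ \<Longrightarrow> letter_expo r a + m \<noteq> 0"
  by (cases a; cases r; cases m) (auto simp: zero_prod_def)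

text \<open>The first letter of \<open>u\<close> is also counted in row \<open>r\<close> of
  \<open>v\<close>, since the exponents agree. Moved to the front of \<open>v\<close> it can be
  split off, and the exponents of the remaining words agree by cancellation.\<close>

lemma cl_word_eq_of_expo_eq:
  assumes "GZ \<notin> set u" "GZ \<notin> set v" "word_expo r u = word_expo r v"
  shows "cl (word_elem u) = cl (word_elem v)"
  using assms
proof (induction u arbitrary: r v)
  case Nil
  show ?case
  proof (cases v)
    case (Cons a w)
    with Nil.prems have "letter_expo r a + word_expo (next_row r a) w = 0" "a \<noteq> GZ" by auto
    with letter_expo_add_neq_0 show ?thesis by blast
  qed simp
next
  case (Cons a u)
  then have a: "a \<noteq> GZ" by auto
  have "comp_at r a (word_expo r v) > 0"
    using a by (simp add: Cons.prems(3)[symmetric] comp_at_add comp_at_letter_expo)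
  then obtain v' where v': "GZ \<notin> set v'" "cl (word_elem v) = cl (word_elem (a # v'))" "word_expo r v = word_expo r (a # v')"
    using bring_to_front[OF Cons.prems(2) a] by blast
  then have "word_expo (next_row r a) u = word_expo (next_row r a) v'" using Cons.prems(3) by simp
  then have "cl (word_elem u) = cl (word_elem v')" using Cons.IH[of v' "next_row r a"] Cons.prems v' by simp
  from cl_mult_cong[OF refl this, of "letter a"] v'(2) show ?case by (simp add: word_elem_Cons)
qed

text \<open>Modulo the relations these are the complementary idempotents \<open>(1 + Z) / 2\<close>
  and \<open>(1 - Z) / 2\<close>; in a generic representation, left multiplication by them selects a
  row.\<close>

definition row_idem :: "bool \<Rightarrow> (word \<Rightarrow>\<^sub>0 complex)" where
  "row_idem r = Poly_Mapping.single 0 (1 / 2) + Poly_Mapping.single 0 (row_sign r / 2) * letter GZ"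

lemma row_idem_sum: "row_idem True + row_idem False = 1"
proof -
  have "Poly_Mapping.single 0 (1 / 2) + Poly_Mapping.single 0 (1 / 2) = (1 :: word \<Rightarrow>\<^sub>0 complex)"
    by (simp only: single_add[symmetric]) simp
  then show ?thesis by (simp add: row_idem_def row_sign_def single_uminus algebra_simps)
qed

lemma cl_row_idem_GZ: "cl (row_idem r * letter GZ) = cl (Poly_Mapping.single 0 (row_sign r) * row_idem r)"
proof -
  let ?h = "Poly_Mapping.single 0 (1 / 2) :: word \<Rightarrow>\<^sub>0 complex"
    and ?t = "Poly_Mapping.single 0 (row_sign r / 2) :: word \<Rightarrow>\<^sub>0 complex"
  have "cl (row_idem r * letter GZ) = cl (?h * letter GZ + ?t * (letter GZ * letter GZ))"
    by (simp add: row_idem_def distrib_right mult.assoc)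
  also have "\<dots> = cl (?h * letter GZ + ?t * 1)"
    by (intro cl_add_cong cl_mult_cong cl_letter_rels refl)
  also have "?h * letter GZ + ?t * 1 = Poly_Mapping.single 0 (row_sign r) * row_idem r"
    by (simp add: row_idem_def distrib_left mult.assoc[symmetric] mult_single) (simp add: row_sign_def add.commute)
  finally show ?thesis .
qed

text \<open>A letter that anticommutes with \<open>Z\<close> exchanges its two eigenspaces, hence
  the two idempotents.\<close>

lemma cl_row_idem_letter:
  assumes "a \<noteq> GZ"
  shows "cl (row_idem r * letter a) = cl (letter a * row_idem (\<not> r))"
proof -
  let ?h = "Poly_Mapping.single 0 (1 / 2) :: word \<Rightarrow>\<^sub>0 complex"
    and ?t = "Poly_Mapping.single 0 (row_sign r / 2) :: word \<Rightarrow>\<^sub>0 complex"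
  have t: "Poly_Mapping.single 0 (row_sign (\<not> r) / 2) = - ?t" by (simp add: row_sign_def single_uminus)
  have "letter a * (?t * letter GZ) = ?t * (letter a * letter GZ)"
    by (metis mult.assoc scalar_commute)
  then have "letter a * row_idem (\<not> r) = ?h * letter a + ?t * (- (letter a * letter GZ))"
    unfolding row_idem_def t by (simp add: distrib_left right_diff_distrib scalar_commute[of _ "letter a"])
  moreover have "cl (- (letter a * letter GZ)) = cl (letter GZ * letter a)"
    using cl_mult_cong[OF refl cl_letter_rels(2)[OF assms], of "- 1"] by simp
  from cl_add_cong[OF refl cl_mult_cong[OF refl this]]
  have "cl (?h * letter a + ?t * (- (letter a * letter GZ))) = cl (?h * letter a + ?t * (letter GZ * letter a))" .
  ultimately show ?thesis by (simp only: row_idem_def distrib_right mult.assoc)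
qed

abbreviation drop_GZ :: "gen list \<Rightarrow> gen list" where
  "drop_GZ \<equiv> filter (\<lambda>a. a \<noteq> GZ)"

lemma word_expo_drop_GZ: "word_expo r (drop_GZ w) = word_expo r w"
  by (induction w arbitrary: r) auto

text \<open>The idempotent is pushed through the word: a \<open>GZ\<close> is replaced by its
  eigenvalue in the current row, and any other letter switches the row. Pushed back to the front,
  the idempotent leaves behind the collected sign and the word without \<open>GZ\<close>.\<close>

lemma cl_row_idem_word: "cl (row_idem r * word_elem w) = cl (row_idem r * Poly_Mapping.single (Word (drop_GZ w)) (word_sign r w))"
proof (induction w arbitrary: r)
  case (Cons a w)
  show ?case
  proof (cases "a = GZ")
    case True
    have "cl (row_idem r * word_elem (a # w)) = cl (row_idem r * letter GZ * word_elem w)" by (simp add: word_elem_Cons True mult.assoc)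
    also have "\<dots> = cl (Poly_Mapping.single 0 (row_sign r) * row_idem r * word_elem w)"
      by (intro cl_mult_cong cl_row_idem_GZ refl)
    also have "\<dots> = cl (Poly_Mapping.single 0 (row_sign r) * (row_idem r * word_elem w))" by (simp add: mult.assoc)
    also have "\<dots> = cl (Poly_Mapping.single 0 (row_sign r) * (row_idem r * Poly_Mapping.single (Word (drop_GZ w)) (word_sign r w)))"
      by (intro cl_mult_cong Cons refl)
    also have "\<dots> = cl (row_idem r * (Poly_Mapping.single 0 (row_sign r) * Poly_Mapping.single (Word (drop_GZ w)) (word_sign r w)))"
      by (metis mult.assoc scalar_commute)
    finally show ?thesis by (simp add: True mult_single)
  next
    case False
    have "cl (row_idem r * word_elem (a # w)) = cl (row_idem r * letter a * word_elem w)" by (simp add: word_elem_Cons mult.assoc)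
    also have "\<dots> = cl (letter a * row_idem (\<not> r) * word_elem w)"
      by (intro cl_mult_cong cl_row_idem_letter False refl)
    also have "\<dots> = cl (letter a * (row_idem (\<not> r) * word_elem w))" by (simp add: mult.assoc)
    also have "\<dots> = cl (letter a * (row_idem (\<not> r) * Poly_Mapping.single (Word (drop_GZ w)) (word_sign (\<not> r) w)))"
      by (intro cl_mult_cong Cons refl)
    also have "\<dots> = cl (letter a * row_idem (\<not> r) * Poly_Mapping.single (Word (drop_GZ w)) (word_sign (\<not> r) w))"
      by (simp add: mult.assoc)
    also have "\<dots> = cl (row_idem r * letter a * Poly_Mapping.single (Word (drop_GZ w)) (word_sign (\<not> r) w))"
      by (intro cl_mult_cong cl_row_idem_letter[symmetric] False refl)
    also have "row_idem r * letter a * Poly_Mapping.single (Word (drop_GZ w)) (word_sign (\<not> r) w)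
        = row_idem r * Poly_Mapping.single (Word (drop_GZ (a # w))) (word_sign r (a # w))"
      using False by (simp add: letter_def mult_single plus_word_def next_row_neq_GZ mult.assoc)
    finally show ?thesis .
  qed
qed simp

section \<open>The conifold algebra as an algebra of polynomial matrices\<close>

lemma letters_Word [simp]: "Word (letters w) = w"
  by (cases w) simp

lemma evmat_generic_mat_row:
  assumes "j < 2"
  shows "evmat (generic_mat v) p $$ (row_index r, j) = (\<Sum>w\<in>Poly_Mapping.keys p.
    if j = row_index (end_row r (letters w)) then poly_mapping.lookup p w * word_sign r (letters w) * mono (word_expo r (letters w)) v else 0)"
  using assms by (auto simp: evmat_index lin_ext_def mword_generic_mat intro!: sum.cong)

text \<open>Adding the columns removes the case distinction on where a word ends. No information is
  lost, since words with equal exponents in row \<open>r\<close> end in the same column.\<close>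

lemma evmat_generic_mat_row_sum:
  "evmat (generic_mat v) p $$ (row_index r, 0) + evmat (generic_mat v) p $$ (row_index r, 1) =
    (\<Sum>w\<in>Poly_Mapping.keys p. poly_mapping.lookup p w * word_sign r (letters w) * mono (word_expo r (letters w)) v)"
proof -
  have "(if 0 = row_index s then c else 0) + (if 1 = row_index s then c else 0) = c" for s and c :: complex
    by (simp add: row_index_def)
  then show ?thesis by (simp add: evmat_generic_mat_row sum.distrib[symmetric])
qed

text \<open>The words of \<open>p\<close> are grouped by their exponent in row \<open>r\<close>.
  Behind the idempotent all words of a group have the same class up to sign, and the signed sum of
  the coefficients of a group vanishes because monomials are linearly independent.\<close>

lemma cl_row_idem_zero:
  assumes "\<And>v. evmat (generic_mat v) p = 0\<^sub>m 2 2"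
  shows "cl (row_idem r * p) = cl 0"
proof -
  let ?K = "Poly_Mapping.keys p" and ?l = "\<lambda>w. poly_mapping.lookup p w * word_sign r (letters w)"
  let ?e = "\<lambda>w. word_expo r (letters w)"
  define S where "S = ?e ` ?K"
  define c where "c = (\<lambda>m. \<Sum>w\<in>{w \<in> ?K. ?e w = m}. ?l w)"
  have S: "finite S" by (simp add: S_def)
  have "(\<Sum>m\<in>S. c m * mono m v) = 0" for v
  proof -
    have "0 = (\<Sum>w\<in>?K. ?l w * mono (?e w) v)"
      using evmat_generic_mat_row_sum[of v p r] by (simp add: assms)
    also have "\<dots> = (\<Sum>m\<in>S. \<Sum>w\<in>{w \<in> ?K. ?e w = m}. ?l w * mono (?e w) v)"
      unfolding S_def by (rule sum.image_gen) simp
    also have "\<dots> = (\<Sum>m\<in>S. c m * mono m v)"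
      by (simp add: c_def sum_distrib_right)
    finally show ?thesis by simp
  qed
  from lin_indepD[OF lin_indep_mono S this] have c0: "c m = 0" if "m \<in> S" for m
    using that by blast
  \<comment> \<open>One word for each exponent; the coefficients of the whole group are collected on
    it.\<close>
  define g where "g = (\<lambda>m. SOME w. w \<in> ?K \<and> ?e w = m)"
  have g: "?e (g (?e w)) = ?e w" if "w \<in> ?K" for w
    using someI[of "\<lambda>u. u \<in> ?K \<and> ?e u = ?e w" w] that by (auto simp: g_def)
  have summand: "cl (row_idem r * Poly_Mapping.single w (poly_mapping.lookup p w))
      = cl (row_idem r * Poly_Mapping.single (Word (drop_GZ (letters (g (?e w))))) (?l w))" if "w \<in> ?K" for w
  proof -
    let ?c = "poly_mapping.lookup p w"
    have "Poly_Mapping.single w ?c = Poly_Mapping.single 0 ?c * word_elem (letters w)"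
      by (simp add: mult_single)
    then have "row_idem r * Poly_Mapping.single w ?c = Poly_Mapping.single 0 ?c * (row_idem r * word_elem (letters w))"
      by (metis mult.assoc scalar_commute)
    then have "cl (row_idem r * Poly_Mapping.single w ?c)
        = cl (Poly_Mapping.single 0 ?c * (row_idem r * Poly_Mapping.single (Word (drop_GZ (letters w))) (word_sign r (letters w))))"
      by (simp only:) (intro cl_mult_cong cl_row_idem_word refl)
    also have "Poly_Mapping.single 0 ?c * (row_idem r * Poly_Mapping.single (Word (drop_GZ (letters w))) (word_sign r (letters w)))
        = row_idem r * (Poly_Mapping.single 0 (?l w) * word_elem (drop_GZ (letters w)))"
      by (simp add: mult.assoc[symmetric] scalar_commute[of ?c]) (simp add: mult.assoc mult_single)
    also have "cl \<dots> = cl (row_idem r * (Poly_Mapping.single 0 (?l w) * word_elem (drop_GZ (letters (g (?e w))))))"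
      by (intro cl_mult_cong refl cl_word_eq_of_expo_eq[where r = r]) (auto simp: word_expo_drop_GZ g[OF that])
    finally show ?thesis by (simp add: mult_single)
  qed
  have "row_idem r * p = (\<Sum>w\<in>?K. row_idem r * Poly_Mapping.single w (poly_mapping.lookup p w))"
    by (simp add: sum_distrib_left[symmetric] sum_singles)
  then have "cl (row_idem r * p) = cl (\<Sum>w\<in>?K. row_idem r * Poly_Mapping.single (Word (drop_GZ (letters (g (?e w))))) (?l w))"
    by (simp only:) (intro cl_sum_cong summand)
  also have "(\<Sum>w\<in>?K. row_idem r * Poly_Mapping.single (Word (drop_GZ (letters (g (?e w))))) (?l w))
      = (\<Sum>m\<in>S. \<Sum>w\<in>{w \<in> ?K. ?e w = m}. row_idem r * Poly_Mapping.single (Word (drop_GZ (letters (g (?e w))))) (?l w))"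
    unfolding S_def by (rule sum.image_gen) simp
  also have "\<dots> = (\<Sum>m\<in>S. row_idem r * Poly_Mapping.single (Word (drop_GZ (letters (g m)))) (c m))"
  proof (intro sum.cong refl)
    fix m
    have "Poly_Mapping.single k (sum f T) = (\<Sum>w\<in>T. Poly_Mapping.single k (f w))" for k :: word and f :: "word \<Rightarrow> complex" and T
      by (induction T rule: infinite_finite_induct) (auto simp: single_add)
    then show "(\<Sum>w\<in>{w \<in> ?K. ?e w = m}. row_idem r * Poly_Mapping.single (Word (drop_GZ (letters (g (?e w))))) (?l w))
      = row_idem r * Poly_Mapping.single (Word (drop_GZ (letters (g m)))) (c m)"
      by (simp add: c_def sum_distrib_left)
  qed
  also have "\<dots> = 0" by (simp add: c0)
  finally show ?thesis .
qed

text \<open>The generic representations are jointly faithful: the two idempotents add up to one, so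
  it suffices that each \<open>row_idem r * p\<close> vanishes in the quotient.\<close>

theorem conifold_ideal_eq_kernel:
  "p \<in> conifold_ideal \<longleftrightarrow> (\<forall>v. evmat (generic_mat v) p = 0\<^sub>m 2 2)"
proof
  show "p \<in> conifold_ideal \<Longrightarrow> \<forall>v. evmat (generic_mat v) p = 0\<^sub>m 2 2"
    using evmat_ideal[OF conifold_rep_generic_mat] by blast
  assume "\<forall>v. evmat (generic_mat v) p = 0\<^sub>m 2 2"
  then have "cl (row_idem True * p + row_idem False * p) = cl (0 + 0)"
    by (intro cl_add_cong cl_row_idem_zero) auto
  then show "p \<in> conifold_ideal"
    by (simp add: distrib_right[symmetric] row_idem_sum cl_eq_iff)
qed

section \<open>Torus weights of monomials and of matrix entries\<close>

definition row_weight :: "bool \<Rightarrow> int" where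
  "row_weight r = (if r then 1 else 0)"

text \<open>Under \<open>diag(l, 1)\<close> the coordinates \<open>x2\<close> and \<open>y2\<close>
  are scaled by \<open>l\<close>, and \<open>x3\<close> and \<open>y3\<close> by its inverse.
  Conjugation scales the entry in row \<open>r\<close> and column \<open>s\<close> with weight
  \<open>row_weight r - row_weight s\<close>.\<close>

definition expo_weight :: "expo \<Rightarrow> int" where
  "expo_weight = (\<lambda>(a, b, c, d). int a + int c - int b - int d)"

text \<open>The path is built greedily. If the remaining monomial were nontrivial but had no letter
  readable in row \<open>r\<close>, its weight would be negative for the first row and positive for
  the second, while the hypothesis allows only 0 or 1 for the first and 0 or -1 for the
  second.\<close>

lemma word_of_weight:
  "expo_weight m = row_weight r - row_weight s \<Longrightarrow> \<exists>w. GZ \<notin> set w \<and> word_expo r w = m \<and> end_row r w = s"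
proof (induction "case m of (a, b, c, d) \<Rightarrow> a + b + c + d" arbitrary: m r)
  case 0
  then have "m = 0" "r = s" by (auto simp: zero_prod_def expo_weight_def row_weight_def split: prod.splits if_splits)
  then show ?case by (intro exI[of _ "[]"]) simp
next
  case (Suc n)
  obtain a b c d where m: "m = (a, b, c, d)" by (cases m)
  have "\<exists>x m'. x \<noteq> GZ \<and> m = letter_expo r x + m'"
  proof (cases r)
    case True
    with Suc m have "a > 0 \<or> c > 0" by (auto simp: expo_weight_def row_weight_def split: if_splits)
    then show ?thesis
    proof
      assume "a > 0"
      then show ?thesis using True m by (intro exI[of _ GX] exI[of _ "(a - 1, b, c, d)"]) simp
    next
      assume "c > 0"
      then show ?thesis using True m by (intro exI[of _ GY] exI[of _ "(a, b, c - 1, d)"]) simp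
    qed
  next
    case False
    with Suc m have "b > 0 \<or> d > 0" by (auto simp: expo_weight_def row_weight_def split: if_splits)
    then show ?thesis
    proof
      assume "b > 0"
      then show ?thesis using False m by (intro exI[of _ GX] exI[of _ "(a, b - 1, c, d)"]) simp
    next
      assume "d > 0"
      then show ?thesis using False m by (intro exI[of _ GY] exI[of _ "(a, b, c, d - 1)"]) simp
    qed
  qed
  then obtain x m' where x: "x \<noteq> GZ" and m': "m = letter_expo r x + m'" by blast
  have "n = (case m' of (a, b, c, d) \<Rightarrow> a + b + c + d)" "expo_weight m' = row_weight (\<not> r) - row_weight s"
    using Suc(2,3) x unfolding m' by (cases m'; cases x; cases r; simp add: expo_weight_def row_weight_def)+
  then obtain w where "GZ \<notin> set w" "word_expo (\<not> r) w = m'" "end_row (\<not> r) w = s"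
    using Suc(1) by blast
  then show ?case using x m' by (intro exI[of _ "x # w"]) (auto simp: next_row_neq_GZ)
qed

lemma word_sign_no_GZ: "GZ \<notin> set w \<Longrightarrow> word_sign r w = 1"
  by (induction w arbitrary: r) auto

lemma evmat_row_idem: "evmat (generic_mat v) (row_idem r) = (if r then m2 1 0 0 0 else m2 0 0 0 1)"
proof -
  note c = generic_mat_carrier[of v]
  have "evmat (generic_mat v) (Poly_Mapping.single 0 z) = z \<cdot>\<^sub>m 1\<^sub>m 2" for z
    using evmat_scalar[of "generic_mat v", OF c, of z 1] by simp
  then show ?thesis
    by (simp add: row_idem_def evmat_add evmat_scalar[of "generic_mat v", OF c] evmat_letter[of "generic_mat v", OF c] one_mat_2 row_sign_def)
qed

text \<open>Such elements evaluate to multiples of a monomial times a matrix unit; from them a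
  preimage of a polynomial matrix is assembled entry by entry.\<close>

lemma evmat_path:
  assumes "GZ \<notin> set w" "i < 2" "j < 2"
  shows "evmat (generic_mat v) (row_idem r * Poly_Mapping.single (Word w) z) $$ (i, j) =
    (if i = row_index r \<and> j = row_index (end_row r w) then z * mono (word_expo r w) v else 0)"
proof -
  have c: "mword (generic_mat v) w \<in> carrier_mat 2 2" by (rule mword_carrier) simp
  then obtain a b a' b' where A: "mword (generic_mat v) w = m2 a b a' b'" using mat2_cases by blast
  have "evmat (generic_mat v) (row_idem r * Poly_Mapping.single (Word w) z)
      = (if r then m2 (z * a) (z * b) 0 0 else m2 0 0 (z * a') (z * b'))"
    by (simp add: evmat_mult evmat_row_idem evmat_single A)
  then have "evmat (generic_mat v) (row_idem r * Poly_Mapping.single (Word w) z) $$ (i, j)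
      = (if i = row_index r then z * mword (generic_mat v) w $$ (row_index r, j) else 0)"
    using assms(2,3) by (auto simp: A row_index_def less_2_cases_iff)
  then show ?thesis using assms by (simp add: mword_generic_mat word_sign_no_GZ)
qed

text \<open>The action of \<open>diag(l, 1)\<close> in the coordinates of \<open>A4\<close>.\<close>

definition quad_act :: "complex \<Rightarrow> quad \<Rightarrow> quad" where
  "quad_act l = (\<lambda>(x2, x3, y2, y3). (l * x2, x3 / l, l * y2, y3 / l))"

lemma mono_quad_act: "l \<noteq> 0 \<Longrightarrow> mono m (quad_act l v) = l powi expo_weight m * mono m v"
  by (cases m; cases v)
    (simp add: mono_def quad_act_def expo_weight_def power_mult_distrib power_divide power_int_add power_int_diff mult_ac)

text \<open>Comparing coefficients at the single torus element \<open>diag(2, 1)\<close> already determines the weights.\<close>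

lemma polynomial_weight:
  fixes p :: "expo \<Rightarrow>\<^sub>0 complex"
  assumes "\<And>v. lin_ext (\<lambda>m. mono m (quad_act 2 v)) p = 2 powi k * lin_ext (\<lambda>m. mono m v) p"
    and m: "m \<in> Poly_Mapping.keys p"
  shows "expo_weight m = k"
proof -
  have "(\<Sum>m\<in>Poly_Mapping.keys p. (poly_mapping.lookup p m * (2 powi expo_weight m - 2 powi k)) * mono m v) = 0" for v
    using assms(1)[of v]
    by (simp add: lin_ext_def mono_quad_act algebra_simps sum_subtractf sum_distrib_left)
  from lin_indepD[OF lin_indep_mono finite_keys this m]
  have "(2::complex) powi expo_weight m = 2 powi k" using m by (simp add: in_keys_iff)
  \<comment> \<open>Over the reals the integer powers of 2 are strictly increasing, so equal powers
    have equal exponents.\<close>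
  then have "complex_of_real (2 powi expo_weight m) = complex_of_real (2 powi k)" by simp
  then have "(2::real) powi expo_weight m = 2 powi k" by (simp only: of_real_eq_iff)
  then show ?thesis
    using power_int_strict_increasing[of "expo_weight m" k "2::real"] power_int_strict_increasing[of k "expo_weight m" "2::real"]
    by (cases "expo_weight m" k rule: linorder_cases) auto
qed

text \<open>Equivariance fixes the weight of every monomial in the entry \<open>(r, s)\<close>, and
  this is the weight that guarantees a path from row \<open>r\<close> to row \<open>s\<close> with
  that monomial. The preimage is the sum of these paths with the coefficients of the
  entries.\<close>

theorem equivariant_polynomial_matrix:
  assumes carrier: "\<And>v. G v \<in> carrier_mat 2 2"
    and poly: "\<And>i j. i < 2 \<Longrightarrow> j < 2 \<Longrightarrow> \<exists>p. \<forall>v. G v $$ (i, j) = lin_ext (\<lambda>m. mono m v) p"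
    and equiv: "\<And>v. G (quad_act 2 v) = m2 2 0 0 1 * G v * m2 (1 / 2) 0 0 1"
  shows "\<exists>p. \<forall>v. G v = evmat (generic_mat v) p"
proof -
  have "\<exists>p. \<forall>v. G v $$ (row_index r, row_index s) = lin_ext (\<lambda>m. mono m v) p" for r s
    by (rule poly) simp_all
  then obtain p where p: "\<And>r s v. G v $$ (row_index r, row_index s) = lin_ext (\<lambda>m. mono m v) (p r s)" by metis
  \<comment> \<open>Conjugation by \<open>diag(2, 1)\<close> multiplies an entry by 2 to the
    difference of the row weights.\<close>
  have "G (quad_act 2 v) $$ (row_index r, row_index s) = 2 powi (row_weight r - row_weight s) * G v $$ (row_index r, row_index s)" for r s v
  proof -
    obtain a b c d where "G v = m2 a b c d" using mat2_cases carrier by blast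
    then show ?thesis unfolding equiv by (simp add: row_index_def row_weight_def power_int_minus)
  qed
  then have expo_weight: "expo_weight m = row_weight r - row_weight s" if "m \<in> Poly_Mapping.keys (p r s)" for r s m
    using polynomial_weight[OF _ that] by (simp add: p)
  define w where "w = (\<lambda>r s m. SOME w. GZ \<notin> set w \<and> word_expo r w = m \<and> end_row r w = s)"
  have w: "GZ \<notin> set (w r s m) \<and> word_expo r (w r s m) = m \<and> end_row r (w r s m) = s"
    if "m \<in> Poly_Mapping.keys (p r s)" for r s m
    unfolding w_def by (rule someI_ex) (rule word_of_weight[OF expo_weight[OF that]])
  define P where "P = (\<Sum>r\<in>UNIV. \<Sum>s\<in>UNIV. \<Sum>m\<in>Poly_Mapping.keys (p r s).
    row_idem r * Poly_Mapping.single (Word (w r s m)) (poly_mapping.lookup (p r s) m))"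
  have "G v $$ (row_index r', row_index s') = evmat (generic_mat v) P $$ (row_index r', row_index s')" for v r' s'
  proof -
    have "evmat (generic_mat v) P $$ (row_index r', row_index s') = (\<Sum>r\<in>UNIV. \<Sum>s\<in>UNIV. \<Sum>m\<in>Poly_Mapping.keys (p r s).
        evmat (generic_mat v) (row_idem r * Poly_Mapping.single (Word (w r s m)) (poly_mapping.lookup (p r s) m)) $$ (row_index r', row_index s'))"
      by (simp add: evmat_index P_def lin_ext_sum)
    also have "\<dots> = (\<Sum>r\<in>UNIV. \<Sum>s\<in>UNIV. if r = r' \<and> s = s' then lin_ext (\<lambda>m. mono m v) (p r s) else 0)"
    proof (intro sum.cong refl)
      fix r s
      have "(\<Sum>m\<in>Poly_Mapping.keys (p r s).
          evmat (generic_mat v) (row_idem r * Poly_Mapping.single (Word (w r s m)) (poly_mapping.lookup (p r s) m)) $$ (row_index r', row_index s'))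
        = (\<Sum>m\<in>Poly_Mapping.keys (p r s). if r = r' \<and> s = s' then poly_mapping.lookup (p r s) m * mono m v else 0)"
        using w by (intro sum.cong refl) (auto simp: evmat_path)
      then show "(\<Sum>m\<in>Poly_Mapping.keys (p r s).
          evmat (generic_mat v) (row_idem r * Poly_Mapping.single (Word (w r s m)) (poly_mapping.lookup (p r s) m)) $$ (row_index r', row_index s'))
        = (if r = r' \<and> s = s' then lin_ext (\<lambda>m. mono m v) (p r s) else 0)"
        by (simp add: lin_ext_def)
    qed
    also have "\<dots> = lin_ext (\<lambda>m. mono m v) (p r' s')"
      by (cases r'; cases s'; simp add: UNIV_bool)
    finally show ?thesis by (simp add: p)
  qed
  then have "G v $$ (i, j) = evmat (generic_mat v) P $$ (i, j)" if "i < 2" "j < 2" for v i j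
    using less_2_eq_row_index[OF that(1)] less_2_eq_row_index[OF that(2)] by blast
  then have "G v = evmat (generic_mat v) P" for v
    by (intro mat2_eqI carrier) auto
  then show ?thesis by blast
qed

section \<open>Group actions and twisted products\<close>

text \<open>Relative to a set \<open>E\<close>: the operations are total functions, and the laws are
  only claimed on the points of a variety.\<close>

definition is_action :: "('g, 'c) monoid_scheme \<Rightarrow> 'a set \<Rightarrow> ('g \<Rightarrow> 'a \<Rightarrow> 'a) \<Rightarrow> bool" where
  "is_action G E act \<longleftrightarrow> group G \<and> (\<forall>g\<in>carrier G. \<forall>x\<in>E. act g x \<in> E) \<and> (\<forall>x\<in>E. act \<one>\<^bsub>G\<^esub> x = x) \<and>
     (\<forall>g\<in>carrier G. \<forall>h\<in>carrier G. \<forall>x\<in>E. act (g \<otimes>\<^bsub>G\<^esub> h) x = act g (act h x))"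

lemma is_actionD:
  assumes "is_action G E act"
  shows "group G" "g \<in> carrier G \<Longrightarrow> x \<in> E \<Longrightarrow> act g x \<in> E" "x \<in> E \<Longrightarrow> act \<one>\<^bsub>G\<^esub> x = x"
    "g \<in> carrier G \<Longrightarrow> h \<in> carrier G \<Longrightarrow> x \<in> E \<Longrightarrow> act (g \<otimes>\<^bsub>G\<^esub> h) x = act g (act h x)"
  using assms by (auto simp: is_action_def)

lemma act_inv_act:
  assumes "is_action G E act" "g \<in> carrier G" "x \<in> E"
  shows "act (inv\<^bsub>G\<^esub> g) (act g x) = x" "act g (act (inv\<^bsub>G\<^esub> g) x) = x"
proof -
  interpret group G using is_actionD(1)[OF assms(1)] .
  show "act (inv\<^bsub>G\<^esub> g) (act g x) = x" "act g (act (inv\<^bsub>G\<^esub> g) x) = x"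
    using is_actionD(3)[OF assms(1,3)] assms(2) is_actionD(4)[OF assms(1) _ _ assms(3), symmetric] by auto
qed

lemma orbit_self:
  assumes "is_action G E act" "x \<in> E" shows "x \<in> orbit G act x"
proof -
  interpret group G using is_actionD(1)[OF assms(1)] .
  have "x = act \<one>\<^bsub>G\<^esub> x" by (rule is_actionD(3)[OF assms, symmetric])
  then show ?thesis unfolding orbit_def by blast
qed

lemma orbit_act:
  assumes "is_action G E act" "x \<in> E" "g \<in> carrier G"
  shows "orbit G act (act g x) = orbit G act x"
proof -
  interpret group G using is_actionD(1)[OF assms(1)] .
  note m = is_actionD(4)[OF assms(1) _ _ assms(2)]
  show ?thesis
  proof (intro equalityI subsetI)
    fix y assume "y \<in> orbit G act (act g x)"
    then obtain h where "h \<in> carrier G" "y = act h (act g x)" by (auto simp: orbit_def)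
    then have "h \<otimes>\<^bsub>G\<^esub> g \<in> carrier G" "y = act (h \<otimes>\<^bsub>G\<^esub> g) x" using m assms(3) by auto
    then show "y \<in> orbit G act x" unfolding orbit_def by blast
  next
    fix y assume "y \<in> orbit G act x"
    then obtain h where h: "h \<in> carrier G" "y = act h x" by (auto simp: orbit_def)
    then have "h \<otimes>\<^bsub>G\<^esub> inv\<^bsub>G\<^esub> g \<in> carrier G" "y = act (h \<otimes>\<^bsub>G\<^esub> inv\<^bsub>G\<^esub> g) (act g x)"
      using assms(3) m[of "h \<otimes>\<^bsub>G\<^esub> inv\<^bsub>G\<^esub> g" g] by (auto simp: inv_solve_right m_assoc)
    then show "y \<in> orbit G act (act g x)" unfolding orbit_def by blast
  qed
qed

lemma orbit_eq_iff:
  assumes "is_action G E act" "x \<in> E" "y \<in> E"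
  shows "orbit G act x = orbit G act y \<longleftrightarrow> (\<exists>g\<in>carrier G. y = act g x)"
proof
  assume "orbit G act x = orbit G act y"
  then have "y \<in> orbit G act x" using orbit_self[OF assms(1,3)] by simp
  then show "\<exists>g\<in>carrier G. y = act g x" by (auto simp: orbit_def)
qed (use orbit_act[OF assms(1,2)] in auto)

lemma mem_orbits:
  assumes "is_action G E act" "c \<in> orbits G E act" "x \<in> c"
  shows "x \<in> E \<and> c = orbit G act x"
proof -
  obtain y where y: "y \<in> E" "c = orbit G act y" using assms(2) by (auto simp: orbits_def)
  then obtain g where g: "g \<in> carrier G" "x = act g y" using assms(3) by (auto simp: orbit_def)
  then show ?thesis using y orbit_act[OF assms(1) y(1) g(1)] is_actionD(2)[OF assms(1)] by auto
qed

lemma same_orbit_iff: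
  assumes "is_action G E act" "x \<in> E" "y \<in> E"
  shows "(\<exists>c\<in>orbits G E act. x \<in> c \<and> y \<in> c) \<longleftrightarrow> (\<exists>g\<in>carrier G. y = act g x)"
proof
  assume "\<exists>c\<in>orbits G E act. x \<in> c \<and> y \<in> c"
  then have "orbit G act x = orbit G act y" using mem_orbits[OF assms(1)] by blast
  then show "\<exists>g\<in>carrier G. y = act g x" using orbit_eq_iff[OF assms] by blast
next
  assume "\<exists>g\<in>carrier G. y = act g x"
  then have "orbit G act x = orbit G act y" using orbit_eq_iff[OF assms] by blast
  then show "\<exists>c\<in>orbits G E act. x \<in> c \<and> y \<in> c"
    using orbit_self[OF assms(1)] assms by (auto simp: orbits_def)
qed

lemma is_action_twist:
  assumes act: "is_action H F act" and \<iota>: "\<iota> \<in> hom H (GL n)"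
  shows "is_action H (carrier (GL n) \<times> F) (twist_act n \<iota> act)"
proof -
  interpret H: group H using is_actionD(1)[OF act] .
  interpret GL: group "GL n" by (rule group_GL)
  interpret group_hom H "GL n" \<iota> by unfold_locales (rule \<iota>)
  show ?thesis
    unfolding is_action_def
  proof (intro conjI ballI)
    fix x assume "x \<in> carrier (GL n) \<times> F"
    then show "twist_act n \<iota> act \<one>\<^bsub>H\<^esub> x = x"
      using is_actionD(3)[OF act] hom_one GL_inv_one[of n] by (auto simp: twist_act_def right_mult_one_mat[OF GL_carrier_mat])
  next
    fix g x assume "g \<in> carrier H" "x \<in> carrier (GL n) \<times> F"
    then show "twist_act n \<iota> act g x \<in> carrier (GL n) \<times> F"
      using is_actionD(2)[OF act] hom_closed by (auto simp: twist_act_def intro!: GL_mult_closed GL_inv_closed)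
  next
    fix g h x assume gh: "g \<in> carrier H" "h \<in> carrier H" and x: "x \<in> carrier (GL n) \<times> F"
    have "a * (inv\<^bsub>GL n\<^esub> \<iota> h * inv\<^bsub>GL n\<^esub> \<iota> g) = a * inv\<^bsub>GL n\<^esub> \<iota> h * inv\<^bsub>GL n\<^esub> \<iota> g" if "a \<in> carrier (GL n)" for a
      using GL.m_assoc[of a "inv\<^bsub>GL n\<^esub> \<iota> h" "inv\<^bsub>GL n\<^esub> \<iota> g"] that gh by simp
    then show "twist_act n \<iota> act (g \<otimes>\<^bsub>H\<^esub> h) x = twist_act n \<iota> act g (twist_act n \<iota> act h x)"
      using is_actionD(4)[OF act gh] hom_mult[OF gh] GL_inv_mult[of "\<iota> g" n "\<iota> h"] gh x
      by (auto simp: twist_act_def)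
  qed (rule H.is_group)
qed

text \<open>Left multiplication by \<open>h\<close> commutes with the right multiplication through
  which \<open>H\<close> acts, so it permutes the orbits.\<close>

lemma bundle_act_orbit:
  assumes "is_action H F act" "\<iota> \<in> hom H (GL n)" "g \<in> carrier (GL n)" "h \<in> carrier (GL n)"
  shows "bundle_act h (orbit H (twist_act n \<iota> act) (g, x)) = orbit H (twist_act n \<iota> act) (h * g, x)"
proof -
  have *: "h * (g * inv\<^bsub>GL n\<^esub> \<iota> k) = h * g * inv\<^bsub>GL n\<^esub> \<iota> k" if "k \<in> carrier H" for k
    using monoid.m_assoc[OF group.is_monoid[OF group_GL], of h n g "inv\<^bsub>GL n\<^esub> \<iota> k"] assms(2-) that
      hom_in_carrier[OF assms(2) that] by (simp add: GL_inv_closed)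
  show ?thesis
    unfolding bundle_act_def orbit_def twist_act_def using * by (auto simp: image_def) (metis * old.prod.inject)+
qed

section \<open>Canonical forms\<close>

abbreviation Z0 :: "complex mat" where
  "Z0 \<equiv> m2 1 0 0 (-1)"

definition generic_rep :: "quad \<Rightarrow> (word \<Rightarrow>\<^sub>0 complex) set \<Rightarrow> complex mat" where
  "generic_rep v = rep (generic_mat v)"

lemma generic_rep_cl: "generic_rep v (cl p) = evmat (generic_mat v) p"
  and generic_rep_cgen: "generic_rep v (cgen a) = generic_mat v a"
  and generic_rep_trep2: "generic_rep v \<in> trep2"
  by (simp_all add: generic_rep_def rep_cl rep_cgen rep_in_trep2 conifold_rep_generic_mat)

lemma A4_eq: "A4 = range generic_rep"
proof (intro equalityI subsetI)
  fix \<phi> assume "\<phi> \<in> A4"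
  then obtain x2 x3 y2 y3 where \<phi>: "\<phi> \<in> trep2" "\<phi> (cgen GX) = m2 0 x2 x3 0"
    "\<phi> (cgen GY) = m2 0 y2 y3 0" "\<phi> (cgen GZ) = Z0" by (auto simp: A4_def)
  have "\<phi> (cgen a) = generic_rep (x2, x3, y2, y3) (cgen a)" for a
    by (cases a) (simp_all add: \<phi> generic_rep_cgen)
  then have "\<phi> = generic_rep (x2, x3, y2, y3)" by (intro trep2_eqI \<phi> generic_rep_trep2)
  then show "\<phi> \<in> range generic_rep" by blast
next
  fix \<phi> assume "\<phi> \<in> range generic_rep"
  then obtain x2 x3 y2 y3 where "\<phi> = generic_rep (x2, x3, y2, y3)" by auto
  then show "\<phi> \<in> A4" by (auto simp: A4_def generic_rep_trep2 generic_rep_cgen)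
qed

lemma A4_trep2: "\<phi> \<in> A4 \<Longrightarrow> \<phi> \<in> trep2"
  by (simp add: A4_def)

text \<open>A matrix that anticommutes with \<open>diag(1, -1)\<close> has zero diagonal, so the
  value at \<open>Z\<close> forces the shape of the values at \<open>X\<close> and
  \<open>Y\<close>.\<close>

lemma A4_iff: "\<phi> \<in> A4 \<longleftrightarrow> \<phi> \<in> trep2 \<and> \<phi> (cgen GZ) = Z0"
proof
  assume *: "\<phi> \<in> trep2 \<and> \<phi> (cgen GZ) = Z0"
  then have r: "conifold_rep (\<lambda>a. \<phi> (cgen a))" by (simp add: conifold_rep_of_trep2)
  obtain a b c d where X: "\<phi> (cgen GX) = m2 a b c d" using mat2_cases[OF conifold_repD[OF r]] .
  obtain a' b' c' d' where Y: "\<phi> (cgen GY) = m2 a' b' c' d'" using mat2_cases[OF conifold_repD[OF r]] .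
  have "a = 0 \<and> d = 0 \<and> a' = 0 \<and> d' = 0"
    using r * by (simp add: conifold_rep_def X Y zero_mat_2)
  then show "\<phi> \<in> A4" using * X Y by (auto simp: A4_def)
qed (auto simp: A4_def)

lemma rep_act_cl: "rep_act g \<phi> (cl p) = conj_mat 2 g (\<phi> (cl p))"
  and rep_act_cgen: "rep_act g \<phi> (cgen a) = conj_mat 2 g (\<phi> (cgen a))"
  by (simp_all add: rep_act_def)

lemma rep_act_trep2:
  assumes g: "g \<in> carrier (GL 2)" and \<phi>: "\<phi> \<in> trep2"
  shows "rep_act g \<phi> \<in> trep2"
proof -
  note s = trep2_simps[OF \<phi>] and r = rep_act_cl[of g \<phi>]
  have "rep_act g \<phi> \<in> alg_hom conifold_alg (mat_alg 2)"
    unfolding alg_hom_def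
  proof (intro CollectI conjI allI ballI ring_hom_memI)
    show "rep_act g \<phi> (\<one>\<^bsub>conifold_alg\<^esub>) = \<one>\<^bsub>mat_alg 2\<^esub>"
      by (simp add: r s(4) conj_mat_1[OF g] module_mat_simps)
    show "rep_act g \<phi> (z \<odot>\<^bsub>conifold_alg\<^esub> x) = z \<odot>\<^bsub>mat_alg 2\<^esub> rep_act g \<phi> x" if "x \<in> carrier conifold_alg" for z x
      using that by (auto simp: carrier_conifold_alg r s(5) conj_mat_smult[OF g s(1)] module_mat_simps)
    show "rep_act g \<phi> (x \<otimes>\<^bsub>conifold_alg\<^esub> y) = rep_act g \<phi> x \<otimes>\<^bsub>mat_alg 2\<^esub> rep_act g \<phi> y"
      if "x \<in> carrier conifold_alg" "y \<in> carrier conifold_alg" for x y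
      using that by (auto simp: carrier_conifold_alg r s(2) conj_mat_times[OF g s(1) s(1)] module_mat_simps)
    show "rep_act g \<phi> (x \<oplus>\<^bsub>conifold_alg\<^esub> y) = rep_act g \<phi> x \<oplus>\<^bsub>mat_alg 2\<^esub> rep_act g \<phi> y"
      if "x \<in> carrier conifold_alg" "y \<in> carrier conifold_alg" for x y
      using that by (auto simp: carrier_conifold_alg r s(3) conj_mat_add[OF g s(1) s(1)] module_mat_simps)
    show "rep_act g \<phi> x \<in> carrier (mat_alg 2)" if "x \<in> carrier conifold_alg" for x
      using that by (auto simp: carrier_conifold_alg r conj_mat_carrier[OF g s(1)] module_mat_simps)
  qed
  moreover have "mat_trace (rep_act g \<phi> (cgen a)) = 0" for a
    using mat_trace_conj_mat_2[OF g s(1)[of "letter a"]] s(6) by (simp add: rep_act_cl cgen_eq_cl)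
  moreover have "rep_act g \<phi> \<in> extensional (carrier conifold_alg)" by (simp add: rep_act_def)
  ultimately show ?thesis by (simp add: trep2_def)
qed

lemma trep2_cgen_carrier: "\<phi> \<in> trep2 \<Longrightarrow> \<phi> (cgen a) \<in> carrier_mat 2 2"
  by (simp add: cgen_eq_cl trep2_simps)

lemma is_action_rep_act: "is_action (GL 2) trep2 rep_act"
  unfolding is_action_def
proof (intro conjI ballI)
  fix \<phi> assume \<phi>: "\<phi> \<in> trep2"
  show "rep_act \<one>\<^bsub>GL 2\<^esub> \<phi> = \<phi>"
    by (intro trep2_eqI rep_act_trep2 \<phi>) (simp_all add: GL_one_closed rep_act_cgen conj_mat_one trep2_cgen_carrier[OF \<phi>])
  fix g h assume gh: "g \<in> carrier (GL 2)" "h \<in> carrier (GL 2)"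
  show "rep_act (g \<otimes>\<^bsub>GL 2\<^esub> h) \<phi> = rep_act g (rep_act h \<phi>)"
    by (intro trep2_eqI rep_act_trep2 \<phi>)
      (simp_all add: GL_mult_closed gh rep_act_cgen conj_mat_mult trep2_cgen_carrier[OF \<phi>])
qed (auto simp: rep_act_trep2 group_GL)

section \<open>The torus as stabilizer of diag(1, -1)\<close>

lemma carrier_torus: "carrier torus = {m2 l 0 0 m | l m. l \<noteq> 0 \<and> m \<noteq> 0}"
  and torus_mult [simp]: "x \<otimes>\<^bsub>torus\<^esub> y = x * y"
  and torus_one [simp]: "\<one>\<^bsub>torus\<^esub> = 1\<^sub>m 2"
  by (simp_all add: torus_def)

lemma torus_GL: "t \<in> carrier torus \<Longrightarrow> t \<in> carrier (GL 2)"
  by (auto simp: carrier_torus carrier_GL)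

lemma inv_diag: "l \<noteq> 0 \<Longrightarrow> m \<noteq> 0 \<Longrightarrow> inv\<^bsub>GL 2\<^esub> (m2 l 0 0 m) = m2 (1 / l) 0 0 (1 / m)"
  by (subst inv_GL_2) (auto simp: carrier_GL Let_def)

lemma group_torus: "group torus"
proof -
  have "subgroup (carrier torus) (GL 2)"
  proof (rule group.subgroupI[OF group_GL])
    show "carrier torus \<subseteq> carrier (GL 2)" using torus_GL by blast
    show "carrier torus \<noteq> {}" by (auto simp: carrier_torus intro: exI[of _ 1])
    show "inv\<^bsub>GL 2\<^esub> a \<in> carrier torus" if "a \<in> carrier torus" for a
      using that by (auto simp: carrier_torus inv_diag)
    show "a \<otimes>\<^bsub>GL 2\<^esub> b \<in> carrier torus" if "a \<in> carrier torus" "b \<in> carrier torus" for a b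
      using that by (auto simp: carrier_torus)
  qed
  from subgroup.subgroup_is_group[OF this group_GL] show ?thesis by (simp add: torus_def)
qed

text \<open>Fixing \<open>Z0\<close> under conjugation means commuting with it, and a matrix that
  commutes with a diagonal matrix with distinct eigenvalues is diagonal.\<close>

lemma torus_iff_conj:
  assumes g: "g \<in> carrier (GL 2)"
  shows "g \<in> carrier torus \<longleftrightarrow> conj_mat 2 g Z0 = Z0"
proof -
  obtain a b c d where g': "g = m2 a b c d" using mat2_cases GL_carrier_mat[OF g] by blast
  have "conj_mat 2 g Z0 = Z0 \<longleftrightarrow> g * Z0 = Z0 * g"
    using GL_inv_cancel(3)[OF g, of "g * Z0"] GL_inv_cancel(4)[OF g, of Z0] GL_carrier_mat[OF g]
    by (auto simp: conj_mat_def)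
  also have "\<dots> \<longleftrightarrow> b = 0 \<and> c = 0" by (auto simp: g')
  also have "\<dots> \<longleftrightarrow> g \<in> carrier torus"
    using g by (auto simp: g' carrier_torus carrier_GL)
  finally show ?thesis by blast
qed

lemma rep_act_A4_iff:
  assumes "g \<in> carrier (GL 2)" "P \<in> A4"
  shows "rep_act g P \<in> A4 \<longleftrightarrow> g \<in> carrier torus"
  using assms by (simp add: A4_iff rep_act_trep2 rep_act_cgen torus_iff_conj)

lemma is_action_torus: "is_action torus A4 rep_act"
  using is_action_rep_act group_torus
  by (auto simp: is_action_def torus_GL rep_act_A4_iff A4_trep2)

lemma id_hom_torus: "(\<lambda>t. t) \<in> hom torus (GL 2)"
  by (rule homI) (auto simp: torus_GL)

lemmas is_action_torus_act = is_action_twist[OF is_action_torus id_hom_torus]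

lemma rep_act_eq_iff:
  assumes "g \<in> carrier (GL 2)" "g' \<in> carrier (GL 2)" "P \<in> A4" "P' \<in> A4"
  shows "rep_act g P = rep_act g' P' \<longleftrightarrow> (\<exists>t\<in>carrier torus. (g', P') = torus_act t (g, P))"
proof
  assume eq: "rep_act g P = rep_act g' P'"
  \<comment> \<open>Forced by the form of the action: the first component \<open>g * inv t\<close>
    has to be \<open>g'\<close>.\<close>
  define t where "t = inv\<^bsub>GL 2\<^esub> g' * g"
  note i = GL_inv_closed[OF assms(2)]
  have t: "t \<in> carrier (GL 2)" by (simp add: t_def GL_mult_closed i assms)
  have P': "rep_act t P = P'"
    using is_actionD(4)[OF is_action_rep_act i assms(1) A4_trep2[OF assms(3)]]
      act_inv_act(1)[OF is_action_rep_act assms(2) A4_trep2[OF assms(4)]]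
    by (simp add: t_def eq)
  then have "t \<in> carrier torus" using rep_act_A4_iff[OF t assms(3)] assms(4) by simp
  moreover have "g * inv\<^bsub>GL 2\<^esub> t = g'"
    using GL_inv_cancel(1)[OF assms(1), of g'] assms(1,2)
    by (simp add: t_def GL_inv_mult i GL_inv_inv GL_carrier_mat)
  ultimately show "\<exists>t\<in>carrier torus. (g', P') = torus_act t (g, P)"
    using P' by (auto simp: twist_act_def)
next
  assume "\<exists>t\<in>carrier torus. (g', P') = torus_act t (g, P)"
  then obtain t where t: "t \<in> carrier torus" "g' = g * inv\<^bsub>GL 2\<^esub> t" "P' = rep_act t P"
    by (auto simp: twist_act_def)
  have "rep_act g' P' = rep_act (g * inv\<^bsub>GL 2\<^esub> t * t) P"
    using is_actionD(4)[OF is_action_rep_act assms(2) torus_GL[OF t(1)] A4_trep2[OF assms(3)]] t by simp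
  then show "rep_act g P = rep_act g' P'"
    using GL_inv_cancel(3)[OF torus_GL[OF t(1)] GL_carrier_mat[OF assms(1)]] by simp
qed

section \<open>The bundle over the representation variety\<close>

definition regular_mat :: "'a variety \<Rightarrow> nat \<Rightarrow> ('a \<Rightarrow> complex mat) \<Rightarrow> bool" where
  "regular_mat V n M \<longleftrightarrow> (\<forall>i<n. \<forall>j<n. (\<lambda>x. M x $$ (i, j)) \<in> regular V)"

lemma regular_matD: "regular_mat V n M \<Longrightarrow> i < n \<Longrightarrow> j < n \<Longrightarrow> (\<lambda>x. M x $$ (i, j)) \<in> regular V"
  by (simp add: regular_mat_def)

lemma regular_mat_m2:
  assumes "a \<in> regular V" "b \<in> regular V" "c \<in> regular V" "d \<in> regular V"
  shows "regular_mat V 2 (\<lambda>x. m2 (a x) (b x) (c x) (d x))"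
  using assms unfolding regular_mat_def by (auto simp: less_2_cases_iff)

lemma regular_det_2:
  assumes V: "is_variety V" and M: "regular_mat V 2 M" "\<And>x. x \<in> points V \<Longrightarrow> M x \<in> carrier_mat 2 2"
  shows "(\<lambda>x. det (M x)) \<in> regular V"
proof (rule regular_cong[OF V])
  show "(\<lambda>x. M x $$ (0, 0) * M x $$ (1, 1) - M x $$ (0, 1) * M x $$ (1, 0)) \<in> regular V"
    by (intro regular_intros V regular_matD[OF M(1)]) auto
  show "det (M x) = M x $$ (0, 0) * M x $$ (1, 1) - M x $$ (0, 1) * M x $$ (1, 0)" if "x \<in> points V" for x
    using mat2_eta[OF M(2)[OF that]] by (metis det_m2)
qed

lemma var_morphism_GL_varI:
  assumes V: "is_variety V" and M: "\<And>x. x \<in> points V \<Longrightarrow> M x \<in> carrier (GL n)"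
    "regular_mat V n M" "(\<lambda>x. inverse (det (M x))) \<in> regular V"
  shows "var_morphism V (GL_var n) M"
  unfolding GL_var_def
  by (rule var_morphism_affine_varI[OF V])
    (use M in \<open>auto simp: GL_coords_def mat_coords_def regular_mat_def\<close>)

lemma var_morphism_GL_varD:
  assumes "var_morphism V (GL_var n) M"
  shows "x \<in> points V \<Longrightarrow> M x \<in> carrier (GL n)" "regular_mat V n M" "(\<lambda>x. inverse (det (M x))) \<in> regular V"
proof -
  show "x \<in> points V \<Longrightarrow> M x \<in> carrier (GL n)"
    using var_morphismD(1)[OF assms, of x] by (simp add: GL_var_def)
  have "(\<lambda>g. g $$ (i, j)) \<in> regular (GL_var n)" if "i < n" "j < n" for i j
    unfolding GL_var_def by (rule affine_var_coord) (use that in \<open>auto simp: GL_coords_def mat_coords_def\<close>)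
  then show "regular_mat V n M"
    using var_morphismD(2)[OF assms] by (auto simp: regular_mat_def)
  have "(\<lambda>g. inverse (det g)) \<in> regular (GL_var n)"
    unfolding GL_var_def by (rule affine_var_coord) (auto simp: GL_coords_def)
  then show "(\<lambda>x. inverse (det (M x))) \<in> regular V"
    using var_morphismD(2)[OF assms] by blast
qed

lemma det_GL_inv:
  assumes "g \<in> carrier (GL n)" shows "det (inv\<^bsub>GL n\<^esub> g) = inverse (det g)"
proof -
  have "det g * det (inv\<^bsub>GL n\<^esub> g) = 1"
    using det_mult[OF GL_carrier_mat[OF assms] GL_carrier_mat[OF GL_inv_closed[OF assms]]]
    by (simp add: GL_inv_right[OF assms])
  then show ?thesis by (simp add: inverse_unique)
qed

lemma var_morphism_GL_inv:
  assumes V: "is_variety V" and M: "var_morphism V (GL_var 2) M"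
  shows "var_morphism V (GL_var 2) (\<lambda>x. inv\<^bsub>GL 2\<^esub> (M x))"
proof (rule var_morphism_GL_varI[OF V])
  note D = var_morphism_GL_varD[OF M]
  show "inv\<^bsub>GL 2\<^esub> (M x) \<in> carrier (GL 2)" if "x \<in> points V" for x by (rule GL_inv_closed[OF D(1)[OF that]])
  show "(\<lambda>x. inverse (det (inv\<^bsub>GL 2\<^esub> (M x)))) \<in> regular V"
    by (rule regular_cong[OF V regular_det_2[OF V D(2)]])
      (auto simp: det_GL_inv[OF D(1)] intro: GL_carrier_mat[OF D(1)])
  have eq: "inv\<^bsub>GL 2\<^esub> (M x) = m2 (inverse (det (M x)) * M x $$ (1, 1)) (inverse (det (M x)) * - M x $$ (0, 1))
      (inverse (det (M x)) * - M x $$ (1, 0)) (inverse (det (M x)) * M x $$ (0, 0))" if x: "x \<in> points V" for x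
  proof -
    obtain a b c d where "M x = m2 a b c d" using mat2_cases GL_carrier_mat[OF D(1)[OF x]] by blast
    then show ?thesis using D(1)[OF x] by (simp add: inv_GL_2 Let_def divide_inverse mult.commute)
  qed
  show "regular_mat V 2 (\<lambda>x. inv\<^bsub>GL 2\<^esub> (M x))"
    unfolding regular_mat_def
  proof (intro allI impI)
    fix i j :: nat assume ij: "i < 2" "j < 2"
    have "regular_mat V 2 (\<lambda>x. m2 (inverse (det (M x)) * M x $$ (1, 1)) (inverse (det (M x)) * - M x $$ (0, 1))
      (inverse (det (M x)) * - M x $$ (1, 0)) (inverse (det (M x)) * M x $$ (0, 0)))"
      by (intro regular_mat_m2 regular_intros V D(3) regular_matD[OF D(2)]) auto
    from regular_matD[OF this ij]
    show "(\<lambda>x. (inv\<^bsub>GL 2\<^esub> (M x)) $$ (i, j)) \<in> regular V"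
      by (rule regular_cong[OF V]) (simp add: eq)
  qed
qed

lemma var_morphism_GL_mult:
  assumes V: "is_variety V" and M: "var_morphism V (GL_var n) M" and N: "var_morphism V (GL_var n) N"
  shows "var_morphism V (GL_var n) (\<lambda>x. M x * N x)"
proof (rule var_morphism_GL_varI[OF V])
  note D = var_morphism_GL_varD[OF M] and E = var_morphism_GL_varD[OF N]
  show "M x * N x \<in> carrier (GL n)" if "x \<in> points V" for x
    by (rule GL_mult_closed[OF D(1)[OF that] E(1)[OF that]])
  show "(\<lambda>x. inverse (det (M x * N x))) \<in> regular V"
    by (rule regular_cong[OF V regular_mult[OF V D(3) E(3)]])
      (auto simp: det_mult[OF GL_carrier_mat[OF D(1)] GL_carrier_mat[OF E(1)]])
  show "regular_mat V n (\<lambda>x. M x * N x)"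
    unfolding regular_mat_def
  proof (intro allI impI)
    fix i j assume ij: "i < n" "j < n"
    have "(\<lambda>x. \<Sum>k<n. M x $$ (i, k) * N x $$ (k, j)) \<in> regular V"
      by (intro regular_intros V regular_matD[OF D(2)] regular_matD[OF E(2)] ij) auto
    then show "(\<lambda>x. (M x * N x) $$ (i, j)) \<in> regular V"
    proof (rule regular_cong[OF V])
      fix x assume "x \<in> points V"
      from GL_carrier_mat[OF D(1)[OF this]] GL_carrier_mat[OF E(1)[OF this]]
      show "(M x * N x) $$ (i, j) = (\<Sum>k<n. M x $$ (i, k) * N x $$ (k, j))"
        using ij by (auto simp: scalar_prod_def lessThan_atLeast0 intro!: sum.cong)
    qed
  qed
qed

lemma regular_mat_conj:
  assumes V: "is_variety V" and M: "var_morphism V (GL_var 2) M"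
    and A: "regular_mat V 2 A" "\<And>x. x \<in> points V \<Longrightarrow> A x \<in> carrier_mat 2 2"
  shows "regular_mat V 2 (\<lambda>x. conj_mat 2 (M x) (A x))"
  unfolding regular_mat_def
proof (intro allI impI)
  note D = var_morphism_GL_varD[OF M]
  fix i j :: nat assume ij: "i < 2" "j < 2"
  have "(\<lambda>x. inverse (det (M x)) * (\<Sum>k<2. \<Sum>l<2. M x $$ (i, k) * A x $$ (k, l) *
      ((if l = j then 1 else -1) * M x $$ (1 - j, 1 - l)))) \<in> regular V"
    by (intro regular_intros V D(3) regular_matD[OF D(2)] regular_matD[OF A(1)] ij) auto
  then show "(\<lambda>x. conj_mat 2 (M x) (A x) $$ (i, j)) \<in> regular V"
    by (rule regular_cong[OF V]) (rule conj_mat_2[OF D(1) A(2) ij])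
qed

lemma points_trep2_var [simp]: "points trep2_var = trep2"
  and is_variety_trep2_var [simp]: "is_variety trep2_var"
  and points_A4_var [simp]: "points A4_var = A4"
  and is_variety_A4_var [simp]: "is_variety A4_var"
  and points_GL_var [simp]: "points (GL_var n) = carrier (GL n)"
  and is_variety_GL_var [simp]: "is_variety (GL_var n)"
  and points_torus_var [simp]: "points torus_var = carrier torus"
  and is_variety_torus_var [simp]: "is_variety torus_var"
  by (simp_all add: trep2_var_def A4_var_def GL_var_def torus_var_def)

lemma var_morphism_trep2_varI:
  assumes "is_variety V" "\<And>x. x \<in> points V \<Longrightarrow> \<pi> x \<in> trep2" "\<And>a. regular_mat V 2 (\<lambda>x. \<pi> x (cgen a))"
  shows "var_morphism V trep2_var \<pi>"
  unfolding trep2_var_def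
  by (rule var_morphism_affine_varI[OF assms(1)])
    (use assms in \<open>auto simp: trep2_coords_def regular_mat_def\<close>)

lemma regular_mat_trep2: "regular_mat trep2_var 2 (\<lambda>\<phi>. \<phi> (cgen a))"
  unfolding regular_mat_def trep2_var_def
  by (intro allI impI affine_var_coord) (auto simp: trep2_coords_def)

lemma var_morphism_trep2_varD:
  assumes "var_morphism V trep2_var \<pi>"
  shows "x \<in> points V \<Longrightarrow> \<pi> x \<in> trep2" "regular_mat V 2 (\<lambda>x. \<pi> x (cgen a))"
  using var_morphismD[OF assms] regular_mat_trep2[of a] by (auto simp: regular_mat_def)

text \<open>\<open>A4_var\<close> carries the coordinates of \<open>trep2_var\<close>, so on top of
  regularity only the values have to be checked.\<close>

lemma var_morphism_A4_var_iff:
  assumes "is_variety V"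
  shows "var_morphism V A4_var \<pi> \<longleftrightarrow> var_morphism V trep2_var \<pi> \<and> (\<forall>x\<in>points V. \<pi> x \<in> A4)"
proof
  assume *: "var_morphism V A4_var \<pi>"
  have "f \<in> regular A4_var" if "f \<in> trep2_coords" for f
    unfolding A4_var_def by (rule affine_var_coord[OF that])
  then show "var_morphism V trep2_var \<pi> \<and> (\<forall>x\<in>points V. \<pi> x \<in> A4)"
    using var_morphismD[OF *] unfolding trep2_var_def
    by (auto intro!: var_morphism_affine_varI[OF assms] A4_trep2)
next
  assume *: "var_morphism V trep2_var \<pi> \<and> (\<forall>x\<in>points V. \<pi> x \<in> A4)"
  have "f \<in> regular trep2_var" if "f \<in> trep2_coords" for f
    unfolding trep2_var_def by (rule affine_var_coord[OF that])
  then show "var_morphism V A4_var \<pi>"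
    using * var_morphismD(2)[of V trep2_var \<pi>] unfolding A4_var_def
    by (auto intro!: var_morphism_affine_varI[OF assms])
qed

lemma var_morphism_rep_act:
  assumes V: "is_variety V" and M: "var_morphism V (GL_var 2) M" and \<pi>: "var_morphism V trep2_var \<pi>"
  shows "var_morphism V trep2_var (\<lambda>x. rep_act (M x) (\<pi> x))"
proof (rule var_morphism_trep2_varI[OF V])
  note D = var_morphism_GL_varD[OF M] and E = var_morphism_trep2_varD[OF \<pi>]
  show "rep_act (M x) (\<pi> x) \<in> trep2" if "x \<in> points V" for x
    by (rule rep_act_trep2[OF D(1)[OF that] E(1)[OF that]])
  show "regular_mat V 2 (\<lambda>x. rep_act (M x) (\<pi> x) (cgen a))" for a
    unfolding rep_act_cgen by (rule regular_mat_conj[OF V M E(2)]) (rule trep2_cgen_carrier[OF E(1)])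
qed

lemma var_morphism_torus_GL: "var_morphism torus_var (GL_var 2) (\<lambda>t. t)"
proof (rule var_morphism_GL_varI)
  show "regular_mat torus_var 2 (\<lambda>t. t)" "(\<lambda>t. inverse (det t)) \<in> regular torus_var"
    unfolding regular_mat_def torus_var_def
    by (auto intro!: affine_var_coord simp: GL_coords_def mat_coords_def)
qed (auto simp: torus_GL)

lemma var_morphism_torusI:
  assumes "is_variety V" "var_morphism V (GL_var 2) M" "\<And>x. x \<in> points V \<Longrightarrow> M x \<in> carrier torus"
  shows "var_morphism V torus_var M"
  unfolding torus_var_def
proof (rule var_morphism_affine_varI[OF assms(1,3)])
  fix f assume "f \<in> GL_coords 2"
  then have "f \<in> regular (GL_var 2)" unfolding GL_var_def by (rule affine_var_coord)
  then show "(\<lambda>x. f (M x)) \<in> regular V" by (rule var_morphismD(2)[OF assms(2)])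
qed simp_all

text \<open>
  A local section of \<open>GL\<^sub>2 \<rightarrow> GL\<^sub>2 \<cdot> diag(1, -1)\<close> over the principal open set where \<open>\<delta>\<close> does not vanish.
\<close>

definition local_section ::
  "(((word \<Rightarrow>\<^sub>0 complex) set \<Rightarrow> complex mat) \<Rightarrow> complex) \<Rightarrow>
    (((word \<Rightarrow>\<^sub>0 complex) set \<Rightarrow> complex mat) \<Rightarrow> complex mat) \<Rightarrow> bool" where
  "local_section \<delta> G \<longleftrightarrow> \<delta> \<in> regular trep2_var \<and> var_morphism (principal_open trep2_var \<delta>) (GL_var 2) G \<and>
     (\<forall>\<phi>\<in>trep2. \<delta> \<phi> \<noteq> 0 \<longrightarrow> conj_mat 2 (G \<phi>) Z0 = \<phi> (cgen GZ))"

text \<open>The equation with \<open>Z0\<close> is polynomial and becomes a conjugation once the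
  determinant is invertible. The constant \<open>e\<close> leaves room for a sign in the
  determinant.\<close>

lemma local_sectionI:
  assumes \<delta>: "\<delta> \<in> regular trep2_var" and e: "e \<noteq> 0"
    and reg: "a \<in> regular trep2_var" "b \<in> regular trep2_var" "c \<in> regular trep2_var" "d \<in> regular trep2_var"
    and det: "\<And>\<phi>. \<phi> \<in> trep2 \<Longrightarrow> a \<phi> * d \<phi> - b \<phi> * c \<phi> = e * \<delta> \<phi>"
    and Z: "\<And>\<phi>. \<phi> \<in> trep2 \<Longrightarrow> m2 (a \<phi>) (b \<phi>) (c \<phi>) (d \<phi>) * Z0 = \<phi> (cgen GZ) * m2 (a \<phi>) (b \<phi>) (c \<phi>) (d \<phi>)"
  shows "local_section \<delta> (\<lambda>\<phi>. m2 (a \<phi>) (b \<phi>) (c \<phi>) (d \<phi>))"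
  unfolding local_section_def
proof (intro conjI ballI impI)
  let ?G = "\<lambda>\<phi>. m2 (a \<phi>) (b \<phi>) (c \<phi>) (d \<phi>)"
  have G: "?G \<phi> \<in> carrier (GL 2)" if "\<phi> \<in> trep2" "\<delta> \<phi> \<noteq> 0" for \<phi>
    using det[OF that(1)] that(2) e by (simp add: carrier_GL)
  show "var_morphism (principal_open trep2_var \<delta>) (GL_var 2) ?G"
  proof (rule var_morphism_GL_varI)
    show "regular_mat (principal_open trep2_var \<delta>) 2 ?G"
      by (intro regular_mat_m2 regular_principal_open reg)
    have "(\<lambda>\<phi>. inverse (\<delta> \<phi>) / e) \<in> regular (principal_open trep2_var \<delta>)"
      by (intro regular_intros regular_inverse_principal_open) simp
    then show "(\<lambda>\<phi>. inverse (det (?G \<phi>))) \<in> regular (principal_open trep2_var \<delta>)"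
      by (rule regular_cong[rotated]) (auto simp: det divide_inverse mult.commute)
  qed (use G in auto)
  fix \<phi> assume \<phi>: "\<phi> \<in> trep2" "\<delta> \<phi> \<noteq> 0"
  show "conj_mat 2 (?G \<phi>) Z0 = \<phi> (cgen GZ)"
    unfolding conj_mat_def Z[OF \<phi>(1)] by (rule GL_inv_cancel(4)[OF G[OF \<phi>] trep2_cgen_carrier[OF \<phi>(1)]])
qed (rule \<delta>)

section \<open>The projector (1 + Z) / 2 and two local sections\<close>

definition proj_p :: "((word \<Rightarrow>\<^sub>0 complex) set \<Rightarrow> complex mat) \<Rightarrow> complex" where
  "proj_p \<phi> = (1 + \<phi> (cgen GZ) $$ (0, 0)) / 2"

definition proj_q :: "((word \<Rightarrow>\<^sub>0 complex) set \<Rightarrow> complex mat) \<Rightarrow> complex" where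
  "proj_q \<phi> = \<phi> (cgen GZ) $$ (0, 1) / 2"

definition proj_r :: "((word \<Rightarrow>\<^sub>0 complex) set \<Rightarrow> complex mat) \<Rightarrow> complex" where
  "proj_r \<phi> = \<phi> (cgen GZ) $$ (1, 0) / 2"

text \<open>For the projector \<open>P = (1 + Z) / 2\<close>, of trace 1 because \<open>Z\<close> is
  traceless, this is \<open>Z = 2 P - 1\<close> together with \<open>det P = 0\<close>, which comes
  from \<open>Z * Z = 1\<close>.\<close>

lemma projector_entries:
  assumes "\<phi> \<in> trep2"
  shows "\<phi> (cgen GZ) = m2 (2 * proj_p \<phi> - 1) (2 * proj_q \<phi>) (2 * proj_r \<phi>) (1 - 2 * proj_p \<phi>)"
    "proj_q \<phi> * proj_r \<phi> = proj_p \<phi> * (1 - proj_p \<phi>)"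
proof -
  have r: "conifold_rep (\<lambda>a. \<phi> (cgen a))" by (rule conifold_rep_of_trep2[OF assms])
  obtain a b c d where Z: "\<phi> (cgen GZ) = m2 a b c d" using mat2_cases[OF conifold_repD[OF r]] .
  have "mat_trace (\<phi> (cgen GZ)) = 0" by (rule trep2_simps(6)[OF assms])
  then have d: "d = - a" by (simp add: Z eq_neg_iff_add_eq_0 add.commute)
  have "a * a + b * c = 1" using r by (simp add: conifold_rep_def Z one_mat_2 d)
  then show "proj_q \<phi> * proj_r \<phi> = proj_p \<phi> * (1 - proj_p \<phi>)"
    unfolding proj_p_def proj_q_def proj_r_def Z by (simp add: field_simps)
  show "\<phi> (cgen GZ) = m2 (2 * proj_p \<phi> - 1) (2 * proj_q \<phi>) (2 * proj_r \<phi>) (1 - 2 * proj_p \<phi>)"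
    unfolding proj_p_def proj_q_def proj_r_def Z by (simp add: d field_simps)
qed

lemma regular_projector_entries: "proj_p \<in> regular trep2_var" "proj_q \<in> regular trep2_var" "proj_r \<in> regular trep2_var"
  unfolding proj_p_def[abs_def] proj_q_def[abs_def] proj_r_def[abs_def]
  by (intro regular_intros regular_matD[OF regular_mat_trep2]; simp)+

lemma projector_columns:
  fixes p q r :: complex
  assumes "q * r = p * (1 - p)"
  shows "m2 p (- q) r p * Z0 = m2 (2 * p - 1) (2 * q) (2 * r) (1 - 2 * p) * m2 p (- q) r p"
    and "m2 q (1 - p) (1 - p) (- r) * Z0
      = m2 (2 * p - 1) (2 * q) (2 * r) (1 - 2 * p) * m2 q (1 - p) (1 - p) (- r)"
proof -
  \<comment> \<open>The upper left entry of \<open>P * P = P\<close>, doubled; the four equations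
    that follow all reduce to it.\<close>
  have "p * (p * 2) + q * (r * 2) = 2 * (p * p + q * r)" by (simp add: algebra_simps)
  also have "p * p + q * r = p" using assms by (simp add: algebra_simps)
  finally have *: "p * (p * 2) + q * (r * 2) = p * 2" by simp
  have "(2 * p - 1) * p + 2 * q * r = p" "2 * r * - q + (1 - 2 * p) * p = - p"
    "(2 * p - 1) * (1 - p) + 2 * q * - r = - (1 - p)" "2 * r * q + (1 - 2 * p) * (1 - p) = 1 - p"
    using * by (simp_all add: algebra_simps)
  then show "m2 p (- q) r p * Z0 = m2 (2 * p - 1) (2 * q) (2 * r) (1 - 2 * p) * m2 p (- q) r p"
    and "m2 q (1 - p) (1 - p) (- r) * Z0
      = m2 (2 * p - 1) (2 * q) (2 * r) (1 - 2 * p) * m2 q (1 - p) (1 - p) (- r)"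
    unfolding m2_mult m2_eq_iff by (simp_all only: mult_1_right mult_0_right) (simp_all add: algebra_simps)
qed

text \<open>
  The columns span the image and the kernel of the projector \<open>(1 + Z) / 2\<close>, which has the entries
  \<open>p, q, r, 1 - p\<close>.
\<close>

lemma local_sections:
  "local_section proj_p (\<lambda>\<phi>. m2 (proj_p \<phi>) (- proj_q \<phi>) (proj_r \<phi>) (proj_p \<phi>))"
  "local_section (\<lambda>\<phi>. 1 - proj_p \<phi>) (\<lambda>\<phi>. m2 (proj_q \<phi>) (1 - proj_p \<phi>) (1 - proj_p \<phi>) (- proj_r \<phi>))"
proof -
  note [simp] = regular_projector_entries
  show "local_section proj_p (\<lambda>\<phi>. m2 (proj_p \<phi>) (- proj_q \<phi>) (proj_r \<phi>) (proj_p \<phi>))"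
  proof (rule local_sectionI[where e = 1])
    fix \<phi> assume \<phi>: "\<phi> \<in> trep2"
    show "m2 (proj_p \<phi>) (- proj_q \<phi>) (proj_r \<phi>) (proj_p \<phi>) * Z0 = \<phi> (cgen GZ) * m2 (proj_p \<phi>) (- proj_q \<phi>) (proj_r \<phi>) (proj_p \<phi>)"
      unfolding projector_entries(1)[OF \<phi>] by (rule projector_columns[OF projector_entries(2)[OF \<phi>]])
    show "proj_p \<phi> * proj_p \<phi> - - proj_q \<phi> * proj_r \<phi> = 1 * proj_p \<phi>"
      using projector_entries(2)[OF \<phi>] by (simp add: algebra_simps)
  qed (auto intro!: regular_intros)
  show "local_section (\<lambda>\<phi>. 1 - proj_p \<phi>) (\<lambda>\<phi>. m2 (proj_q \<phi>) (1 - proj_p \<phi>) (1 - proj_p \<phi>) (- proj_r \<phi>))"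
  \<comment> \<open>Since \<open>q * r = p * (1 - p)\<close>, the determinant
    \<open>- q * r - (1 - p)^2\<close> equals \<open>- (1 - p)\<close>.\<close>
  proof (rule local_sectionI[where e = "- 1"])
    fix \<phi> assume \<phi>: "\<phi> \<in> trep2"
    show "m2 (proj_q \<phi>) (1 - proj_p \<phi>) (1 - proj_p \<phi>) (- proj_r \<phi>) * Z0 = \<phi> (cgen GZ) * m2 (proj_q \<phi>) (1 - proj_p \<phi>) (1 - proj_p \<phi>) (- proj_r \<phi>)"
      unfolding projector_entries(1)[OF \<phi>] by (rule projector_columns[OF projector_entries(2)[OF \<phi>]])
    show "proj_q \<phi> * - proj_r \<phi> - (1 - proj_p \<phi>) * (1 - proj_p \<phi>) = - 1 * (1 - proj_p \<phi>)"
      using projector_entries(2)[OF \<phi>] by (simp add: algebra_simps)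
  qed (auto intro!: regular_intros)
qed

definition section_pt :: "(((word \<Rightarrow>\<^sub>0 complex) set \<Rightarrow> complex mat) \<Rightarrow> complex mat) \<Rightarrow>
    ((word \<Rightarrow>\<^sub>0 complex) set \<Rightarrow> complex mat) \<Rightarrow> complex mat \<times> ((word \<Rightarrow>\<^sub>0 complex) set \<Rightarrow> complex mat)" where
  "section_pt G \<phi> = (G \<phi>, rep_act (inv\<^bsub>GL 2\<^esub> (G \<phi>)) \<phi>)"

text \<open>Conjugating by the inverse of \<open>G \<phi>\<close> moves
  \<open>\<phi> (cgen GZ)\<close> to \<open>Z0\<close>, which by \<open>A4_iff\<close> puts the
  representation into \<open>A4\<close>.\<close>

lemma section_pt:
  assumes ls: "local_section \<delta> G" and \<phi>: "\<phi> \<in> trep2" "\<delta> \<phi> \<noteq> 0"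
  shows "G \<phi> \<in> carrier (GL 2)" "rep_act (inv\<^bsub>GL 2\<^esub> (G \<phi>)) \<phi> \<in> A4"
    "rep_act (G \<phi>) (rep_act (inv\<^bsub>GL 2\<^esub> (G \<phi>)) \<phi>) = \<phi>"
proof -
  show G: "G \<phi> \<in> carrier (GL 2)"
    using ls \<phi> var_morphism_GL_varD(1)[of "principal_open trep2_var \<delta>" 2 G \<phi>] by (auto simp: local_section_def)
  show "rep_act (G \<phi>) (rep_act (inv\<^bsub>GL 2\<^esub> (G \<phi>)) \<phi>) = \<phi>"
    by (rule act_inv_act(2)[OF is_action_rep_act G \<phi>(1)])
  have "\<phi> (cgen GZ) = conj_mat 2 (G \<phi>) Z0" using ls \<phi> by (simp add: local_section_def)
  then have "conj_mat 2 (inv\<^bsub>GL 2\<^esub> (G \<phi>)) (\<phi> (cgen GZ)) = Z0"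
    by (simp add: conj_mat_inv_cancel[OF G])
  then show "rep_act (inv\<^bsub>GL 2\<^esub> (G \<phi>)) \<phi> \<in> A4"
    by (simp add: A4_iff rep_act_trep2 GL_inv_closed G \<phi> rep_act_cgen)
qed

abbreviation E_var :: "(complex mat \<times> ((word \<Rightarrow>\<^sub>0 complex) set \<Rightarrow> complex mat)) variety" where
  "E_var \<equiv> prod_var (GL_var 2) A4_var"

lemma var_morphism_section_pt:
  assumes ls: "local_section \<delta> G"
  shows "var_morphism (principal_open trep2_var \<delta>) E_var (section_pt G)"
proof (rule var_morphism_prod_varI)
  let ?U = "principal_open trep2_var \<delta>"
  have G: "var_morphism ?U (GL_var 2) G" using ls by (simp add: local_section_def)
  then show "var_morphism ?U (GL_var 2) (\<lambda>x. fst (section_pt G x))" by (simp add: section_pt_def)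
  have "var_morphism ?U trep2_var (\<lambda>x. rep_act (inv\<^bsub>GL 2\<^esub> (G x)) x)"
    by (intro var_morphism_rep_act var_morphism_GL_inv G var_morphism_principal_open_inclusion) simp_all
  then show "var_morphism ?U A4_var (\<lambda>x. snd (section_pt G x))"
    using section_pt(2)[OF ls] by (auto simp: var_morphism_A4_var_iff section_pt_def)
qed simp

section \<open>The isomorphism between the torus bundle and the representation variety\<close>

definition bundle_to_rep :: "(complex mat \<times> ((word \<Rightarrow>\<^sub>0 complex) set \<Rightarrow> complex mat)) set \<Rightarrow> ((word \<Rightarrow>\<^sub>0 complex) set \<Rightarrow> complex mat)" where
  "bundle_to_rep c = (case SOME x. x \<in> c of (g, P) \<Rightarrow> rep_act g P)"

lemma points_torus_bundle: "points torus_bundle = orbits torus (carrier (GL 2) \<times> A4) torus_act"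
  by (simp add: assoc_bundle_def)

text \<open>All points of one orbit have the same image under the action map, so the choice made by
  \<open>SOME\<close> is harmless.\<close>

lemma bundle_to_rep_orbit:
  assumes "g \<in> carrier (GL 2)" "P \<in> A4"
  shows "bundle_to_rep (orbit torus torus_act (g, P)) = rep_act g P"
proof -
  have x: "(g, P) \<in> carrier (GL 2) \<times> A4" using assms by simp
  define y where "y = (SOME x. x \<in> orbit torus torus_act (g, P))"
  have "y \<in> orbit torus torus_act (g, P)"
    unfolding y_def by (rule someI, rule orbit_self[OF is_action_torus_act x])
  then obtain t where t: "t \<in> carrier torus" "y = torus_act t (g, P)" by (auto simp: orbit_def)
  obtain g' P' where y: "y = (g', P')" by (cases y)
  have "(g', P') \<in> carrier (GL 2) \<times> A4" using is_actionD(2)[OF is_action_torus_act t(1) x] t y by simp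
  then have "rep_act g P = rep_act g' P'" using rep_act_eq_iff[of g g' P P'] assms t y by auto
  then show ?thesis by (simp add: bundle_to_rep_def y_def[symmetric] y)
qed

lemma var_morphism_action: "var_morphism E_var trep2_var (\<lambda>x. rep_act (fst x) (snd x))"
proof -
  have "var_morphism E_var A4_var snd" by (rule var_morphism_snd)
  then show ?thesis
    by (intro var_morphism_rep_act var_morphism_fst) (auto simp: var_morphism_A4_var_iff)
qed

lemma var_morphism_bundle_to_rep: "var_morphism torus_bundle trep2_var bundle_to_rep"
  unfolding assoc_bundle_def
  by (rule var_morphism_quot_varI, rule var_morphism_cong[OF _ var_morphism_action]) (auto simp: bundle_to_rep_orbit)

text \<open>Where \<open>proj_p\<close> vanishes, \<open>1 - proj_p\<close> is 1, so one of the two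
  sections always applies.\<close>

definition rep_to_bundle :: "((word \<Rightarrow>\<^sub>0 complex) set \<Rightarrow> complex mat) \<Rightarrow> (complex mat \<times> ((word \<Rightarrow>\<^sub>0 complex) set \<Rightarrow> complex mat)) set" where
  "rep_to_bundle \<phi> = (if proj_p \<phi> \<noteq> 0 then orbit torus torus_act (section_pt (\<lambda>\<phi>. m2 (proj_p \<phi>) (- proj_q \<phi>) (proj_r \<phi>) (proj_p \<phi>)) \<phi>)
    else orbit torus torus_act (section_pt (\<lambda>\<phi>. m2 (proj_q \<phi>) (1 - proj_p \<phi>) (1 - proj_p \<phi>) (- proj_r \<phi>)) \<phi>))"

lemma orbit_eq_of_rep_act_eq:
  assumes "g \<in> carrier (GL 2)" "g' \<in> carrier (GL 2)" "P \<in> A4" "P' \<in> A4" "rep_act g P = rep_act g' P'"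
  shows "orbit torus torus_act (g, P) = orbit torus torus_act (g', P')"
  using assms rep_act_eq_iff[OF assms(1-4)] orbit_eq_iff[OF is_action_torus_act, of "(g, P)" "(g', P')"] by auto

lemma orbit_section_pt:
  assumes "local_section \<delta> G" "\<phi> \<in> trep2" "\<delta> \<phi> \<noteq> 0"
  shows "orbit torus torus_act (section_pt G \<phi>) \<in> points torus_bundle"
  unfolding points_torus_bundle orbits_def section_pt_def using section_pt[OF assms] by blast

lemma bundle_to_rep_section:
  assumes "local_section \<delta> G" "\<phi> \<in> trep2" "\<delta> \<phi> \<noteq> 0"
  shows "bundle_to_rep (orbit torus torus_act (section_pt G \<phi>)) = \<phi>"
  using section_pt[OF assms] by (simp add: section_pt_def bundle_to_rep_orbit)

lemma bundle_to_rep_rep_to_bundle: "\<phi> \<in> trep2 \<Longrightarrow> bundle_to_rep (rep_to_bundle \<phi>) = \<phi>"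
  using bundle_to_rep_section[OF local_sections(1), of \<phi>] bundle_to_rep_section[OF local_sections(2), of \<phi>]
  by (auto simp: rep_to_bundle_def)

lemma rep_to_bundle_points: "\<phi> \<in> trep2 \<Longrightarrow> rep_to_bundle \<phi> \<in> points torus_bundle"
  using orbit_section_pt[OF local_sections(1), of \<phi>] orbit_section_pt[OF local_sections(2), of \<phi>]
  by (simp add: rep_to_bundle_def)

lemma torus_bundle_cases:
  assumes "c \<in> points torus_bundle"
  obtains g P where "g \<in> carrier (GL 2)" "P \<in> A4" "c = orbit torus torus_act (g, P)"
  using assms unfolding points_torus_bundle orbits_def by blast

lemma bundle_to_rep_inj:
  assumes "c \<in> points torus_bundle" "c' \<in> points torus_bundle" "bundle_to_rep c = bundle_to_rep c'"
  shows "c = c'"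
proof -
  obtain g P where c: "g \<in> carrier (GL 2)" "P \<in> A4" "c = orbit torus torus_act (g, P)"
    using torus_bundle_cases[OF assms(1)] .
  obtain g' P' where c': "g' \<in> carrier (GL 2)" "P' \<in> A4" "c' = orbit torus torus_act (g', P')"
    using torus_bundle_cases[OF assms(2)] .
  have "rep_act g P = rep_act g' P'"
    using assms(3) by (simp only: c(3) c'(3) bundle_to_rep_orbit[OF c(1,2)] bundle_to_rep_orbit[OF c'(1,2)])
  from orbit_eq_of_rep_act_eq[OF c(1) c'(1) c(2) c'(2) this] show ?thesis by (simp only: c(3) c'(3))
qed

text \<open>By injectivity of \<open>bundle_to_rep\<close> the orbit does not depend on the section.
  So on each open set \<open>rep_to_bundle\<close> may be computed with the section that is regular
  there, whichever branch its definition takes.\<close>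

lemma rep_to_bundle_section:
  assumes "local_section \<delta> G" "\<phi> \<in> trep2" "\<delta> \<phi> \<noteq> 0"
  shows "rep_to_bundle \<phi> = orbit torus torus_act (section_pt G \<phi>)"
proof (rule bundle_to_rep_inj)
  show "bundle_to_rep (rep_to_bundle \<phi>) = bundle_to_rep (orbit torus torus_act (section_pt G \<phi>))"
    using bundle_to_rep_rep_to_bundle bundle_to_rep_section[OF assms] assms(2) by simp
qed (rule rep_to_bundle_points[OF assms(2)], rule orbit_section_pt[OF assms])

text \<open>A regular function on the bundle becomes regular upstairs after composing with
  \<open>orbit\<close>; composing further with a section gives regularity on a principal open
  set.\<close>

lemma var_morphism_rep_to_bundle: "var_morphism trep2_var torus_bundle rep_to_bundle"
  unfolding var_morphism_def
proof (intro conjI ballI funcsetI)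
  fix f assume f: "f \<in> regular torus_bundle"
  have reg: "(\<lambda>\<phi>. f (rep_to_bundle \<phi>)) \<in> regular (principal_open trep2_var \<delta>)" if ls: "local_section \<delta> G" for \<delta> G
  proof (rule regular_cong)
    have "(\<lambda>x. f (orbit torus torus_act x)) \<in> regular E_var"
      using f by (simp add: assoc_bundle_def regular_quot_var)
    from var_morphismD(2)[OF var_morphism_section_pt[OF ls] this]
    show "(\<lambda>\<phi>. f (orbit torus torus_act (section_pt G \<phi>))) \<in> regular (principal_open trep2_var \<delta>)" .
  qed (auto simp: rep_to_bundle_section[OF ls])
  have "(\<lambda>\<phi>. f (rep_to_bundle \<phi>)) \<in> regular trep2_var"
    by (rule regular_glue[OF _ regular_projector_entries(1) _ _ reg[OF local_sections(1)] reg[OF local_sections(2)]])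
      (auto intro!: regular_intros regular_projector_entries)
  then show "f \<circ> rep_to_bundle \<in> regular trep2_var" by (simp add: comp_def)
qed (use rep_to_bundle_points in auto)

lemma is_variety_torus_bundle [simp]: "is_variety torus_bundle"
  by (simp add: assoc_bundle_def)

theorem var_iso_bundle_to_rep: "var_iso torus_bundle trep2_var bundle_to_rep"
proof (rule var_isoI[OF _ var_morphism_bundle_to_rep var_morphism_rep_to_bundle])
  fix c assume c: "c \<in> points torus_bundle"
  then have "bundle_to_rep c \<in> trep2" using var_morphismD(1)[OF var_morphism_bundle_to_rep] by simp
  then show "rep_to_bundle (bundle_to_rep c) = c" by (intro bundle_to_rep_inj rep_to_bundle_points c bundle_to_rep_rep_to_bundle)
qed (simp_all add: bundle_to_rep_rep_to_bundle)

lemma bundle_to_rep_bundle_act: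
  assumes "h \<in> carrier (GL 2)" "c \<in> points torus_bundle"
  shows "bundle_to_rep (bundle_act h c) = rep_act h (bundle_to_rep c)"
proof -
  obtain g P where c: "g \<in> carrier (GL 2)" "P \<in> A4" "c = orbit torus torus_act (g, P)"
    using torus_bundle_cases[OF assms(2)] .
  then show ?thesis
    using bundle_act_orbit[OF is_action_torus id_hom_torus c(1) assms(1)]
      is_actionD(4)[OF is_action_rep_act assms(1) c(1) A4_trep2[OF c(2)]]
    by (simp add: bundle_to_rep_orbit GL_mult_closed assms(1))
qed

text \<open>A section trivializes a principal bundle: its translates by the torus sweep out the part
  of the total space over its domain, each point exactly once.\<close>

lemma local_trivialization:
  assumes ls: "local_section \<delta> G"
  defines "f \<equiv> \<lambda>c. \<delta> (bundle_to_rep c)"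
  defines "\<tau> \<equiv> \<lambda>(u, h). torus_act h (section_pt G (bundle_to_rep u))"
  shows "var_iso (prod_var (principal_open torus_bundle f) torus_var)
      (principal_open E_var (f \<circ> orbit torus torus_act)) \<tau>"
    and "u \<in> points (principal_open torus_bundle f) \<Longrightarrow> h \<in> carrier torus \<Longrightarrow> orbit torus torus_act (\<tau> (u, h)) = u"
    and "u \<in> points (principal_open torus_bundle f) \<Longrightarrow> h \<in> carrier torus \<Longrightarrow> k \<in> carrier torus \<Longrightarrow>
      \<tau> (u, k \<otimes>\<^bsub>torus\<^esub> h) = torus_act k (\<tau> (u, h))"
proof -
  let ?B = "principal_open torus_bundle f" and ?E = "principal_open E_var (f \<circ> orbit torus torus_act)"
  let ?U = "prod_var ?B torus_var"
  have Phi_u: "bundle_to_rep u \<in> trep2" "\<delta> (bundle_to_rep u) \<noteq> 0" if "u \<in> points ?B" for u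
    using that var_morphismD(1)[OF var_morphism_bundle_to_rep, of u] by (auto simp: f_def)
  have s: "section_pt G (bundle_to_rep u) \<in> carrier (GL 2) \<times> A4" if "u \<in> points ?B" for u
    using section_pt[OF ls Phi_u[OF that]] by (simp add: section_pt_def)
  have orb: "orbit torus torus_act (section_pt G (bundle_to_rep u)) = u" if u: "u \<in> points ?B" for u
  proof (rule bundle_to_rep_inj)
    show "u \<in> points torus_bundle" using u by simp
  qed (use orbit_section_pt[OF ls Phi_u[OF u]] bundle_to_rep_section[OF ls Phi_u[OF u]] in simp_all)
  show orb_\<tau>: "orbit torus torus_act (\<tau> (u, h)) = u" if "u \<in> points ?B" "h \<in> carrier torus" for u h
    using orbit_act[OF is_action_torus_act s[OF that(1)] that(2)] orb[OF that(1)] by (simp add: \<tau>_def)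
  show "\<tau> (u, k \<otimes>\<^bsub>torus\<^esub> h) = torus_act k (\<tau> (u, h))"
    if "u \<in> points ?B" "h \<in> carrier torus" "k \<in> carrier torus" for u h k
    using is_actionD(4)[OF is_action_torus_act that(3,2) s[OF that(1)]] by (simp add: \<tau>_def)
  have \<tau>_E: "\<tau> x \<in> carrier (GL 2) \<times> A4" if xU: "x \<in> points ?U" for x
  proof -
    obtain u h where x: "x = (u, h)" "u \<in> points ?B" "h \<in> carrier torus" using xU by auto
    show ?thesis using is_actionD(2)[OF is_action_torus_act x(3) s[OF x(2)]] by (simp add: \<tau>_def x(1))
  qed
  have mPhi: "var_morphism ?U (principal_open trep2_var \<delta>) (\<lambda>x. bundle_to_rep (fst x))"
  proof (rule var_morphism_principal_openI)
    have "var_morphism ?U torus_bundle fst"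
      by (rule var_morphism_comp[OF var_morphism_fst var_morphism_principal_open_inclusion])
    then show "var_morphism ?U trep2_var (\<lambda>x. bundle_to_rep (fst x))" by (rule var_morphism_comp[OF _ var_morphism_bundle_to_rep])
    show "(\<lambda>x. inverse (\<delta> (bundle_to_rep (fst x)))) \<in> regular ?U"
      using regular_fst[OF regular_inverse_principal_open[of f torus_bundle]] by (simp add: f_def)
    show "\<delta> (bundle_to_rep (fst x)) \<noteq> 0" if "x \<in> points ?U" for x using that Phi_u(2) by auto
  qed simp
  have ms: "var_morphism ?U E_var (\<lambda>x. section_pt G (bundle_to_rep (fst x)))"
    by (rule var_morphism_comp[OF mPhi var_morphism_section_pt[OF ls]])
  have msnd: "var_morphism ?U (GL_var 2) snd"
    by (rule var_morphism_comp[OF var_morphism_snd var_morphism_torus_GL])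
  have m\<tau>: "var_morphism ?U E_var \<tau>"
  proof (rule var_morphism_prod_varI)
    have "var_morphism ?U (GL_var 2) (\<lambda>x. fst (section_pt G (bundle_to_rep (fst x))) * inv\<^bsub>GL 2\<^esub> (snd x))"
      by (intro var_morphism_GL_mult var_morphism_GL_inv msnd var_morphism_comp[OF ms var_morphism_fst]) simp_all
    then show "var_morphism ?U (GL_var 2) (\<lambda>x. fst (\<tau> x))"
      by (simp add: \<tau>_def twist_act_def case_prod_unfold)
    have "var_morphism ?U A4_var (\<lambda>x. snd (section_pt G (bundle_to_rep (fst x))))"
      by (rule var_morphism_comp[OF ms var_morphism_snd])
    then have "var_morphism ?U trep2_var (\<lambda>x. snd (section_pt G (bundle_to_rep (fst x))))"
      by (simp add: var_morphism_A4_var_iff)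
    then have "var_morphism ?U trep2_var (\<lambda>x. rep_act (snd x) (snd (section_pt G (bundle_to_rep (fst x)))))"
      by (intro var_morphism_rep_act msnd) simp_all
    then have "var_morphism ?U trep2_var (\<lambda>x. snd (\<tau> x))"
      by (simp add: \<tau>_def twist_act_def case_prod_unfold)
    moreover have "snd (\<tau> x) \<in> A4" if "x \<in> points ?U" for x using \<tau>_E[OF that] by (simp add: mem_Times_iff)
    ultimately show "var_morphism ?U A4_var (\<lambda>x. snd (\<tau> x))" by (simp add: var_morphism_A4_var_iff)
  qed simp
  have f\<tau>: "(f \<circ> orbit torus torus_act) (\<tau> x) = f (fst x)" if "x \<in> points ?U" for x
    using orb_\<tau>[of "fst x" "snd x"] that by (auto simp: mem_Times_iff)
  have m\<tau>': "var_morphism ?U ?E \<tau>"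
  proof (rule var_morphism_principal_openI[OF _ m\<tau>])
    show "(\<lambda>x. inverse ((f \<circ> orbit torus torus_act) (\<tau> x))) \<in> regular ?U"
      by (rule regular_cong[OF _ regular_fst[OF regular_inverse_principal_open[of f torus_bundle]]])
        (use f\<tau> in auto)
    show "(f \<circ> orbit torus torus_act) (\<tau> x) \<noteq> 0" if "x \<in> points ?U" for x
      unfolding f\<tau>[OF that] using that by auto
  qed simp
  \<comment> \<open>The inverse reads off the torus element: the first component of
    \<open>\<tau> (u, h)\<close> is \<open>g = G * inv h\<close>, so
    \<open>h = inv g * G\<close>.\<close>
  define \<kappa> where "\<kappa> = (\<lambda>x. (orbit torus torus_act x, inv\<^bsub>GL 2\<^esub> (fst x) * G (rep_act (fst x) (snd x))))"
  have E: "fst x \<in> carrier (GL 2)" "snd x \<in> A4" "rep_act (fst x) (snd x) \<in> trep2"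
    "bundle_to_rep (orbit torus torus_act x) = rep_act (fst x) (snd x)" "\<delta> (rep_act (fst x) (snd x)) \<noteq> 0"
    if "x \<in> points ?E" for x
  proof -
    show x: "fst x \<in> carrier (GL 2)" "snd x \<in> A4" using that by auto
    then show "rep_act (fst x) (snd x) \<in> trep2" by (simp add: rep_act_trep2 A4_trep2)
    show bundle_to_rep: "bundle_to_rep (orbit torus torus_act x) = rep_act (fst x) (snd x)" using bundle_to_rep_orbit[OF x] by simp
    show "\<delta> (rep_act (fst x) (snd x)) \<noteq> 0" using that by (simp add: f_def bundle_to_rep)
  qed
  \<comment> \<open>The point \<open>x\<close> and the section point have the same image in
    \<open>trep2\<close>, hence lie in one torus orbit; this makes \<open>inv g * G\<close> the
    inverse of a torus element.\<close>
  have t: "inv\<^bsub>GL 2\<^esub> (fst x) * G (rep_act (fst x) (snd x)) \<in> carrier torus" if x: "x \<in> points ?E" for x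
  proof -
    let ?\<phi> = "rep_act (fst x) (snd x)"
    note G = section_pt[OF ls E(3,5)[OF x]]
    obtain t where "t \<in> carrier torus" "(G ?\<phi>, rep_act (inv\<^bsub>GL 2\<^esub> (G ?\<phi>)) ?\<phi>) = torus_act t (fst x, snd x)"
      using rep_act_eq_iff[OF E(1)[OF x] G(1) E(2)[OF x] G(2)] G(3) by auto
    then have t: "t \<in> carrier torus" "G ?\<phi> = fst x * inv\<^bsub>GL 2\<^esub> t" by (auto simp: twist_act_def case_prod_unfold)
    have "inv\<^bsub>GL 2\<^esub> (fst x) * G ?\<phi> = inv\<^bsub>GL 2\<^esub> t"
      unfolding t(2) by (intro GL_inv_cancel(2) E(1)[OF x] GL_carrier_mat GL_inv_closed torus_GL t(1))
    also have "\<dots> \<in> carrier torus" using t(1) by (auto simp: carrier_torus inv_diag)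
    finally show ?thesis .
  qed
  have incl: "var_morphism ?E E_var (\<lambda>x. x)" by (rule var_morphism_principal_open_inclusion)
  have mact: "var_morphism ?E trep2_var (\<lambda>x. rep_act (fst x) (snd x))"
    by (rule var_morphism_comp[OF incl var_morphism_action])
  have inv_f: "(\<lambda>x. inverse (f (orbit torus torus_act x))) \<in> regular ?E"
    using regular_inverse_principal_open[of "f \<circ> orbit torus torus_act" E_var] by (simp add: comp_def)
  have m\<kappa>: "var_morphism ?E ?U \<kappa>"
  proof (rule var_morphism_prod_varI)
    have "var_morphism ?E torus_bundle (orbit torus torus_act)"
      unfolding assoc_bundle_def by (rule var_morphism_comp[OF incl var_morphism_orbit])
    then have "var_morphism ?E ?B (orbit torus torus_act)"
      by (rule var_morphism_principal_openI[rotated]) (use inv_f in auto)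
    then show "var_morphism ?E ?B (\<lambda>x. fst (\<kappa> x))" by (simp add: \<kappa>_def)
    have "var_morphism ?E (principal_open trep2_var \<delta>) (\<lambda>x. rep_act (fst x) (snd x))"
    proof (rule var_morphism_principal_openI[OF _ mact])
      show "\<delta> (rep_act (fst x) (snd x)) \<noteq> 0" if "x \<in> points ?E" for x by (rule E(5)[OF that])
      show "(\<lambda>x. inverse (\<delta> (rep_act (fst x) (snd x)))) \<in> regular ?E"
        by (rule regular_cong[OF _ inv_f]) (simp_all only: f_def E(4) is_variety_principal_open)
    qed simp_all
    then have "var_morphism ?E (GL_var 2) (\<lambda>x. G (rep_act (fst x) (snd x)))"
      by (rule var_morphism_comp) (use ls in \<open>simp add: local_section_def\<close>)
    then have "var_morphism ?E (GL_var 2) (\<lambda>x. inv\<^bsub>GL 2\<^esub> (fst x) * G (rep_act (fst x) (snd x)))"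
      by (intro var_morphism_GL_mult var_morphism_GL_inv var_morphism_comp[OF incl var_morphism_fst]) simp_all
    then have "var_morphism ?E torus_var (\<lambda>x. inv\<^bsub>GL 2\<^esub> (fst x) * G (rep_act (fst x) (snd x)))"
      by (rule var_morphism_torusI[rotated]) (use t in auto)
    then show "var_morphism ?E torus_var (\<lambda>x. snd (\<kappa> x))" by (simp add: \<kappa>_def)
  qed simp
  show "var_iso ?U ?E \<tau>"
  proof (rule var_isoI[OF _ m\<tau>' m\<kappa>])
    fix x assume x: "x \<in> points ?U"
    obtain u h where uh: "x = (u, h)" "u \<in> points ?B" "h \<in> carrier torus" using x by auto
    have \<tau>x: "\<tau> x \<in> points ?E" using var_morphismD(1)[OF m\<tau>' x] .
    have u: "orbit torus torus_act (\<tau> x) = u" using orb_\<tau>[OF uh(2,3)] uh(1) by simp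
    have "rep_act (fst (\<tau> x)) (snd (\<tau> x)) = bundle_to_rep u" using E(4)[OF \<tau>x] u by simp
    moreover have "fst (\<tau> x) = G (bundle_to_rep u) * inv\<^bsub>GL 2\<^esub> h"
      by (simp add: uh(1) \<tau>_def twist_act_def section_pt_def)
    moreover have G: "G (bundle_to_rep u) \<in> carrier (GL 2)" using s[OF uh(2)] by (simp add: section_pt_def)
    note h = torus_GL[OF uh(3)]
    have "inv\<^bsub>GL 2\<^esub> (G (bundle_to_rep u) * inv\<^bsub>GL 2\<^esub> h) * G (bundle_to_rep u) = h"
      using GL_inv_cancel(3)[OF G GL_carrier_mat[OF h]]
      by (simp add: GL_inv_mult G GL_inv_closed h GL_inv_inv)
    ultimately show "\<kappa> (\<tau> x) = x" by (simp add: \<kappa>_def u[unfolded uh(1)] uh(1))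
  next
    fix x assume x: "x \<in> points ?E"
    let ?\<phi> = "rep_act (fst x) (snd x)"
    note g = E(1)[OF x] and G = section_pt[OF ls E(3,5)[OF x]]
    note gi = GL_inv_closed[OF g] and Gi = GL_inv_closed[OF G(1)]
    have "G ?\<phi> * inv\<^bsub>GL 2\<^esub> (inv\<^bsub>GL 2\<^esub> (fst x) * G ?\<phi>) = fst x"
      using GL_inv_cancel(1)[OF G(1) GL_carrier_mat[OF g]]
      by (simp add: GL_inv_mult gi G GL_inv_inv g)
    moreover have "rep_act (inv\<^bsub>GL 2\<^esub> (fst x) * G ?\<phi>) (rep_act (inv\<^bsub>GL 2\<^esub> (G ?\<phi>)) ?\<phi>) = snd x"
      using is_actionD(4)[OF is_action_rep_act gi G(1) A4_trep2[OF G(2)]] G(3)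
        act_inv_act(1)[OF is_action_rep_act g A4_trep2[OF E(2)[OF x]]] by simp
    ultimately show "\<tau> (\<kappa> x) = x"
      by (simp add: \<tau>_def \<kappa>_def E(4)[OF x] section_pt_def twist_act_def)
  qed simp
qed

theorem principal_bundle_torus:
  "principal_bundle torus torus_var torus_act E_var torus_bundle (orbit torus torus_act)"
  unfolding principal_bundle_def
proof (intro conjI ballI)
  show "var_morphism E_var torus_bundle (orbit torus torus_act)"
    unfolding assoc_bundle_def by (rule var_morphism_orbit)
  fix b assume b: "b \<in> points torus_bundle"
  obtain \<delta> G where ls: "local_section \<delta> G" "\<delta> (bundle_to_rep b) \<noteq> 0"
    using local_sections by (cases "proj_p (bundle_to_rep b) = 0") auto
  have "\<delta> \<in> regular trep2_var" using ls(1) by (simp add: local_section_def)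
  from var_morphismD(2)[OF var_morphism_bundle_to_rep this]
  have reg: "(\<lambda>c. \<delta> (bundle_to_rep c)) \<in> regular torus_bundle" .
  show "\<exists>f\<in>regular torus_bundle. f b \<noteq> 0 \<and>
        (\<exists>\<tau>. var_iso (prod_var (principal_open torus_bundle f) torus_var)
              (principal_open E_var (f \<circ> orbit torus torus_act)) \<tau> \<and>
             (\<forall>u\<in>points (principal_open torus_bundle f). \<forall>h\<in>carrier torus.
                orbit torus torus_act (\<tau> (u, h)) = u \<and>
                (\<forall>k\<in>carrier torus. \<tau> (u, k \<otimes>\<^bsub>torus\<^esub> h) = torus_act k (\<tau> (u, h)))))"
    using local_trivialization[OF ls(1)] ls(2)
    by (intro bexI[OF _ reg] conjI exI[of _ "\<lambda>(u, h). torus_act h (section_pt G (bundle_to_rep u))"]) blast+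
qed

text \<open>Every \<open>GL 2\<close>-orbit meets \<open>A4\<close>, as the action map is onto, and
  meets it in a single torus orbit, because only torus elements move a point of \<open>A4\<close> to
  a point of \<open>A4\<close>.\<close>

theorem orbit_correspondence:
  "bij_betw (\<lambda>c. c \<inter> A4) (orbits (GL 2) trep2 rep_act) (orbits torus A4 rep_act)"
proof -
  have int: "orbit (GL 2) rep_act P \<inter> A4 = orbit torus rep_act P" if "P \<in> A4" for P
    using that rep_act_A4_iff torus_GL by (auto simp: orbit_def)
  have rep: "\<exists>P\<in>A4. c = orbit (GL 2) rep_act P" if c: "c \<in> orbits (GL 2) trep2 rep_act" for c
  proof -
    obtain \<phi> where \<phi>: "\<phi> \<in> trep2" "c = orbit (GL 2) rep_act \<phi>" using c by (auto simp: orbits_def)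
    obtain g P where gP: "g \<in> carrier (GL 2)" "P \<in> A4" "rep_to_bundle \<phi> = orbit torus torus_act (g, P)"
      using torus_bundle_cases[OF rep_to_bundle_points[OF \<phi>(1)]] .
    have "\<phi> = rep_act g P" using bundle_to_rep_rep_to_bundle[OF \<phi>(1)] gP by (simp add: bundle_to_rep_orbit)
    then have "c = orbit (GL 2) rep_act P"
      using \<phi>(2) orbit_act[OF is_action_rep_act A4_trep2[OF gP(2)] gP(1)] by simp
    then show ?thesis using gP(2) by blast
  qed
  show ?thesis
    unfolding bij_betw_def
  proof (intro conjI inj_onI)
    fix c d assume cd: "c \<in> orbits (GL 2) trep2 rep_act" "d \<in> orbits (GL 2) trep2 rep_act" "c \<inter> A4 = d \<inter> A4"
    obtain P where P: "P \<in> A4" "c = orbit (GL 2) rep_act P" using rep[OF cd(1)] by blast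
    have "P \<in> c" using orbit_self[OF is_action_rep_act A4_trep2[OF P(1)]] P(2) by simp
    then have "P \<in> d" using cd(3) P(1) by blast
    then show "c = d" using mem_orbits[OF is_action_rep_act cd(2)] P(2) by simp
  next
    show "(\<lambda>c. c \<inter> A4) ` orbits (GL 2) trep2 rep_act = orbits torus A4 rep_act"
    proof (intro equalityI subsetI)
      fix c assume "c \<in> (\<lambda>c. c \<inter> A4) ` orbits (GL 2) trep2 rep_act"
      then obtain d where d: "d \<in> orbits (GL 2) trep2 rep_act" "c = d \<inter> A4" by blast
      obtain P where P: "P \<in> A4" "d = orbit (GL 2) rep_act P" using rep[OF d(1)] by blast
      then show "c \<in> orbits torus A4 rep_act" using d(2) int by (auto simp: orbits_def)
    next
      fix c assume "c \<in> orbits torus A4 rep_act"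
      then obtain P where P: "P \<in> A4" "c = orbit torus rep_act P" by (auto simp: orbits_def)
      then have "c = orbit (GL 2) rep_act P \<inter> A4" "orbit (GL 2) rep_act P \<in> orbits (GL 2) trep2 rep_act"
        using int A4_trep2 by (auto simp: orbits_def)
      then show "c \<in> (\<lambda>c. c \<inter> A4) ` orbits (GL 2) trep2 rep_act" by blast
    qed
  qed
qed

section \<open>The conifold quiver\<close>

definition m1 :: "complex \<Rightarrow> complex mat" where
  "m1 a = mat_of_rows_list 1 [[a]]"

lemma m1_carrier [simp]: "m1 a \<in> carrier_mat (Suc 0) (Suc 0)"
  and m1_index [simp]: "m1 a $$ (0, 0) = a"
  and dim_m1 [simp]: "dim_row (m1 a) = Suc 0" "dim_col (m1 a) = Suc 0"
  by (auto simp: mat_of_rows_list_def m1_def)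

lemma mat1_eta: "A \<in> carrier_mat (Suc 0) (Suc 0) \<Longrightarrow> A = m1 (A $$ (0, 0))"
  by (rule eq_matI) auto

lemma m1_eq_iff [simp]: "m1 a = m1 b \<longleftrightarrow> a = b"
  by (metis m1_index)

lemma m1_mult [simp]: "m1 a * m1 b = m1 (a * b)"
  by (rule eq_matI) (auto simp: scalar_prod_def)

lemma det_m1 [simp]: "det (m1 a) = a"
  by (simp add: det_single)

lemma one_mat_1: "1\<^sub>m (Suc 0) = m1 1"
  by (rule eq_matI) simp_all

lemma carrier_GL_1: "carrier (GL (Suc 0)) = {m1 a | a. a \<noteq> 0}"
proof (intro equalityI subsetI)
  fix A assume "A \<in> carrier (GL (Suc 0))"
  then have A: "A \<in> carrier_mat (Suc 0) (Suc 0)" "det A \<noteq> 0" by (auto simp: carrier_GL)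
  have "A = m1 (A $$ (0, 0))" by (rule mat1_eta[OF A(1)])
  moreover from this have "A $$ (0, 0) \<noteq> 0" using A(2) by (metis det_m1)
  ultimately show "A \<in> {m1 a | a. a \<noteq> 0}" by blast
qed (auto simp: carrier_GL)

lemma inv_GL_1:
  assumes "a \<noteq> 0" shows "inv\<^bsub>GL (Suc 0)\<^esub> (m1 a) = m1 (1 / a)"
proof -
  have a: "m1 a \<in> carrier (GL (Suc 0))" using assms by (auto simp: carrier_GL_1)
  have "m1 a * m1 (1 / a) = 1\<^sub>m (Suc 0)" using assms by (simp add: one_mat_1)
  with GL_inv_cancel(2)[OF a, of "m1 (1 / a)"] show ?thesis
    using GL_carrier_mat[OF GL_inv_closed[OF a]] by simp
qed

section \<open>The base change group of the conifold quiver\<close>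

abbreviation "CQ \<equiv> conifold_quiver"
abbreviation "CD \<equiv> conifold_dim"

lemma conifold_quiver_simps [simp]:
  "nverts CQ = 2" "arrows CQ = {0, 1, 2, 3}" "tl_vert CQ a = (if a < 2 then 0 else 1)"
  "hd_vert CQ a = (if a < 2 then 1 else 0)" "CD v = 1" "total_dim CQ CD = 2"
  by (simp_all add: conifold_quiver_def conifold_dim_def total_dim_def)

abbreviation "GQ \<equiv> GL_dim CQ CD"

definition torus_elem :: "complex \<Rightarrow> complex \<Rightarrow> nat \<Rightarrow> complex mat" where
  "torus_elem a b = (\<lambda>v\<in>{..<2}. m1 (if v = 0 then a else b))"

lemma torus_elem_simps [simp]: "torus_elem a b 0 = m1 a" "torus_elem a b 1 = m1 b" "torus_elem a b (Suc 0) = m1 b"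
  by (simp_all add: torus_elem_def)

lemma group_GQ: "group GQ"
  unfolding GL_dim_def by (rule product_group) (rule group_GL)

lemma carrier_GQ: "carrier GQ = {torus_elem a b | a b. a \<noteq> 0 \<and> b \<noteq> 0}"
proof (intro equalityI subsetI)
  fix \<gamma> assume "\<gamma> \<in> carrier GQ"
  then have \<gamma>: "\<gamma> \<in> (\<Pi>\<^sub>E v\<in>{..<2}. carrier (GL (Suc 0)))"
    by (simp add: GL_dim_def product_group_def)
  obtain a b where ab: "\<gamma> 0 = m1 a" "a \<noteq> 0" "\<gamma> 1 = m1 b" "b \<noteq> 0"
    using PiE_mem[OF \<gamma>, of 0] PiE_mem[OF \<gamma>, of 1] by (auto simp: carrier_GL_1)
  have "\<gamma> = torus_elem a b"
    by (rule extensionalityI[of _ "{..<2}"]) (use \<gamma> ab in \<open>auto simp: torus_elem_def less_2_cases_iff PiE_iff\<close>)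
  then show "\<gamma> \<in> {torus_elem a b | a b. a \<noteq> 0 \<and> b \<noteq> 0}" using ab by blast
qed (auto simp: GL_dim_def product_group_def carrier_GL_1 torus_elem_def)

lemma torus_elem_in_GQ: "a \<noteq> 0 \<Longrightarrow> b \<noteq> 0 \<Longrightarrow> torus_elem a b \<in> carrier GQ"
  by (auto simp: carrier_GQ)

lemma GQ_cases:
  assumes "\<gamma> \<in> carrier GQ" obtains a b where "\<gamma> = torus_elem a b" "a \<noteq> 0" "b \<noteq> 0"
  using assms by (auto simp: carrier_GQ)

lemma GQ_mult: "torus_elem a b \<otimes>\<^bsub>GQ\<^esub> torus_elem a' b' = torus_elem (a * a') (b * b')"
  by (auto simp: GL_dim_def product_group_def torus_elem_def)

lemma block_embed_torus_elem: "block_embed CQ (torus_elem a b) = m2 a 0 0 b"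
proof -
  have "block_embed CQ (torus_elem a b) = diag_block_mat [m1 a, m1 b]"
    by (simp add: block_embed_def upt_rec)
  also have "\<dots> = m2 a 0 0 b"
    by (rule mat2_eqI) (auto simp: Let_def four_block_mat_def)
  finally show ?thesis .
qed

lemma block_embed_iso: "block_embed CQ \<in> iso GQ torus"
proof -
  have "block_embed CQ \<in> hom GQ torus"
    by (rule homI) (auto simp: carrier_GQ carrier_torus block_embed_torus_elem GQ_mult)
  moreover have "bij_betw (block_embed CQ) (carrier GQ) (carrier torus)"
    by (rule bij_betwI[where g = "\<lambda>t. torus_elem (t $$ (0, 0)) (t $$ (1, 1))"])
      (auto simp: carrier_torus block_embed_torus_elem torus_elem_in_GQ elim!: GQ_cases)
  ultimately show ?thesis by (simp add: iso_def)
qed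

lemma block_embed_hom: "block_embed CQ \<in> hom GQ torus"
  using block_embed_iso by (simp add: iso_def)

lemma block_embed_torus: "\<gamma> \<in> carrier GQ \<Longrightarrow> block_embed CQ \<gamma> \<in> carrier torus"
  by (rule hom_in_carrier[OF block_embed_hom])

lemma block_embed_hom_GL: "block_embed CQ \<in> hom GQ (GL 2)"
  using block_embed_hom torus_GL by (auto simp: hom_def)

abbreviation "GQ_var \<equiv> GL_dim_var CQ CD"

lemma points_GQ_var [simp]: "points GQ_var = carrier GQ"
  and is_variety_GQ_var [simp]: "is_variety GQ_var"
  by (simp_all add: GL_dim_var_def)

lemma block_embed_var_iso: "var_iso GQ_var torus_var (block_embed CQ)"
proof (rule var_isoI[where \<psi> = "\<lambda>t. torus_elem (t $$ (0, 0)) (t $$ (1, 1))"])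
  have reg: "(\<lambda>\<gamma>. f (\<gamma> v)) \<in> regular GQ_var" if "v < 2" "f \<in> GL_coords (Suc 0)" for f v
    unfolding GL_dim_var_def by (rule affine_var_coord) (use that in auto)
  have entry: "(\<lambda>\<gamma>. \<gamma> v $$ (0, 0)) \<in> regular GQ_var" and dinv: "(\<lambda>\<gamma>. inverse (det (\<gamma> v))) \<in> regular GQ_var"
    if "v < 2" for v
    using reg[OF that, of "\<lambda>A. A $$ (0, 0)"] reg[OF that, of "\<lambda>A. inverse (det A)"]
    by (auto simp: GL_coords_def mat_coords_def)
  show "var_morphism GQ_var torus_var (block_embed CQ)"
  proof (rule var_morphism_torusI)
    show "var_morphism GQ_var (GL_var 2) (block_embed CQ)"
    proof (rule var_morphism_GL_varI)
      show "regular_mat GQ_var 2 (block_embed CQ)"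
        unfolding regular_mat_def
      proof (intro allI impI)
        fix i j :: nat assume ij: "i < 2" "j < 2"
        have "(\<lambda>\<gamma>. (if i = j then \<gamma> i $$ (0, 0) else 0)) \<in> regular GQ_var"
          using entry[OF ij(1)] by (cases "i = j") (simp_all add: regular_const)
        then show "(\<lambda>\<gamma>. block_embed CQ \<gamma> $$ (i, j)) \<in> regular GQ_var"
          by (rule regular_cong[rotated]) (use ij in \<open>auto simp: carrier_GQ block_embed_torus_elem less_2_cases_iff\<close>)
      qed
      have "(\<lambda>\<gamma>. inverse (det (\<gamma> 0)) * inverse (det (\<gamma> 1))) \<in> regular GQ_var"
        by (intro regular_intros dinv) simp_all
      then show "(\<lambda>\<gamma>. inverse (det (block_embed CQ \<gamma>))) \<in> regular GQ_var"
        by (rule regular_cong[rotated]) (auto simp: carrier_GQ block_embed_torus_elem)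
    qed (use block_embed_torus torus_GL in auto)
  qed (use block_embed_torus in auto)
  note D = var_morphism_GL_varD[OF var_morphism_torus_GL]
  show "var_morphism torus_var GQ_var (\<lambda>t. torus_elem (t $$ (0, 0)) (t $$ (1, 1)))"
    unfolding GL_dim_var_def
  proof (rule var_morphism_affine_varI)
    fix h assume "h \<in> {\<lambda>\<gamma>. f (\<gamma> v) | f v. v < nverts CQ \<and> f \<in> GL_coords (CD v)}"
    then obtain f v where h: "h = (\<lambda>\<gamma>. f (\<gamma> v))" and v: "v < 2" and f: "f \<in> GL_coords (Suc 0)" by auto
    consider "f = (\<lambda>A. inverse (det A))" | "f = (\<lambda>A. A $$ (0, 0))"
      using f by (auto simp: GL_coords_def mat_coords_def)
    then show "(\<lambda>t. h (torus_elem (t $$ (0, 0)) (t $$ (1, 1)))) \<in> regular torus_var"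
    proof cases
      case 1
      \<comment> \<open>The inverse of one diagonal entry is the other diagonal entry divided by the
        determinant.\<close>
      have "(\<lambda>t. inverse (det t) * t $$ (1 - v, 1 - v)) \<in> regular torus_var"
        by (intro regular_intros D(3) regular_matD[OF D(2)]) simp_all
      then show ?thesis
        by (rule regular_cong[rotated]) (use v in \<open>auto simp: h 1 carrier_torus less_2_cases_iff\<close>)
    next
      case 2
      have "(\<lambda>t. t $$ (v, v)) \<in> regular torus_var" by (intro regular_matD[OF D(2)] v)
      then show ?thesis
        by (rule regular_cong[rotated]) (use v in \<open>auto simp: h 2 less_2_cases_iff\<close>)
    qed
  qed (auto simp: carrier_torus torus_elem_in_GQ simp flip: GL_dim_var_def)
qed (auto simp: carrier_torus block_embed_torus_elem elim!: GQ_cases)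

section \<open>Quiver representations in the coordinates of A4\<close>

abbreviation "QV \<equiv> qrep_var CQ CD"

definition arrow_values :: "complex \<Rightarrow> complex \<Rightarrow> complex \<Rightarrow> complex \<Rightarrow> nat \<Rightarrow> complex mat" where
  "arrow_values a b c d = (\<lambda>i\<in>{0, 1, 2, 3}. m1 ([a, b, c, d] ! i))"

lemma arrow_values_simps [simp]: "arrow_values a b c d 0 = m1 a" "arrow_values a b c d 1 = m1 b" "arrow_values a b c d (Suc 0) = m1 b"
  "arrow_values a b c d 2 = m1 c" "arrow_values a b c d 3 = m1 d"
  by (simp_all add: arrow_values_def)

lemma is_variety_QV [simp]: "is_variety QV"
  by (simp add: qrep_var_def)

lemma points_QV: "points QV = {arrow_values a b c d | a b c d. True}"
proof -
  let ?S = "\<Pi>\<^sub>E a\<in>{0, 1, 2, 3}. carrier_mat (Suc 0) (Suc 0)"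
  have "points QV = ?S" by (simp add: qrep_var_def)
  also have "\<dots> = {arrow_values a b c d | a b c d. True}"
  proof (intro equalityI subsetI)
    fix V :: "nat \<Rightarrow> complex mat" assume V: "V \<in> ?S"
    have "V = arrow_values (V 0 $$ (0, 0)) (V 1 $$ (0, 0)) (V 2 $$ (0, 0)) (V 3 $$ (0, 0))"
    proof (rule extensionalityI[of _ "{0, 1, 2, 3}"])
      fix a :: nat assume a: "a \<in> {0, 1, 2, 3}"
      have "V a = m1 (V a $$ (0, 0))" by (rule mat1_eta[OF PiE_mem[OF V a]])
      then show "V a = arrow_values (V 0 $$ (0, 0)) (V 1 $$ (0, 0)) (V 2 $$ (0, 0)) (V 3 $$ (0, 0)) a"
        using a by auto
    qed (use V in \<open>auto simp: arrow_values_def PiE_iff\<close>)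
    then show "V \<in> {arrow_values a b c d | a b c d. True}" by blast
  next
    fix V assume "V \<in> {arrow_values a b c d | a b c d. True}"
    then obtain a b c d where "V = arrow_values a b c d" by blast
    then show "V \<in> ?S" by (auto simp: arrow_values_def)
  qed
  finally show ?thesis .
qed

lemma regular_QV: "a \<in> {0, 1, 2, 3} \<Longrightarrow> (\<lambda>V. V a $$ (0, 0)) \<in> regular QV"
  unfolding qrep_var_def by (rule affine_var_coord) auto

text \<open>Lower left entries sit on the arrows from the first vertex to the second, upper right
  entries on the arrows back; this permutation restores the order
  \<open>x2, x3, y2, y3\<close>.\<close>

definition arrow_quad :: "(nat \<Rightarrow> complex mat) \<Rightarrow> quad" where
  "arrow_quad V = (V 2 $$ (0, 0), V 0 $$ (0, 0), V 3 $$ (0, 0), V 1 $$ (0, 0))"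

lemma A4_to_qrep_generic_rep: "A4_to_qrep (generic_rep (x2, x3, y2, y3)) = arrow_values x3 y3 x2 y2"
  by (simp add: A4_to_qrep_def arrow_values_def generic_rep_cgen m1_def)

lemma arrow_quad_A4_to_qrep: "arrow_quad (A4_to_qrep (generic_rep v)) = v"
  by (cases v) (simp add: A4_to_qrep_generic_rep arrow_quad_def)

lemma A4_to_qrep_arrow_quad: "V \<in> points QV \<Longrightarrow> A4_to_qrep (generic_rep (arrow_quad V)) = V"
  by (auto simp: points_QV arrow_quad_def A4_to_qrep_generic_rep)

lemma A4_to_qrep_points: "A4_to_qrep (generic_rep v) \<in> points QV"
  by (cases v) (auto simp: A4_to_qrep_generic_rep points_QV)

lemma A4_to_qrep_var_iso: "var_iso A4_var QV A4_to_qrep"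
proof (rule var_isoI[where \<psi> = "\<lambda>V. generic_rep (arrow_quad V)"])
  have reg: "(\<lambda>P. P (cgen a) $$ (i, j)) \<in> regular A4_var" if "i < 2" "j < 2" for a i j
    unfolding A4_var_def by (rule affine_var_coord) (use that in \<open>auto simp: trep2_coords_def\<close>)
  have QV_eq: "QV = affine_var (points QV)
      {\<lambda>V. V a $$ (i, j) | a i j. a \<in> arrows CQ \<and> i < CD (hd_vert CQ a) \<and> j < CD (tl_vert CQ a)}"
    by (simp add: qrep_var_def)
  have reg': "(\<lambda>P. A4_to_qrep P a $$ (0, 0)) \<in> regular A4_var" if "a \<in> {0, 1, 2, 3}" for a
    using that reg[of 0 1] reg[of 1 0] by (auto simp: A4_to_qrep_def m1_def[simplified, symmetric])
  show "var_morphism A4_var QV A4_to_qrep"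
    by (subst QV_eq, rule var_morphism_affine_varI) (auto simp: A4_eq A4_to_qrep_points intro!: reg')
  show "var_morphism QV A4_var (\<lambda>V. generic_rep (arrow_quad V))"
    unfolding A4_var_def
  proof (rule var_morphism_affine_varI)
    fix f assume "f \<in> trep2_coords"
    then obtain a i j where f: "f = (\<lambda>\<phi>. \<phi> (cgen a) $$ (i, j))" "i < 2" "j < 2" by (auto simp: trep2_coords_def)
    have "(\<lambda>V. generic_mat (arrow_quad V) a $$ (i, j)) \<in> regular QV"
      using f(2,3) by (cases a) (auto simp: arrow_quad_def less_2_cases_iff intro!: regular_QV regular_const)
    then show "(\<lambda>V. f (generic_rep (arrow_quad V))) \<in> regular QV" by (simp add: f(1) generic_rep_cgen)
  qed (auto simp: A4_eq)
qed (auto simp: A4_eq arrow_quad_A4_to_qrep A4_to_qrep_arrow_quad)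

lemma rep_act_diag:
  assumes "a \<noteq> 0" "b \<noteq> 0"
  shows "rep_act (m2 a 0 0 b) (generic_rep (x2, x3, y2, y3)) = generic_rep (a * x2 / b, b * x3 / a, a * y2 / b, b * y3 / a)"
proof (rule trep2_eqI)
  show "rep_act (m2 a 0 0 b) (generic_rep (x2, x3, y2, y3)) \<in> trep2"
    using assms by (intro rep_act_trep2 generic_rep_trep2) (simp add: carrier_GL)
  show "rep_act (m2 a 0 0 b) (generic_rep (x2, x3, y2, y3)) (cgen g) = generic_rep (a * x2 / b, b * x3 / a, a * y2 / b, b * y3 / a) (cgen g)" for g
    using assms by (cases g) (simp_all add: rep_act_cgen generic_rep_cgen conj_mat_def inv_diag)
qed (rule generic_rep_trep2)

lemma qrep_act_arrow_values:
  assumes "l \<noteq> 0" "m \<noteq> 0"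
  shows "qrep_act CQ CD (torus_elem l m) (arrow_values a b c d) = arrow_values (m * a / l) (m * b / l) (l * c / m) (l * d / m)"
  using assms inv_GL_1[of l] inv_GL_1[of m] by (auto simp: qrep_act_def arrow_values_def fun_eq_iff restrict_def)

lemma A4_to_qrep_equivariant:
  assumes "\<gamma> \<in> carrier GQ" "P \<in> A4"
  shows "A4_to_qrep (rep_act (block_embed CQ \<gamma>) P) = qrep_act CQ CD \<gamma> (A4_to_qrep P)"
proof -
  obtain l m where \<gamma>: "\<gamma> = torus_elem l m" "l \<noteq> 0" "m \<noteq> 0" using assms(1) by (auto simp: carrier_GQ)
  obtain x2 x3 y2 y3 where "P = generic_rep (x2, x3, y2, y3)" using assms(2) by (auto simp: A4_eq)
  then show ?thesis using \<gamma> by (simp add: block_embed_torus_elem rep_act_diag A4_to_qrep_generic_rep qrep_act_arrow_values)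
qed

section \<open>The quiver order\<close>

text \<open>The action laws pass along an equivariant surjection; \<open>qrep_act\<close> inherits
  them in this way from the torus action on \<open>A4\<close>.\<close>

lemma is_action_transport:
  assumes act: "is_action G E act" and H: "group H" and \<iota>: "\<iota> \<in> hom H G"
    and f: "f ` E = F" and eq: "\<And>h x. h \<in> carrier H \<Longrightarrow> x \<in> E \<Longrightarrow> f (act (\<iota> h) x) = act' h (f x)"
  shows "is_action H F act'"
  unfolding is_action_def
proof (intro conjI ballI H)
  interpret H: group H by (rule H)
  interpret G: group G by (rule is_actionD(1)[OF act])
  interpret group_hom H G \<iota> by unfold_locales (rule \<iota>)
  fix y assume "y \<in> F"
  then obtain x where x: "x \<in> E" "y = f x" using f by blast
  show "act' \<one>\<^bsub>H\<^esub> y = y"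
    using eq[OF H.one_closed x(1)] is_actionD(3)[OF act x(1)] by (simp add: x(2))
  fix g assume g: "g \<in> carrier H"
  have gx: "act (\<iota> g) x \<in> E" by (rule is_actionD(2)[OF act hom_closed[OF g] x(1)])
  show "act' g y \<in> F" unfolding x(2) eq[OF g x(1), symmetric] using f gx by blast
next
  interpret H: group H by (rule H)
  interpret G: group G by (rule is_actionD(1)[OF act])
  interpret group_hom H G \<iota> by unfold_locales (rule \<iota>)
  fix g h y assume gh: "g \<in> carrier H" "h \<in> carrier H" and "y \<in> F"
  then obtain x where x: "x \<in> E" "y = f x" using f by blast
  have hx: "act (\<iota> h) x \<in> E" by (rule is_actionD(2)[OF act hom_closed[OF gh(2)] x(1)])
  show "act' (g \<otimes>\<^bsub>H\<^esub> h) y = act' g (act' h y)"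
    using eq[OF H.m_closed[OF gh] x(1)] eq[OF gh(1) hx] eq[OF gh(2) x(1)]
      is_actionD(4)[OF act hom_closed[OF gh(1)] hom_closed[OF gh(2)] x(1)] hom_mult[OF gh]
    by (simp add: x(2))
qed

lemma A4_to_qrep_image: "A4_to_qrep ` A4 = points QV"
proof (intro equalityI subsetI)
  fix V assume "V \<in> A4_to_qrep ` A4"
  then show "V \<in> points QV" using A4_to_qrep_points by (auto simp: A4_eq)
next
  fix V assume "V \<in> points QV"
  then have V: "V = A4_to_qrep (generic_rep (arrow_quad V))" by (rule A4_to_qrep_arrow_quad[symmetric])
  show "V \<in> A4_to_qrep ` A4" by (subst V, rule imageI) (simp add: A4_eq)
qed

lemma is_action_qrep: "is_action GQ (points QV) (qrep_act CQ CD)"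
  by (rule is_action_transport[OF is_action_torus group_GQ block_embed_hom A4_to_qrep_image])
    (rule A4_to_qrep_equivariant)

section \<open>From the quiver bundle to representations of the conifold algebra\<close>

abbreviation "qact \<equiv> twist_act 2 (block_embed CQ) (qrep_act CQ CD)"
abbreviation "QB \<equiv> quiver_bundle CQ CD"

lemma QB_eq: "QB = quot_var (prod_var (GL_var 2) QV) GQ qact"
  by (simp add: quiver_bundle_def assoc_bundle_def)

lemma points_QB: "points QB = orbits GQ (carrier (GL 2) \<times> points QV) qact"
  by (simp add: QB_eq)

lemma is_variety_QB [simp]: "is_variety QB"
  by (simp add: QB_eq)

lemmas is_action_qact = is_action_twist[OF is_action_qrep block_embed_hom_GL]

lemma QB_cases:
  assumes "c \<in> points QB"
  obtains g v where "g \<in> carrier (GL 2)" "c = orbit GQ qact (g, A4_to_qrep (generic_rep v))"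
proof -
  obtain g V where gV: "g \<in> carrier (GL 2)" "V \<in> points QV" "c = orbit GQ qact (g, V)"
    using assms unfolding points_QB orbits_def by blast
  show thesis
    by (rule that[OF gV(1), of "arrow_quad V"]) (simp only: gV(3) A4_to_qrep_arrow_quad[OF gV(2)])
qed

lemma orbit_points_QB: "g \<in> carrier (GL 2) \<Longrightarrow> orbit GQ qact (g, A4_to_qrep (generic_rep v)) \<in> points QB"
  using A4_to_qrep_points unfolding points_QB orbits_def by blast

definition quiver_bundle_to_rep :: "(complex mat \<times> (nat \<Rightarrow> complex mat)) set \<Rightarrow> ((word \<Rightarrow>\<^sub>0 complex) set \<Rightarrow> complex mat)" where
  "quiver_bundle_to_rep c = (case SOME x. x \<in> c of (g, V) \<Rightarrow> rep_act g (generic_rep (arrow_quad V)))"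

text \<open>The choice of a point in the orbit cancels: a group element with image \<open>t\<close>
  in the torus replaces \<open>rep_act g P\<close> by
  \<open>rep_act (g * inv t) (rep_act t P)\<close>, which is the same representation.\<close>

lemma quiver_bundle_to_rep_orbit:
  assumes "g \<in> carrier (GL 2)" "V \<in> points QV"
  shows "quiver_bundle_to_rep (orbit GQ qact (g, V)) = rep_act g (generic_rep (arrow_quad V))"
proof -
  have x: "(g, V) \<in> carrier (GL 2) \<times> points QV" using assms by simp
  define y where "y = (SOME x. x \<in> orbit GQ qact (g, V))"
  have "y \<in> orbit GQ qact (g, V)"
    unfolding y_def by (rule someI, rule orbit_self[OF is_action_qact x])
  then obtain \<gamma> where \<gamma>: "\<gamma> \<in> carrier GQ" "y = qact \<gamma> (g, V)" by (auto simp: orbit_def)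
  let ?t = "block_embed CQ \<gamma>" and ?P = "generic_rep (arrow_quad V)"
  have t: "?t \<in> carrier torus" by (rule block_embed_torus[OF \<gamma>(1)])
  have P: "?P \<in> A4" by (simp add: A4_eq)
  have "qrep_act CQ CD \<gamma> V = A4_to_qrep (rep_act ?t ?P)"
    using A4_to_qrep_equivariant[OF \<gamma>(1) P] A4_to_qrep_arrow_quad[OF assms(2)] by simp
  moreover obtain v where v: "rep_act ?t ?P = generic_rep v"
    using is_actionD(2)[OF is_action_torus t P] by (auto simp: A4_eq)
  ultimately have "generic_rep (arrow_quad (qrep_act CQ CD \<gamma> V)) = rep_act ?t ?P"
    by (simp add: arrow_quad_A4_to_qrep)
  moreover have "rep_act g ?P = rep_act (g * inv\<^bsub>GL 2\<^esub> ?t) (rep_act ?t ?P)"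
    using t P assms(1) by (subst rep_act_eq_iff)
      (auto simp: twist_act_def GL_mult_closed GL_inv_closed torus_GL is_actionD(2)[OF is_action_torus])
  ultimately show ?thesis
    by (simp add: quiver_bundle_to_rep_def y_def[symmetric] \<gamma>(2)) (simp add: twist_act_def)
qed

lemma quiver_bundle_to_rep_orbit_A4: "g \<in> carrier (GL 2) \<Longrightarrow> quiver_bundle_to_rep (orbit GQ qact (g, A4_to_qrep (generic_rep v))) = rep_act g (generic_rep v)"
  by (simp add: quiver_bundle_to_rep_orbit A4_to_qrep_points arrow_quad_A4_to_qrep)

lemma quiver_bundle_to_rep_trep2: "c \<in> points QB \<Longrightarrow> quiver_bundle_to_rep c \<in> trep2"
  by (erule QB_cases) (simp add: quiver_bundle_to_rep_orbit_A4 rep_act_trep2 generic_rep_trep2)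

lemma var_morphism_quiver_bundle_to_rep: "var_morphism QB trep2_var quiver_bundle_to_rep"
  unfolding QB_eq
proof (rule var_morphism_quot_varI, rule var_morphism_cong)
  let ?E = "prod_var (GL_var 2) QV"
  have "var_morphism QV A4_var (inv_into (points A4_var) A4_to_qrep)"
    and bij: "bij_betw A4_to_qrep A4 (points QV)"
    using A4_to_qrep_var_iso by (simp_all add: var_iso_def)
  then have "var_morphism QV A4_var (\<lambda>V. generic_rep (arrow_quad V))"
  proof (rule_tac var_morphism_cong)
    fix V assume "V \<in> points QV"
    then show "generic_rep (arrow_quad V) = inv_into (points A4_var) A4_to_qrep V"
      using bij_betw_inv_into_left[OF bij, of "generic_rep (arrow_quad V)"] A4_to_qrep_arrow_quad by (simp add: A4_eq)
  qed simp_all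
  from var_morphism_comp[OF var_morphism_snd[of "GL_var 2"] this]
  have "var_morphism ?E trep2_var (\<lambda>x. generic_rep (arrow_quad (snd x)))" by (simp add: var_morphism_A4_var_iff)
  then show "var_morphism ?E trep2_var (\<lambda>x. rep_act (fst x) (generic_rep (arrow_quad (snd x))))"
    by (intro var_morphism_rep_act var_morphism_fst) simp_all
qed (auto simp: quiver_bundle_to_rep_orbit)

lemma regular_mat_mult:
  assumes V: "is_variety V" and A: "regular_mat V 2 A" "\<And>x. x \<in> points V \<Longrightarrow> A x \<in> carrier_mat 2 2"
    and B: "regular_mat V 2 B" "\<And>x. x \<in> points V \<Longrightarrow> B x \<in> carrier_mat 2 2"
  shows "regular_mat V 2 (\<lambda>x. A x * B x)"
  unfolding regular_mat_def
proof (intro allI impI)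
  fix i j :: nat assume ij: "i < 2" "j < 2"
  have "(\<lambda>x. A x $$ (i, 0) * B x $$ (0, j) + A x $$ (i, 1) * B x $$ (1, j)) \<in> regular V"
    by (intro regular_intros V regular_matD[OF A(1)] regular_matD[OF B(1)] ij) simp_all
  then show "(\<lambda>x. (A x * B x) $$ (i, j)) \<in> regular V"
  proof (rule regular_cong[OF V])
    fix x assume "x \<in> points V"
    from A(2)[OF this] B(2)[OF this]
    show "(A x * B x) $$ (i, j) = A x $$ (i, 0) * B x $$ (0, j) + A x $$ (i, 1) * B x $$ (1, j)"
      using ij by (auto simp: scalar_prod_def sum_less_2)
  qed
qed

text \<open>For fixed \<open>p\<close>, the matrix \<open>\<phi> (cl p)\<close> is a finite
  combination of products of generator matrices, hence polynomial in the coordinates of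
  \<open>\<phi>\<close>.\<close>

lemma regular_mat_cl: "regular_mat trep2_var 2 (\<lambda>\<phi>. \<phi> (cl p))"
proof -
  have word: "regular_mat trep2_var 2 (\<lambda>\<phi>. mword (\<lambda>a. \<phi> (cgen a)) w)" for w
  proof (induction w)
    case Nil
    show ?case by (auto simp: regular_mat_def intro!: regular_const)
  next
    case (Cons a w)
    show ?case
      unfolding mword.simps
      by (rule regular_mat_mult[OF _ regular_mat_trep2 _ Cons])
        (auto intro: trep2_cgen_carrier mword_carrier)
  qed
  show ?thesis
    unfolding regular_mat_def
  proof (intro allI impI)
    fix i j :: nat assume ij: "i < 2" "j < 2"
    have "(\<lambda>\<phi>. \<Sum>w\<in>Poly_Mapping.keys p. poly_mapping.lookup p w * mword (\<lambda>a. \<phi> (cgen a)) (letters w) $$ (i, j)) \<in> regular trep2_var"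
      by (intro regular_intros regular_matD[OF word] ij) simp_all
    then show "(\<lambda>\<phi>. \<phi> (cl p) $$ (i, j)) \<in> regular trep2_var"
      by (rule regular_cong[rotated]) (simp_all add: trep2_cl evmat_index ij lin_ext_def)
  qed
qed

lemma quiver_bundle_to_rep_bundle_act:
  assumes "h \<in> carrier (GL 2)" "c \<in> points QB"
  shows "quiver_bundle_to_rep (bundle_act h c) = rep_act h (quiver_bundle_to_rep c)"
proof -
  obtain g v where c: "g \<in> carrier (GL 2)" "c = orbit GQ qact (g, A4_to_qrep (generic_rep v))"
    using QB_cases[OF assms(2)] .
  then show ?thesis
    using bundle_act_orbit[OF is_action_qrep block_embed_hom_GL c(1) assms(1)]
      is_actionD(4)[OF is_action_rep_act assms(1) c(1) generic_rep_trep2]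
    by (simp add: quiver_bundle_to_rep_orbit_A4 GL_mult_closed assms(1))
qed

section \<open>The isomorphism with the quiver order\<close>

abbreviation "QO \<equiv> quiver_order CQ CD"

lemma QO_simps:
  "carrier QO = {F \<in> extensional (points QB). var_morphism QB (mat_var 2) F \<and>
        (\<forall>h\<in>carrier (GL 2). \<forall>c\<in>points QB. F (bundle_act h c) = conj_mat 2 h (F c))}"
  "F \<otimes>\<^bsub>QO\<^esub> G = (\<lambda>c\<in>points QB. F c * G c)" "F \<oplus>\<^bsub>QO\<^esub> G = (\<lambda>c\<in>points QB. F c + G c)"
  "\<one>\<^bsub>QO\<^esub> = (\<lambda>c\<in>points QB. 1\<^sub>m 2)" "z \<odot>\<^bsub>QO\<^esub> F = (\<lambda>c\<in>points QB. z \<cdot>\<^sub>m F c)"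
  by (simp_all add: quiver_order_def Let_def)

text \<open>The tautological map: an element of the algebra becomes the function that evaluates
  representations at it, pulled back to the quiver bundle.\<close>

definition quiver_eval :: "(word \<Rightarrow>\<^sub>0 complex) set \<Rightarrow> (complex mat \<times> (nat \<Rightarrow> complex mat)) set \<Rightarrow> complex mat" where
  "quiver_eval a = (\<lambda>c\<in>points QB. quiver_bundle_to_rep c a)"

lemma bundle_act_points_QB:
  assumes "h \<in> carrier (GL 2)" "c \<in> points QB"
  shows "bundle_act h c \<in> points QB"
proof -
  obtain g v where c: "g \<in> carrier (GL 2)" "c = orbit GQ qact (g, A4_to_qrep (generic_rep v))"
    using QB_cases[OF assms(2)] .
  show ?thesis
    unfolding c(2) bundle_act_orbit[OF is_action_qrep block_embed_hom_GL c(1) assms(1)]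
    by (rule orbit_points_QB[OF GL_mult_closed[OF assms(1) c(1)]])
qed

lemma quiver_eval_carrier: "quiver_eval (cl p) \<in> carrier QO"
proof -
  have "var_morphism QB (mat_var 2) (\<lambda>c. quiver_bundle_to_rep c (cl p))"
    unfolding mat_var_def
  proof (rule var_morphism_affine_varI)
    show "quiver_bundle_to_rep c (cl p) \<in> carrier_mat 2 2" if "c \<in> points QB" for c
      by (rule trep2_simps(1)[OF quiver_bundle_to_rep_trep2[OF that]])
    fix f assume "f \<in> mat_coords 2"
    then obtain i j where f: "f = (\<lambda>A. A $$ (i, j))" "i < 2" "j < 2" by (auto simp: mat_coords_def)
    from var_morphismD(2)[OF var_morphism_quiver_bundle_to_rep regular_matD[OF regular_mat_cl f(2,3)]]
    show "(\<lambda>c. f (quiver_bundle_to_rep c (cl p))) \<in> regular QB" by (simp add: f(1))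
  qed simp
  then have "var_morphism QB (mat_var 2) (quiver_eval (cl p))"
    by (rule var_morphism_cong[rotated]) (simp_all add: quiver_eval_def)
  then show ?thesis
    by (auto simp: QO_simps quiver_eval_def bundle_act_points_QB quiver_bundle_to_rep_bundle_act rep_act_cl)
qed

lemma quiver_eval_hom: "quiver_eval \<in> alg_hom conifold_alg QO"
  unfolding alg_hom_def
proof (intro CollectI conjI allI ballI ring_hom_memI)
  show "quiver_eval x \<in> carrier QO" if "x \<in> carrier conifold_alg" for x
    using that quiver_eval_carrier by (auto simp: carrier_conifold_alg)
  show "quiver_eval (x \<otimes>\<^bsub>conifold_alg\<^esub> y) = quiver_eval x \<otimes>\<^bsub>QO\<^esub> quiver_eval y"
    if "x \<in> carrier conifold_alg" "y \<in> carrier conifold_alg" for x y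
    using that by (auto simp: carrier_conifold_alg quiver_eval_def QO_simps trep2_simps(2)[OF quiver_bundle_to_rep_trep2])
  show "quiver_eval (x \<oplus>\<^bsub>conifold_alg\<^esub> y) = quiver_eval x \<oplus>\<^bsub>QO\<^esub> quiver_eval y"
    if "x \<in> carrier conifold_alg" "y \<in> carrier conifold_alg" for x y
    using that by (auto simp: carrier_conifold_alg quiver_eval_def QO_simps trep2_simps(3)[OF quiver_bundle_to_rep_trep2])
  show "quiver_eval \<one>\<^bsub>conifold_alg\<^esub> = \<one>\<^bsub>QO\<^esub>"
    by (auto simp: quiver_eval_def QO_simps trep2_simps(4)[OF quiver_bundle_to_rep_trep2])
  show "quiver_eval (z \<odot>\<^bsub>conifold_alg\<^esub> x) = z \<odot>\<^bsub>QO\<^esub> quiver_eval x" if "x \<in> carrier conifold_alg" for z x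
    using that by (auto simp: carrier_conifold_alg quiver_eval_def QO_simps trep2_simps(5)[OF quiver_bundle_to_rep_trep2])
qed

text \<open>The classes of \<open>(1, V)\<close>. Their \<open>GL 2\<close>-translates fill the
  bundle, and translates by the torus are again of this form.\<close>

abbreviation base_pt :: "quad \<Rightarrow> (complex mat \<times> (nat \<Rightarrow> complex mat)) set" where
  "base_pt v \<equiv> orbit GQ qact (1\<^sub>m 2, A4_to_qrep (generic_rep v))"

lemma base_pt: "base_pt v \<in> points QB" "quiver_bundle_to_rep (base_pt v) = generic_rep v"
  using is_actionD(3)[OF is_action_rep_act generic_rep_trep2]
  by (simp_all add: orbit_points_QB GL_one_closed quiver_bundle_to_rep_orbit_A4)

text \<open>The class of \<open>(g, V)\<close> is the translate by \<open>g\<close> of the class of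
  \<open>(1, V)\<close>, so equivariance leaves no freedom away from the base points.\<close>

lemma QO_determined:
  assumes F: "F \<in> carrier QO" and G: "G \<in> carrier QO" and eq: "\<And>v. F (base_pt v) = G (base_pt v)"
  shows "F = G"
proof (rule extensionalityI[of _ "points QB"])
  fix c assume "c \<in> points QB"
  then obtain g v where c: "g \<in> carrier (GL 2)" "c = orbit GQ qact (g, A4_to_qrep (generic_rep v))"
    using QB_cases by blast
  have "c = bundle_act g (base_pt v)"
    using bundle_act_orbit[OF is_action_qrep block_embed_hom_GL GL_one_closed c(1)] c
    by (simp add: right_mult_one_mat[OF GL_carrier_mat])
  then show "F c = G c"
    using F G eq[of v] base_pt(1)[of v] c(1) by (simp add: QO_simps)
qed (use F G in \<open>auto simp: QO_simps\<close>)

lemma quiver_eval_base_pt: "quiver_eval (cl p) (base_pt v) = evmat (generic_mat v) p"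
  by (simp add: quiver_eval_def base_pt generic_rep_cl)

text \<open>The values at the base points are evaluations at the generic matrices, and these detect
  the conifold ideal.\<close>

lemma quiver_eval_inj: "inj_on quiver_eval (carrier conifold_alg)"
proof (rule inj_onI)
  fix x y assume "x \<in> carrier conifold_alg" "y \<in> carrier conifold_alg" and eq: "quiver_eval x = quiver_eval y"
  then obtain p q where xy: "x = cl p" "y = cl q" by (auto simp: carrier_conifold_alg)
  have "evmat (generic_mat v) p = evmat (generic_mat v) q" for v
    using arg_cong[OF eq, of "\<lambda>F. F (base_pt v)"] by (simp add: xy quiver_eval_base_pt)
  then have "evmat (generic_mat v) (p - q) = 0\<^sub>m 2 2" for v
    by (simp add: evmat_diff)
  then show "x = y" by (simp add: xy cl_eq_iff conifold_ideal_eq_kernel)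
qed

definition quad_var :: "quad variety" where
  "quad_var = affine_var UNIV {\<lambda>(a, b, c, d). a, \<lambda>(a, b, c, d). b, \<lambda>(a, b, c, d). c, \<lambda>(a, b, c, d). d}"

text \<open>Exponents add up under multiplication of monomials, so the span of the monomials
  contains every polynomial function of the four coordinates.\<close>

lemma regular_quad_var:
  assumes "f \<in> regular quad_var"
  shows "\<exists>p. \<forall>v. f v = lin_ext (\<lambda>m. mono m v) p"
proof -
  obtain g where g: "g \<in> poly_fun {\<lambda>(a, b, c, d). a, \<lambda>(a, b, c, d). b, \<lambda>(a, b, c, d). c, \<lambda>(a, b, c, d). d :: complex}"
      "\<And>v. f v = g v"
    using assms by (auto simp: quad_var_def affine_var_def)
  from g(1) have "\<exists>p. \<forall>v. g v = lin_ext (\<lambda>m. mono m v) p"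
  proof induction
    case (coord h)
    then obtain m where "h = mono m"
    proof -
      have "(\<lambda>(a, b, c, d). a) = mono (1, 0, 0, 0)" "(\<lambda>(a, b, c, d). b) = mono (0, 1, 0, 0)"
        "(\<lambda>(a, b, c, d). c) = mono (0, 0, 1, 0)" "(\<lambda>(a, b, c, d). d) = mono (0, 0, 0, 1)"
        by (auto simp: mono_def)
      then show ?thesis using coord that by auto
    qed
    then show ?case by (intro exI[of _ "Poly_Mapping.single m 1"]) simp
  next
    case (const c)
    show ?case by (intro exI[of _ "Poly_Mapping.single 0 c"]) (simp add: mono_0)
  next
    case (add h k)
    then obtain p q where "\<forall>v. h v = lin_ext (\<lambda>m. mono m v) p" "\<forall>v. k v = lin_ext (\<lambda>m. mono m v) q" by blast
    then show ?case by (intro exI[of _ "p + q"]) (simp add: lin_ext_add)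
  next
    case (mult h k)
    then obtain p q where "\<forall>v. h v = lin_ext (\<lambda>m. mono m v) p" "\<forall>v. k v = lin_ext (\<lambda>m. mono m v) q" by blast
    then show ?case
      by (intro exI[of _ "p * q"]) (simp add: lin_ext_mult mono_add, simp add: lin_ext_def sum_product mult_ac)
  qed
  with g(2) show ?thesis by simp
qed

text \<open>Composed with this morphism, the entries of an element of the quiver order become
  polynomials in four variables.\<close>

lemma var_morphism_base_pt: "var_morphism quad_var QB base_pt"
proof -
  have V: "is_variety quad_var" by (simp add: quad_var_def)
  have "{\<lambda>(a, b, c, d). a, \<lambda>(a, b, c, d). b, \<lambda>(a, b, c, d). c, \<lambda>(a, b, c, d). d} \<subseteq> regular quad_var"
    unfolding quad_var_def by (intro subsetI affine_var_coord)
  then have generic_mat: "(\<lambda>v. generic_mat v a $$ (i, j)) \<in> regular quad_var" if "i < 2" "j < 2" for a i j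
    using that regular_const[OF V] by (cases a) (auto simp: generic_mat_def case_prod_unfold less_2_cases_iff)
  have "var_morphism quad_var trep2_var generic_rep"
    by (rule var_morphism_trep2_varI[OF V generic_rep_trep2]) (auto simp: regular_mat_def generic_rep_cgen generic_mat)
  then have "var_morphism quad_var A4_var generic_rep" by (simp add: var_morphism_A4_var_iff V A4_eq)
  moreover have "var_morphism A4_var QV A4_to_qrep" using A4_to_qrep_var_iso by (simp add: var_iso_def)
  ultimately have "var_morphism quad_var QV (\<lambda>v. A4_to_qrep (generic_rep v))" by (rule var_morphism_comp)
  moreover have "var_morphism quad_var (GL_var 2) (\<lambda>v. 1\<^sub>m 2)"
    by (rule var_morphism_GL_varI[OF V]) (auto simp: GL_one_closed regular_mat_def intro!: regular_const V)
  ultimately have "var_morphism quad_var (prod_var (GL_var 2) QV) (\<lambda>v. (1\<^sub>m 2, A4_to_qrep (generic_rep v)))"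
    by (intro var_morphism_prod_varI V) simp_all
  then show ?thesis
    unfolding QB_eq by (rule var_morphism_comp[OF _ var_morphism_orbit])
qed

lemma quiver_eval_surj: "quiver_eval ` carrier conifold_alg = carrier QO"
proof (intro equalityI subsetI)
  fix F assume F: "F \<in> carrier QO"
  then have mF: "var_morphism QB (mat_var 2) F"
    and eF: "\<And>h c. h \<in> carrier (GL 2) \<Longrightarrow> c \<in> points QB \<Longrightarrow> F (bundle_act h c) = conj_mat 2 h (F c)"
    by (auto simp: QO_simps)
  have mG: "var_morphism quad_var (mat_var 2) (\<lambda>v. F (base_pt v))"
    by (rule var_morphism_comp[OF var_morphism_base_pt mF])
  have "\<exists>p. \<forall>v. F (base_pt v) = evmat (generic_mat v) p"
  proof (rule equivariant_polynomial_matrix)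
    show "F (base_pt v) \<in> carrier_mat 2 2" for v
      using var_morphismD(1)[OF mG, of v] by (simp add: quad_var_def mat_var_def)
    show "\<exists>p. \<forall>v. F (base_pt v) $$ (i, j) = lin_ext (\<lambda>m. mono m v) p" if "i < 2" "j < 2" for i j
    proof (rule regular_quad_var)
      have "(\<lambda>A. A $$ (i, j)) \<in> regular (mat_var 2)"
        unfolding mat_var_def by (rule affine_var_coord) (use that in \<open>auto simp: mat_coords_def\<close>)
      from var_morphismD(2)[OF mG this] show "(\<lambda>v. F (base_pt v) $$ (i, j)) \<in> regular quad_var" .
    qed
    show "F (base_pt (quad_act 2 v)) = m2 2 0 0 1 * F (base_pt v) * m2 (1 / 2) 0 0 1" for v
    proof -
      \<comment> \<open>In the bundle \<open>[1, t.V] = [t, V] = t.[1, V]\<close>, so acting on the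
        coordinates by \<open>diag(2, 1)\<close> amounts to translating the base point.\<close>
      let ?t = "m2 2 0 0 1" and ?\<gamma> = "torus_elem 2 1"
      have t: "?t \<in> carrier (GL 2)" by (simp add: carrier_GL)
      have \<gamma>: "?\<gamma> \<in> carrier GQ" by (simp add: torus_elem_in_GQ)
      obtain x2 x3 y2 y3 where v: "v = (x2, x3, y2, y3)" by (cases v)
      have "generic_rep (quad_act 2 v) = rep_act ?t (generic_rep v)"
        by (simp add: v rep_act_diag quad_act_def)
      then have "A4_to_qrep (generic_rep (quad_act 2 v)) = qrep_act CQ CD ?\<gamma> (A4_to_qrep (generic_rep v))"
        using A4_to_qrep_equivariant[OF \<gamma>, of "generic_rep v"] by (simp add: A4_eq block_embed_torus_elem)
      then have "(1\<^sub>m 2, A4_to_qrep (generic_rep (quad_act 2 v))) = qact ?\<gamma> (?t, A4_to_qrep (generic_rep v))"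
        using GL_inv_right[OF t] by (simp add: twist_act_def block_embed_torus_elem)
      then have "base_pt (quad_act 2 v) = orbit GQ qact (?t, A4_to_qrep (generic_rep v))"
        using orbit_act[OF is_action_qact _ \<gamma>, of "(?t, A4_to_qrep (generic_rep v))"] t A4_to_qrep_points by simp
      also have "\<dots> = bundle_act ?t (base_pt v)"
        using bundle_act_orbit[OF is_action_qrep block_embed_hom_GL GL_one_closed t]
        by (simp add: right_mult_one_mat[OF GL_carrier_mat[OF t]])
      finally show ?thesis
        using eF[OF t base_pt(1)] by (simp add: conj_mat_def inv_diag)
    qed
  qed
  then obtain p where p: "\<And>v. F (base_pt v) = evmat (generic_mat v) p" by blast
  have "F = quiver_eval (cl p)"
    by (rule QO_determined[OF F quiver_eval_carrier]) (simp add: p quiver_eval_base_pt)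
  then show "F \<in> quiver_eval ` carrier conifold_alg" by simp
qed (use quiver_eval_carrier in \<open>auto simp: carrier_conifold_alg\<close>)

theorem quiver_eval_iso: "quiver_eval \<in> alg_iso conifold_alg QO"
  using quiver_eval_hom quiver_eval_inj quiver_eval_surj by (simp add: alg_iso_def bij_betw_def)

theorem proposition5p8:
  shows
    "(\<forall>g\<in>carrier (GL 2). \<forall>g'\<in>carrier (GL 2). \<forall>P\<in>A4. \<forall>P'\<in>A4.
        rep_act g P = rep_act g' P' \<longleftrightarrow>
        (\<exists>c\<in>orbits torus (carrier (GL 2) \<times> A4) torus_act. (g, P) \<in> c \<and> (g', P') \<in> c))
     \<and> principal_bundle torus torus_var torus_act
         (prod_var (GL_var 2) A4_var) torus_bundle (orbit torus torus_act)
     \<and> (\<exists>\<Phi>. var_iso torus_bundle trep2_var \<Phi> \<and>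
          (\<forall>g\<in>carrier (GL 2). \<forall>P\<in>A4. \<Phi> (orbit torus torus_act (g, P)) = rep_act g P) \<and>
          (\<forall>h\<in>carrier (GL 2). \<forall>c\<in>points torus_bundle.
             \<Phi> (bundle_act h c) = rep_act h (\<Phi> c)))
     \<and> bij_betw (\<lambda>c. c \<inter> A4) (orbits (GL 2) trep2 rep_act) (orbits torus A4 rep_act)
     \<and> (block_embed conifold_quiver \<in> iso (GL_dim conifold_quiver conifold_dim) torus \<and>
        var_iso (GL_dim_var conifold_quiver conifold_dim) torus_var
          (block_embed conifold_quiver) \<and>
        var_iso A4_var (qrep_var conifold_quiver conifold_dim) A4_to_qrep \<and>
        (\<forall>\<gamma>\<in>carrier (GL_dim conifold_quiver conifold_dim). \<forall>P\<in>A4.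
           A4_to_qrep (rep_act (block_embed conifold_quiver \<gamma>) P) =
           qrep_act conifold_quiver conifold_dim \<gamma> (A4_to_qrep P)))
     \<and> alg_iso conifold_alg (quiver_order conifold_quiver conifold_dim) \<noteq> {}"
proof (intro conjI)
  show "\<forall>g\<in>carrier (GL 2). \<forall>g'\<in>carrier (GL 2). \<forall>P\<in>A4. \<forall>P'\<in>A4.
        rep_act g P = rep_act g' P' \<longleftrightarrow>
        (\<exists>c\<in>orbits torus (carrier (GL 2) \<times> A4) torus_act. (g, P) \<in> c \<and> (g', P') \<in> c)"
  proof (intro ballI)
    fix g g' P P' assume *: "g \<in> carrier (GL 2)" "g' \<in> carrier (GL 2)" "P \<in> A4" "P' \<in> A4"
    show "rep_act g P = rep_act g' P' \<longleftrightarrow>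
        (\<exists>c\<in>orbits torus (carrier (GL 2) \<times> A4) torus_act. (g, P) \<in> c \<and> (g', P') \<in> c)"
      unfolding rep_act_eq_iff[OF *]
      by (rule same_orbit_iff[OF is_action_torus_act, symmetric]) (use * in simp_all)
  qed
  show "\<exists>\<Phi>. var_iso torus_bundle trep2_var \<Phi> \<and>
          (\<forall>g\<in>carrier (GL 2). \<forall>P\<in>A4. \<Phi> (orbit torus torus_act (g, P)) = rep_act g P) \<and>
          (\<forall>h\<in>carrier (GL 2). \<forall>c\<in>points torus_bundle. \<Phi> (bundle_act h c) = rep_act h (\<Phi> c))"
    using var_iso_bundle_to_rep bundle_to_rep_orbit bundle_to_rep_bundle_act by blast
  show "alg_iso conifold_alg QO \<noteq> {}" using quiver_eval_iso by blast
  show "\<forall>\<gamma>\<in>carrier GQ. \<forall>P\<in>A4. A4_to_qrep (rep_act (block_embed CQ \<gamma>) P) = qrep_act CQ CD \<gamma> (A4_to_qrep P)"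
    using A4_to_qrep_equivariant by blast
qed (rule principal_bundle_torus orbit_correspondence block_embed_iso block_embed_var_iso A4_to_qrep_var_iso)+

end
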